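(* Let $A$ be a connected abelian Lie group with maximal torus $T$, and let $\mathrm{Gas}(A)$ denote its Gaschütz rank. Then $$\mathrm{Gas}(A)=\begin{cases}1 & \text{if } A \text{ is compact},\\ 2\dim A-\dim T & \text{if } A \text{ is non-compact}.\end{cases}$$
   Context: Topological groups are not assumed Hausdorff unless this is explicitly stated. All homomorphisms between topological groups are continuous; an epimorphism is a surjective continuous homomorphism. Elements of a topological group $G$ are said to generate $G$ if the subgroup they abstractly generate is dense in $G$. The maximal torus $T$ of a connected abelian Lie group is its maximal compact subgroup (which is always isomorphic to a torus). Let $f:G\to H$ be an epimorphism between topological groups and let $n\in\mathbb{N}$, where $\mathbb{N}$ denotes the natural numbers. One says that $f$ is $n$-Gaschütz if for every $n$ elements $h_1,\dots,h_n\in H$ that generate $H$ there are lifts $g_1,\dots,g_n\in G$ (that is, $f(g_i)=h_i$ for all $i$) that generate $G$. The Gaschütz rank $\mathrm{Gas}(G)$ of a topological group $G$ is the minimal $m\in\mathbb{N}\cup\{\infty\}$ such that every open epimorphism $f:G\to H$ onto a Hausdorff topological group $H$ is $n$-Gaschütz for every $n\geq m$. *)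

theory Defs
  imports "HOL-Analysis.Analysis" "HOL-Algebra.Generated_Groups"
begin

section \<open>Topological groups\<close>

text \<open>A topological group is a group together with an abstract topology on its carrier.
  It is not assumed to be Hausdorff.\<close>

definition topological_group :: "('a, 'b) monoid_scheme \<Rightarrow> 'a topology \<Rightarrow> bool" where
  "topological_group G X \<longleftrightarrow>
     group G \<and> topspace X = carrier G \<and>
     continuous_map (prod_topology X X) X (\<lambda>(x, y). x \<otimes>\<^bsub>G\<^esub> y) \<and>
     continuous_map X X (\<lambda>x. inv\<^bsub>G\<^esub> x)"

definition open_epimorphism ::
    "('a, 'c) monoid_scheme \<Rightarrow> 'a topology \<Rightarrow> ('b, 'd) monoid_scheme \<Rightarrow> 'b topology
      \<Rightarrow> ('a \<Rightarrow> 'b) \<Rightarrow> bool" where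
  "open_epimorphism G X H Y f \<longleftrightarrow>
     f \<in> hom G H \<and> f ` carrier G = carrier H \<and> continuous_map X Y f \<and> open_map X Y f"

definition topologically_generates ::
    "('a, 'b) monoid_scheme \<Rightarrow> 'a topology \<Rightarrow> 'a set \<Rightarrow> bool" where
  "topologically_generates G X S \<longleftrightarrow> X closure_of (generate G S) = topspace X"

section \<open>Gaschuetz rank\<close>

definition gaschuetz ::
    "nat \<Rightarrow> ('a, 'c) monoid_scheme \<Rightarrow> 'a topology \<Rightarrow> ('b, 'd) monoid_scheme \<Rightarrow> 'b topology
      \<Rightarrow> ('a \<Rightarrow> 'b) \<Rightarrow> bool" where
  "gaschuetz n G X H Y f \<longleftrightarrow>
     (\<forall>h :: nat \<Rightarrow> 'b.
        h ` {..<n} \<subseteq> carrier H \<and> topologically_generates H Y (h ` {..<n}) \<longrightarrow>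
        (\<exists>g :: nat \<Rightarrow> 'a.
           g ` {..<n} \<subseteq> carrier G \<and> (\<forall>i<n. f (g i) = h i) \<and>
           topologically_generates G X (g ` {..<n})))"

text \<open>Natural numbers start at 1 here (with 0 allowed, the trivial group would have rank 0).
  The infimum of the empty set is \<open>\<infinity>\<close>.

  A definition cannot quantify over all target types, so the targets \<open>H\<close> range over groups
  whose elements are subsets of \<open>G\<close>. This is no restriction, since every epimorphic image of \<open>G\<close>
  can be realised on the set of fibres of the epimorphism; see \<open>gaschuetz_rank_all_types\<close>.\<close>

definition gaschuetz_rank :: "('a, 'b) monoid_scheme \<Rightarrow> 'a topology \<Rightarrow> enat" where
  "gaschuetz_rank G X =
     Inf {enat m | m. 1 \<le> m \<and>
       (\<forall>n\<ge>m. \<forall>(H :: 'a set monoid) Y f.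
          topological_group H Y \<and> Hausdorff_space Y \<and> open_epimorphism G X H Y f \<longrightarrow>
          gaschuetz n G X H Y f)}"

lemma gaschuetz_rank_all_types:
  fixes G :: "('a, 'b) monoid_scheme" and H :: "('h, 'c) monoid_scheme"
  assumes G: "group G" and rank: "gaschuetz_rank G X \<le> enat n"
    and H: "topological_group H Y" and Y: "Hausdorff_space Y"
    and f: "open_epimorphism G X H Y f"
  shows "gaschuetz n G X H Y f"
proof -
  interpret G: group G by fact
  interpret H: group H using H by (simp add: topological_group_def)
  have tY: "topspace Y = carrier H"
    and cmult: "continuous_map (prod_topology Y Y) Y (\<lambda>(x, y). x \<otimes>\<^bsub>H\<^esub> y)"
    and cinv: "continuous_map Y Y (\<lambda>x. inv\<^bsub>H\<^esub> x)"
    using H by (auto simp: topological_group_def)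
  have fhom: "f \<in> hom G H" and fsurj: "f ` carrier G = carrier H"
    and fcont: "continuous_map X Y f" and fopen: "open_map X Y f"
    using f by (auto simp: open_epimorphism_def)
  obtain m where m: "m \<le> n"
    and gas: "\<And>n' (H' :: 'a set monoid) Y' f'. \<lbrakk>m \<le> n'; topological_group H' Y';
       Hausdorff_space Y'; open_epimorphism G X H' Y' f'\<rbrakk> \<Longrightarrow> gaschuetz n' G X H' Y' f'"
  proof -
    let ?M = "{enat m | m. 1 \<le> m \<and>
       (\<forall>n\<ge>m. \<forall>(H :: 'a set monoid) Y f.
          topological_group H Y \<and> Hausdorff_space Y \<and> open_epimorphism G X H Y f \<longrightarrow>
          gaschuetz n G X H Y f)}"
    have le: "Inf ?M \<le> enat n"
      using rank by (simp only: gaschuetz_rank_def)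
    have "?M \<noteq> {}"
    proof
      assume empty: "?M = {}"
      have "Inf ({} :: enat set) = \<infinity>" by (simp add: Inf_enat_def)
      then show False using le unfolding empty by simp
    qed
    then have "Inf ?M \<in> ?M" by (meson wellorder_InfI ex_in_conv)
    then show ?thesis using le that by auto
  qed
  define \<phi> where "\<phi> h = {x \<in> carrier G. f x = h}" for h
  define C where "C = \<phi> ` carrier H"
  define \<psi> where "\<psi> = inv_into (carrier H) \<phi>"
  have inj: "inj_on \<phi> (carrier H)"
  proof (rule inj_onI)
    fix a b assume "a \<in> carrier H" "b \<in> carrier H" and eq: "\<phi> a = \<phi> b"
    then obtain x where "x \<in> carrier G" "f x = a" using fsurj by (metis imageE)
    then have "x \<in> \<phi> b" using eq by (auto simp: \<phi>_def)
    then show "a = b" using \<open>f x = a\<close> by (auto simp: \<phi>_def)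
  qed
  have \<psi>\<phi>[simp]: "\<psi> (\<phi> h) = h" if "h \<in> carrier H" for h
    using that inj by (simp add: \<psi>_def)
  have \<psi>C[simp]: "\<psi> c \<in> carrier H" "\<phi> (\<psi> c) = c" if "c \<in> C" for c
    using that by (auto simp: C_def)
  have \<phi>C[simp]: "\<phi> h \<in> C" if "h \<in> carrier H" for h
    using that by (simp add: C_def)
  define H' :: "'a set monoid" where
    "H' = \<lparr>carrier = C, mult = \<lambda>a b. \<phi> (\<psi> a \<otimes>\<^bsub>H\<^esub> \<psi> b), one = \<phi> \<one>\<^bsub>H\<^esub>\<rparr>"
  have H'_simps[simp]: "carrier H' = C" "a \<otimes>\<^bsub>H'\<^esub> b = \<phi> (\<psi> a \<otimes>\<^bsub>H\<^esub> \<psi> b)" "\<one>\<^bsub>H'\<^esub> = \<phi> \<one>\<^bsub>H\<^esub>"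
    for a b by (simp_all add: H'_def)
  have gH': "group H'"
  proof (rule groupI)
    fix x assume "x \<in> carrier H'"
    then show "\<exists>y\<in>carrier H'. y \<otimes>\<^bsub>H'\<^esub> x = \<one>\<^bsub>H'\<^esub>"
      by (intro bexI[of _ "\<phi> (inv\<^bsub>H\<^esub> \<psi> x)"]) auto
  qed (auto simp: H.m_assoc)
  interpret H': group H' by fact
  have inv': "inv\<^bsub>H'\<^esub> c = \<phi> (inv\<^bsub>H\<^esub> \<psi> c)" if "c \<in> C" for c
    by (rule H'.inv_equality) (use that in auto)
  have \<phi>hom: "group_hom H H' \<phi>"
    by unfold_locales (auto simp: hom_def)
  define Y' where "Y' = pullback_topology C \<psi> Y"
  have tY': "topspace Y' = C"
    by (auto simp: Y'_def topspace_pullback_topology tY)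
  have c\<psi>: "continuous_map Y' Y \<psi>"
    using continuous_map_pullback[OF continuous_map_id, of C \<psi> Y] by (simp add: Y'_def)
  have c\<phi>: "continuous_map Y Y' \<phi>"
    unfolding Y'_def
  proof (rule continuous_map_pullback')
    show "continuous_map Y Y (\<psi> \<circ> \<phi>)"
      by (rule continuous_map_eq[OF continuous_map_id]) (simp add: tY)
    show "topspace Y \<subseteq> \<phi> -` C" by (auto simp: tY)
  qed
  have "homeomorphic_maps Y Y' \<phi> \<psi>"
    unfolding homeomorphic_maps_def using c\<phi> c\<psi> by (auto simp: tY tY')
  then have hm: "homeomorphic_map Y Y' \<phi>"
    by (rule homeomorphic_maps_map[THEN iffD1, THEN conjunct1])
  have "topological_group H' Y'"
    unfolding topological_group_def
  proof (intro conjI gH')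
    show "topspace Y' = carrier H'" by (simp add: tY')
    have "continuous_map (prod_topology Y' Y') (prod_topology Y Y) (\<lambda>(x, y). (\<psi> x, \<psi> y))"
      using c\<psi> by (simp add: continuous_map_prod_top)
    from continuous_map_compose[OF continuous_map_compose[OF this cmult] c\<phi>]
    show "continuous_map (prod_topology Y' Y') Y' (\<lambda>(x, y). x \<otimes>\<^bsub>H'\<^esub> y)"
      by (simp add: o_def case_prod_unfold)
    from continuous_map_compose[OF continuous_map_compose[OF c\<psi> cinv] c\<phi>]
    show "continuous_map Y' Y' (\<lambda>x. inv\<^bsub>H'\<^esub> x)"
      by (rule continuous_map_eq) (simp add: tY' inv')
  qed
  moreover have "Hausdorff_space Y'"
    using hm Y homeomorphic_Hausdorff_space homeomorphic_map_imp_homeomorphic_space by blast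
  moreover have "open_epimorphism G X H' Y' (\<phi> \<circ> f)"
    unfolding open_epimorphism_def
  proof (intro conjI)
    show "\<phi> \<circ> f \<in> hom G H'"
      using fhom group_hom.homh[OF \<phi>hom] by (rule hom_compose)
    show "(\<phi> \<circ> f) ` carrier G = carrier H'"
      by (simp only: image_comp[symmetric] fsurj C_def H'_simps)
    show "continuous_map X Y' (\<phi> \<circ> f)"
      using fcont c\<phi> by (rule continuous_map_compose)
    show "open_map X Y' (\<phi> \<circ> f)"
      using fopen homeomorphic_imp_open_map[OF hm] by (rule open_map_compose)
  qed
  ultimately have G': "gaschuetz n G X H' Y' (\<phi> \<circ> f)"
    using gas[OF m] by simp
  show ?thesis
    unfolding gaschuetz_def
  proof (intro allI impI, elim conjE)
    fix h :: "nat \<Rightarrow> 'h"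
    assume hC: "h ` {..<n} \<subseteq> carrier H" and hgen: "topologically_generates H Y (h ` {..<n})"
    have sub: "generate H (h ` {..<n}) \<subseteq> topspace Y"
      using H.generate_incl[OF hC] by (simp add: tY)
    have "generate H' (\<phi> ` h ` {..<n}) = \<phi> ` generate H (h ` {..<n})"
      using group_hom.generate_img[OF \<phi>hom hC] by simp
    then have "Y' closure_of generate H' (\<phi> ` h ` {..<n}) = \<phi> ` topspace Y"
      using homeomorphic_map_closure_of[OF hm sub] hgen
      by (simp add: topologically_generates_def)
    then have "topologically_generates H' Y' ((\<phi> \<circ> h) ` {..<n})"
      unfolding topologically_generates_def image_comp[symmetric] by (simp only: tY tY' C_def)
    moreover have "(\<phi> \<circ> h) ` {..<n} \<subseteq> carrier H'" using hC by auto
    ultimately obtain g where g: "g ` {..<n} \<subseteq> carrier G"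
        "\<forall>i<n. (\<phi> \<circ> f) (g i) = (\<phi> \<circ> h) i" "topologically_generates G X (g ` {..<n})"
      using G'[unfolded gaschuetz_def, rule_format, of "\<phi> \<circ> h"] by auto
    have "f (g i) = h i" if i: "i < n" for i
    proof -
      have "g i \<in> carrier G" "h i \<in> carrier H"
        using i g(1) hC by (simp_all add: image_subset_iff)
      moreover from this have "f (g i) \<in> carrier H" using fsurj by blast
      moreover have "\<phi> (f (g i)) = \<phi> (h i)" using g(2) i by simp
      ultimately show ?thesis using inj by (simp add: inj_on_eq_iff)
    qed
    then show "\<exists>g. g ` {..<n} \<subseteq> carrier G \<and> (\<forall>i<n. f (g i) = h i) \<and>
           topologically_generates G X (g ` {..<n})"
      using g(1,3) by (intro exI[of _ g]) simp
  qed
qed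

section \<open>Lie groups\<close>

text \<open>Functions on an open subset of \<open>Euclidean_space m\<close> (the points of \<open>nat \<Rightarrow> real\<close> that
  vanish from coordinate \<open>m\<close> on) are of class \<open>C\<^sup>k\<close> if all iterated partial derivatives up to
  order \<open>k\<close> exist and are continuous.\<close>

definition partial_deriv :: "nat \<Rightarrow> ((nat \<Rightarrow> real) \<Rightarrow> real) \<Rightarrow> (nat \<Rightarrow> real) \<Rightarrow> real" where
  "partial_deriv i u x = deriv (\<lambda>t. u (x(i := t))) (x i)"

fun Ck_on :: "nat \<Rightarrow> nat \<Rightarrow> (nat \<Rightarrow> real) set \<Rightarrow> ((nat \<Rightarrow> real) \<Rightarrow> real) \<Rightarrow> bool" where
  "Ck_on 0 m S u \<longleftrightarrow> continuous_map (subtopology (Euclidean_space m) S) euclideanreal u"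
| "Ck_on (Suc k) m S u \<longleftrightarrow>
     continuous_map (subtopology (Euclidean_space m) S) euclideanreal u \<and>
     (\<forall>i<m. (\<forall>x\<in>S. (\<lambda>t. u (x(i := t))) field_differentiable at (x i)) \<and>
            Ck_on k m S (partial_deriv i u))"

definition smooth_on ::
    "nat \<Rightarrow> nat \<Rightarrow> (nat \<Rightarrow> real) set \<Rightarrow> ((nat \<Rightarrow> real) \<Rightarrow> nat \<Rightarrow> real) \<Rightarrow> bool" where
  "smooth_on m n S F \<longleftrightarrow>
     openin (Euclidean_space m) S \<and> F ` S \<subseteq> topspace (Euclidean_space n) \<and>
     (\<forall>j<n. \<forall>k. Ck_on k m S (\<lambda>x. F x j))"

text \<open>A chart is a pair of its domain and its coordinate map.\<close>

type_synonym 'a chart = "'a set \<times> ('a \<Rightarrow> nat \<Rightarrow> real)"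

definition smooth_map ::
    "nat \<Rightarrow> 'a chart set \<Rightarrow> nat \<Rightarrow> 'b chart set \<Rightarrow> ('a \<Rightarrow> 'b) \<Rightarrow> bool" where
  "smooth_map m \<A> n \<B> f \<longleftrightarrow>
     (\<forall>(U, \<phi>)\<in>\<A>. \<forall>(V, \<psi>)\<in>\<B>.
        smooth_on m n (\<phi> ` {x \<in> U. f x \<in> V}) (\<psi> \<circ> f \<circ> inv_into U \<phi>))"

definition smooth_atlas :: "nat \<Rightarrow> 'a topology \<Rightarrow> 'a chart set \<Rightarrow> bool" where
  "smooth_atlas n X \<A> \<longleftrightarrow>
     (\<Union>(U, \<phi>)\<in>\<A>. U) = topspace X \<and>
     (\<forall>(U, \<phi>)\<in>\<A>.
        openin X U \<and> openin (Euclidean_space n) (\<phi> ` U) \<and>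
        homeomorphic_map (subtopology X U) (subtopology (Euclidean_space n) (\<phi> ` U)) \<phi>) \<and>
     smooth_map n \<A> n \<A> (\<lambda>x. x)"

definition prod_atlas :: "nat \<Rightarrow> 'a chart set \<Rightarrow> 'b chart set \<Rightarrow> ('a \<times> 'b) chart set" where
  "prod_atlas m \<A> \<B> =
     {(U \<times> V, \<lambda>(x, y) i. if i < m then \<phi> x i else \<psi> y (i - m)) | U \<phi> V \<psi>.
        (U, \<phi>) \<in> \<A> \<and> (V, \<psi>) \<in> \<B>}"

definition lie_structure ::
    "nat \<Rightarrow> ('a, 'b) monoid_scheme \<Rightarrow> 'a topology \<Rightarrow> 'a chart set \<Rightarrow> bool" where
  "lie_structure n G X \<A> \<longleftrightarrow>
     topological_group G X \<and> Hausdorff_space X \<and> second_countable X \<and> smooth_atlas n X \<A> \<and>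
     smooth_map (n + n) (prod_atlas n \<A> \<A>) n \<A> (\<lambda>(x, y). x \<otimes>\<^bsub>G\<^esub> y) \<and>
     smooth_map n \<A> n \<A> (\<lambda>x. inv\<^bsub>G\<^esub> x)"

definition lie_group :: "('a, 'b) monoid_scheme \<Rightarrow> 'a topology \<Rightarrow> bool" where
  "lie_group G X \<longleftrightarrow> (\<exists>n \<A>. lie_structure n G X \<A>)"

text \<open>The dimension is determined by the topology alone, by invariance of dimension.\<close>

definition lie_dim :: "('a, 'b) monoid_scheme \<Rightarrow> 'a topology \<Rightarrow> nat" where
  "lie_dim G X = (THE n. \<exists>\<A>. lie_structure n G X \<A>)"

definition maximal_compact_subgroup ::
    "('a, 'b) monoid_scheme \<Rightarrow> 'a topology \<Rightarrow> 'a set \<Rightarrow> bool" where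
  "maximal_compact_subgroup G X T \<longleftrightarrow>
     subgroup T G \<and> compactin X T \<and>
     (\<forall>K. subgroup K G \<and> compactin X K \<and> T \<subseteq> K \<longrightarrow> K = T)"

end

theory Submission
  imports Defs "HOL-Homology.Invariance_of_Domain" "HOL-Library.Function_Algebras"
begin

text \<open>
  For small \<open>x\<close>, in a chart \<open>p\<close> at the identity, the limit of \<open>q\<^sup>k (x / 2\<^sup>k)\<close>, where \<open>q\<close> is the
  squaring map, exists and is a local homomorphism from the vector group. It extends to an open
  homomorphism onto \<open>A\<close> with discrete kernel \<open>\<Lambda>\<close>. In suitable real coordinates the first \<open>b\<close> coordinates
  on \<open>\<Lambda>\<close> are rational with bounded denominators and the other \<open>a\<close> vanish, so \<open>T\<close> is the image of the
  span of \<open>\<Lambda>\<close>, \<open>dim T = b\<close>, \<open>dim A = a + b\<close> and the asserted rank is \<open>2 a + b\<close> if \<open>a > 0\<close>.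

  By duality, \<open>N\<close> elements of a quotient of a vector group generate it if and only if no nonzero linear
  functional takes integral values on the kernel and on representatives of these elements. The
  functionals that are integral on \<open>\<Lambda>\<close> form \<open>\<real>\<^sup>a \<times> \<int>\<^sup>b\<close>, so generating tuples of length \<open>N\<close> correspond to
  injective homomorphisms from this group to the \<open>N\<close>-torus. A quotient of \<open>A\<close> corresponds to a
  subgroup, and an injective homomorphism is extended from it one coordinate at a time. Adding an
  integral coordinate means avoiding countably many values; making an integral coordinate real means
  choosing integral corrections, and a count of linear conditions leaves room for them when \<open>N \<ge> 2 a + b\<close>.
  For \<open>N = 2 a + b - 1\<close>, the images of \<open>sqrt 2\<close> times the basis vectors generate a torus quotient, but
  the lifts are never generating, by a system of \<open>N\<close> integral linear equations in \<open>N + 1\<close> unknowns.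
\<close>

subsection \<open>Integral linear algebra\<close>

text \<open>The factor 2 in \<open>2 a + b\<close> is a count of unknowns. If no integral correction
  allowed a coordinate to become real, then the zero correction and each unit vector would supply a
  relation. As many rows as there are real columns, including the new one, suffice to pin down the
  real coefficients; each other row contributes two unknowns, the multiplicity of its relation and
  that of its unit vector. So every real column costs two unknowns, and every integral coordinate
  costs one equation. No lattice basis of a kernel is constructed. A real basis taken from the
  kernel is enough, because a functional may be multiplied by a common denominator without changing
  whether it vanishes. Lie groups are given by charts alone, so even the torus needs an explicit
  atlas before its dimension can be computed. Openness of the exponential map comes from invariance
  of domain, which requires only continuity and injectivity of the limit.\<close>

lemma homogeneous_solution:
  fixes M :: "'j \<Rightarrow> 'i \<Rightarrow> 'a::idom"
  assumes "finite J" "finite I" "card J < card I"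
  shows "\<exists>x. (\<exists>i\<in>I. x i \<noteq> 0) \<and> (\<forall>j\<in>J. (\<Sum>i\<in>I. M j i * x i) = 0)"
  using assms
proof (induction J arbitrary: I M rule: finite_induct)
  case empty
  then have "I \<noteq> {}" by auto
  then show ?case by (intro exI[of _ "\<lambda>_. 1"]) auto
next
  case (insert j J)
  show ?case
  proof (cases "\<forall>i\<in>I. M j i = 0")
    case True
    have "card J < card I" using insert by simp
    from insert.IH[OF insert.prems(1) this, of M] obtain x
      where "\<exists>i\<in>I. x i \<noteq> 0" "\<forall>j\<in>J. (\<Sum>i\<in>I. M j i * x i) = 0" by (elim exE conjE)
    then show ?thesis using True by (intro exI[of _ x]) simp
  next
    case False
    then obtain p where p: "p \<in> I" "M j p \<noteq> 0" by blast
    let ?I = "I - {p}"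
    have fin: "finite ?I" and "card J < card ?I"
      using insert p by auto
    \<comment> \<open>Fraction-free elimination: cross-multiplying row \<open>l\<close> with the
      pivot row \<open>j\<close> removes the unknown \<open>p\<close> without division, so integral
      systems get integral solutions.\<close>
    from insert.IH[OF this, of "\<lambda>l i. M j p * M l i - M l p * M j i"]
    obtain x where x: "\<exists>i\<in>?I. x i \<noteq> 0"
      and sol: "\<forall>l\<in>J. (\<Sum>i\<in>?I. (M j p * M l i - M l p * M j i) * x i) = 0" by blast
    \<comment> \<open>The other unknowns are scaled by the pivot, so that row \<open>j\<close>
      determines \<open>y p\<close> without dividing by \<open>M j p\<close>.\<close>
    define y where "y i = (if i = p then - (\<Sum>i\<in>?I. M j i * x i) else M j p * x i)" for i
    have eq: "(\<Sum>i\<in>I. M l i * y i) = M l p * y p + M j p * (\<Sum>i\<in>?I. M l i * x i)" for l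
    proof -
      have "(\<Sum>i\<in>?I. M l i * y i) = (\<Sum>i\<in>?I. M j p * (M l i * x i))"
        by (rule sum.cong) (auto simp: y_def)
      then show ?thesis
        using sum.remove[OF insert.prems(1) p(1), of "\<lambda>i. M l i * y i"]
        by (simp add: sum_distrib_left)
    qed
    have "(\<Sum>i\<in>I. M l i * y i) = 0" if "l \<in> J" for l
    proof -
      have "(\<Sum>i\<in>?I. (M j p * M l i - M l p * M j i) * x i)
          = M j p * (\<Sum>i\<in>?I. M l i * x i) - M l p * (\<Sum>i\<in>?I. M j i * x i)"
        by (simp add: sum_distrib_left left_diff_distrib sum_subtractf mult.assoc)
      then have "M j p * (\<Sum>i\<in>?I. M l i * x i) - M l p * (\<Sum>i\<in>?I. M j i * x i) = 0"
        using sol that by simp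
      then show ?thesis unfolding eq by (simp add: y_def)
    qed
    moreover have "(\<Sum>i\<in>I. M j i * y i) = 0" unfolding eq by (simp add: y_def)
    moreover have "\<exists>i\<in>I. y i \<noteq> 0" using x p(2) by (auto simp: y_def)
    ultimately show ?thesis by (intro exI[of _ y]) auto
  qed
qed

text \<open>A minimal set \<open>J\<close> of columns that still detects every nonzero vector has,
  for each column \<open>j\<close> in it, a vector \<open>X j\<close> killed by all of
  \<open>J\<close> except \<open>j\<close>. These vectors are independent, so \<open>J\<close> has
  at most \<open>card R\<close> elements. It is the choice of a nonsingular minor without
  determinants.\<close>

lemma independent_columns_minor:
  fixes \<alpha> :: "'i \<Rightarrow> 'k \<Rightarrow> 'a::idom"
  assumes "finite R" "finite K"
    and inj: "\<And>x. \<lbrakk>\<forall>k\<in>K. (\<Sum>i\<in>R. x i * \<alpha> i k) = 0\<rbrakk> \<Longrightarrow> \<forall>i\<in>R. x i = 0"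
  obtains J where "J \<subseteq> K" "card J \<le> card R"
    and "\<And>x. \<lbrakk>\<forall>k\<in>J. (\<Sum>i\<in>R. x i * \<alpha> i k) = 0\<rbrakk> \<Longrightarrow> \<forall>i\<in>R. x i = 0"
proof -
  let ?P = "\<lambda>J. J \<subseteq> K \<and> (\<forall>x. (\<forall>k\<in>J. (\<Sum>i\<in>R. x i * \<alpha> i k) = 0) \<longrightarrow> (\<forall>i\<in>R. x i = 0))"
  have "?P K" using inj by simp
  from ex_has_least_nat[of ?P, OF this, of card]
  obtain J where "?P J \<and> (\<forall>J'. ?P J' \<longrightarrow> card J \<le> card J')" ..
  then have J: "?P J" and least: "?P J' \<Longrightarrow> card J \<le> card J'" for J'
    by simp_all
  have finJ: "finite J" using J by (intro finite_subset[OF _ assms(2)]) simp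
  have "\<exists>x. (\<forall>k\<in>J - {j}. (\<Sum>i\<in>R. x i * \<alpha> i k) = 0) \<and> (\<exists>i\<in>R. x i \<noteq> 0)" if "j \<in> J" for j
  proof (rule ccontr)
    assume "\<not> ?thesis"
    then have "\<forall>x. (\<forall>k\<in>J - {j}. (\<Sum>i\<in>R. x i * \<alpha> i k) = 0) \<longrightarrow> (\<forall>i\<in>R. x i = 0)"
      unfolding not_ex de_Morgan_conj bex_simps not_not imp_conv_disj .
    then have "?P (J - {j})" using J by (intro conjI) auto
    then have "card J \<le> card (J - {j})" by (rule least)
    then show False using card_Diff1_less[OF finJ that] by linarith
  qed
  then have "\<forall>j\<in>J. \<exists>x. (\<forall>k\<in>J - {j}. (\<Sum>i\<in>R. x i * \<alpha> i k) = 0) \<and> (\<exists>i\<in>R. x i \<noteq> 0)" ..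
  from bchoice[OF this] obtain X
    where X: "\<forall>j\<in>J. (\<forall>k\<in>J - {j}. (\<Sum>i\<in>R. X j i * \<alpha> i k) = 0) \<and> (\<exists>i\<in>R. X j i \<noteq> 0)" ..
  have X0: "(\<Sum>i\<in>R. X j i * \<alpha> i k) = 0" if "j \<in> J" "k \<in> J - {j}" for j k
    using X that by simp
  have Xn: "\<exists>i\<in>R. X j i \<noteq> 0" if "j \<in> J" for j using X that by simp
  have Xj: "(\<Sum>i\<in>R. X j i * \<alpha> i j) \<noteq> 0" if "j \<in> J" for j
  proof
    assume "(\<Sum>i\<in>R. X j i * \<alpha> i j) = 0"
    then have "\<forall>k\<in>J. (\<Sum>i\<in>R. X j i * \<alpha> i k) = 0" using X0[OF that] by (auto simp: Ball_def)
    then have "\<forall>i\<in>R. X j i = 0" using J by simp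
    then show False using Xn[OF that] by simp
  qed
  have "card J \<le> card R"
  proof (rule ccontr)
    assume "\<not> ?thesis"
    then have "card R < card J" by simp
    \<comment> \<open>More than \<open>card R\<close> vectors \<open>X j\<close> satisfy a linear
      relation; evaluated at column \<open>j\<close> it keeps only the term with
      \<open>c j\<close>.\<close>
    from homogeneous_solution[OF assms(1) finJ this, of "\<lambda>i j. X j i"]
    obtain c where c: "\<exists>j\<in>J. c j \<noteq> 0" and sol: "\<forall>i\<in>R. (\<Sum>j\<in>J. X j i * c j) = 0" by blast
    from c obtain j where j: "j \<in> J" "c j \<noteq> 0" by blast
    have "0 = (\<Sum>i\<in>R. (\<Sum>l\<in>J. X l i * c l) * \<alpha> i j)" using sol by simp
    also have "\<dots> = (\<Sum>l\<in>J. c l * (\<Sum>i\<in>R. X l i * \<alpha> i j))"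
      unfolding sum_distrib_right sum_distrib_left
      by (subst sum.swap) (simp add: ac_simps)
    also have "\<dots> = c j * (\<Sum>i\<in>R. X j i * \<alpha> i j)"
    proof -
      have "(\<Sum>l\<in>J - {j}. c l * (\<Sum>i\<in>R. X l i * \<alpha> i j)) = 0"
      proof (rule sum.neutral, rule ballI)
        fix l assume "l \<in> J - {j}"
        then have "(\<Sum>i\<in>R. X l i * \<alpha> i j) = 0" using j(1) by (intro X0) auto
        then show "c l * (\<Sum>i\<in>R. X l i * \<alpha> i j) = 0" by simp
      qed
      then show ?thesis by (subst sum.remove[OF finJ j(1)]) simp
    qed
    finally have "c j * (\<Sum>i\<in>R. X j i * \<alpha> i j) = 0" ..
    then show False using j(2) Xj[OF j(1)] by simp
  qed
  then show ?thesis using J by (intro that[of J]) auto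
qed

text \<open>Injectivity of the homomorphism with columns \<open>\<alpha> i\<close> from the group of all \<open>x\<close> with real
  coordinates in \<open>S\<close> and integral coordinates in \<open>Q\<close> to the torus of dimension \<open>N\<close>.\<close>

definition torus_injective :: "'i set \<Rightarrow> 'i set \<Rightarrow> nat \<Rightarrow> ('i \<Rightarrow> nat \<Rightarrow> real) \<Rightarrow> bool" where
  "torus_injective S Q N \<alpha> \<longleftrightarrow>
     (\<forall>x. (\<forall>i\<in>Q. x i \<in> \<int>) \<and> (\<forall>k<N. (\<Sum>i\<in>S \<union> Q. x i * \<alpha> i k) \<in> \<int>) \<longrightarrow> (\<forall>i\<in>S \<union> Q. x i = 0))"

lemma torus_injectiveD:
  "\<lbrakk>torus_injective S Q N \<alpha>; \<forall>i\<in>Q. x i \<in> \<int>; \<forall>k<N. (\<Sum>i\<in>S \<union> Q. x i * \<alpha> i k) \<in> \<int>; i \<in> S \<union> Q\<rbrakk>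
   \<Longrightarrow> x i = 0"
  unfolding torus_injective_def by blast

section \<open>Extending injective homomorphisms to a torus by one coordinate\<close>

lemma countable_integer_combinations:
  fixes \<beta> :: "'i \<Rightarrow> real"
  assumes "finite Q"
  shows "countable {r. \<exists>f. (\<forall>i\<in>Q. f i \<in> \<int>) \<and> r = (\<Sum>i\<in>Q. f i * \<beta> i)}" (is "countable ?R")
proof -
  have "?R \<subseteq> (\<lambda>f. \<Sum>i\<in>Q. f i * \<beta> i) ` (\<Pi>\<^sub>E i\<in>Q. \<int>)"
  proof
    fix r assume "r \<in> ?R"
    then obtain f where f: "\<forall>i\<in>Q. f i \<in> \<int>" "r = (\<Sum>i\<in>Q. f i * \<beta> i)" by blast
    then have "restrict f Q \<in> (\<Pi>\<^sub>E i\<in>Q. \<int>)" "r = (\<Sum>i\<in>Q. restrict f Q i * \<beta> i)" by auto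
    then show "r \<in> (\<lambda>f. \<Sum>i\<in>Q. f i * \<beta> i) ` (\<Pi>\<^sub>E i\<in>Q. \<int>)" by blast
  qed
  moreover have "countable (\<Pi>\<^sub>E i\<in>Q. (\<int>::real set))"
    using assms by (intro countable_PiE) (auto simp: Ints_def)
  ultimately show ?thesis by (meson countable_image countable_subset)
qed

text \<open>With fewer than \<open>N\<close> real columns some \<eta> is orthogonal to all of them,
  and pairing with \<eta> removes the real unknowns. What remains relates integral combinations of
  finitely many numbers, so only countably many values of the pairing of the new column with \<eta>
  allow \<open>x i\<close> to be nonzero.\<close>

lemma torus_injective_add_integer:
  assumes fin: "finite S" "finite Q" and i: "i \<notin> S \<union> Q" and SQ: "S \<inter> Q = {}"
    and N: "card S < N" and inj: "torus_injective S Q N \<alpha>"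
  shows "\<exists>v. torus_injective S (insert i Q) N (\<alpha>(i := v))"
proof -
  from homogeneous_solution[OF fin(1), of "{..<N}" \<alpha>] N
  obtain \<eta> where \<eta>: "\<exists>k<N. \<eta> k \<noteq> 0" "\<forall>s\<in>S. (\<Sum>k<N. \<alpha> s k * \<eta> k) = 0" by auto
  then obtain k0 where k0: "k0 < N" "\<eta> k0 \<noteq> 0" by blast
  define A where "A j = (\<Sum>k<N. \<alpha> j k * \<eta> k)" for j
  define R1 where "R1 = {r. \<exists>f. (\<forall>k\<in>{..<N}. f k \<in> \<int>) \<and> r = (\<Sum>k<N. f k * \<eta> k)}"
  define R2 where "R2 = {r. \<exists>f. (\<forall>j\<in>Q. f j \<in> \<int>) \<and> r = (\<Sum>j\<in>Q. f j * A j)}"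
  \<comment> \<open>The values of \<open>r\<close> that solve \<open>m * r + b = a\<close> with
    nonzero integral \<open>m\<close>; the case \<open>m = 0\<close> only adds the value 0.\<close>
  define Bad where "Bad = (\<lambda>(m, a, b). (a - b) / m) ` (\<int> \<times> R1 \<times> R2)"
  have "countable R1" "countable R2"
    unfolding R1_def R2_def using fin by (auto intro!: countable_integer_combinations)
  then have "countable Bad"
    unfolding Bad_def by (intro countable_image countable_SIGMA) (auto simp: Ints_def)
  then obtain r where r: "r \<notin> Bad"
    using uncountable_UNIV_real by (metis UNIV_eq_I)
  \<comment> \<open>A column concentrated at \<open>k0\<close>, where \<eta> does not vanish, can be
    given the pairing \<open>r\<close> with \<eta>.\<close>
  define v where "v k = (if k = k0 then r / \<eta> k0 else 0)" for k
  have veta: "(\<Sum>k<N. v k * \<eta> k) = r"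
  proof -
    have "(\<Sum>k<N. v k * \<eta> k) = (\<Sum>k<N. if k = k0 then r else 0)"
      using k0 by (intro sum.cong) (auto simp: v_def)
    then show ?thesis using k0 by simp
  qed
  have "torus_injective S (insert i Q) N (\<alpha>(i := v))"
    unfolding torus_injective_def
  proof (intro allI impI, elim conjE)
    fix x :: "'a \<Rightarrow> real"
    let ?\<beta> = "\<alpha>(i := v)"
    assume xZ: "\<forall>j\<in>insert i Q. x j \<in> \<int>"
      and sZ: "\<forall>k<N. (\<Sum>j\<in>S \<union> insert i Q. x j * ?\<beta> j k) \<in> \<int>"
    define w where "w k = (\<Sum>j\<in>S \<union> insert i Q. x j * ?\<beta> j k)" for k
    have w: "w k = x i * v k + (\<Sum>j\<in>S \<union> Q. x j * \<alpha> j k)" for k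
    proof -
      have "w k = x i * v k + (\<Sum>j\<in>S \<union> Q. x j * ?\<beta> j k)"
        unfolding w_def using i fin by (simp add: Un_insert_right)
      also have "(\<Sum>j\<in>S \<union> Q. x j * ?\<beta> j k) = (\<Sum>j\<in>S \<union> Q. x j * \<alpha> j k)"
        using i by (intro sum.cong) auto
      finally show ?thesis .
    qed
    have "(\<Sum>k<N. w k * \<eta> k) = x i * r + (\<Sum>j\<in>Q. x j * A j)"
    proof -
      have "(\<Sum>k<N. w k * \<eta> k)
          = (\<Sum>k<N. x i * (v k * \<eta> k)) + (\<Sum>k<N. \<Sum>j\<in>S \<union> Q. x j * (\<alpha> j k * \<eta> k))"
        unfolding w by (simp add: distrib_right sum.distrib sum_distrib_right mult.assoc)
      also have "(\<Sum>k<N. \<Sum>j\<in>S \<union> Q. x j * (\<alpha> j k * \<eta> k)) = (\<Sum>j\<in>S \<union> Q. x j * A j)"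
        unfolding A_def sum_distrib_left by (rule sum.swap)
      also have "(\<Sum>j\<in>S \<union> Q. x j * A j) = (\<Sum>j\<in>Q. x j * A j)"
        using fin SQ \<eta>(2) by (subst sum.union_disjoint) (auto simp: A_def)
      also have "(\<Sum>k<N. x i * (v k * \<eta> k)) = x i * r"
        by (simp add: veta flip: sum_distrib_left)
      finally show ?thesis .
    qed
    moreover have "(\<Sum>k<N. w k * \<eta> k) \<in> R1"
      unfolding R1_def using sZ by (auto simp: w_def)
    moreover have "(\<Sum>j\<in>Q. x j * A j) \<in> R2"
      unfolding R2_def using xZ by auto
    ultimately have "x i = 0"
    proof -
      assume *: "(\<Sum>k<N. w k * \<eta> k) = x i * r + (\<Sum>j\<in>Q. x j * A j)"
        "(\<Sum>k<N. w k * \<eta> k) \<in> R1" "(\<Sum>j\<in>Q. x j * A j) \<in> R2"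
      show "x i = 0"
      proof (rule ccontr)
        assume "x i \<noteq> 0"
        then have "r = ((\<Sum>k<N. w k * \<eta> k) - (\<Sum>j\<in>Q. x j * A j)) / x i"
          using *(1) by (simp add: field_simps)
        then have "r \<in> Bad"
          unfolding Bad_def using * xZ
          by (intro image_eqI[of _ _ "(x i, (\<Sum>k<N. w k * \<eta> k), (\<Sum>j\<in>Q. x j * A j))"]) auto
        then show False using r by simp
      qed
    qed
    moreover from this have "\<forall>k<N. (\<Sum>j\<in>S \<union> Q. x j * \<alpha> j k) \<in> \<int>"
      using sZ w unfolding w_def by simp
    ultimately show "\<forall>j\<in>S \<union> insert i Q. x j = 0"
      using inj xZ unfolding torus_injective_def by blast
  qed
  then show ?thesis by blast
qed

text \<open>If every integral correction failed, the corrections 0 and \<open>e k\<close> would give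
  relations \<open>y\<close> and \<open>x k\<close> with nonzero coordinate at \<open>i\<close>. An
  integral combination of them that cancels all integral data is a purely real relation, which the
  independence of the real columns refutes. The hypothesis on \<open>N\<close> says that this
  combination has more unknowns than equations.\<close>

lemma torus_injective_integer_to_real:
  assumes fin: "finite S" "finite Q" and i: "i \<in> Q" and SQ: "S \<inter> Q = {}"
    and N: "2 * card S + card Q < N" and inj: "torus_injective S Q N \<alpha>"
  shows "\<exists>z. (\<forall>k. z k \<in> \<int>) \<and>
    torus_injective (insert i S) (Q - {i}) N (\<alpha>(i := \<lambda>k. \<alpha> i k + z k))"
proof (rule ccontr)
  assume contr: "\<not> ?thesis"
  let ?Q = "Q - {i}"
  have iS: "i \<notin> S" using i SQ by blast
  have un: "insert i S \<union> ?Q = S \<union> Q" using i by blast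
  have split: "(\<Sum>j\<in>S \<union> Q. g j) = (\<Sum>j\<in>insert i S. g j) + (\<Sum>j\<in>?Q. g j)" for g :: "_ \<Rightarrow> real"
    unfolding un[symmetric] using fin SQ i by (intro sum.union_disjoint) auto
  have ex: "\<exists>x. (\<forall>j\<in>?Q. x j \<in> \<int>) \<and> x i \<noteq> 0 \<and>
      (\<forall>k<N. (\<Sum>j\<in>S \<union> Q. x j * \<alpha> j k) + x i * z k \<in> \<int>)"
    if z: "\<forall>k. z k \<in> \<int>" for z
  proof -
    let ?\<beta> = "\<alpha>(i := \<lambda>k. \<alpha> i k + z k)"
    from contr z obtain x where xZ: "\<forall>j\<in>?Q. x j \<in> \<int>"
      and s: "\<forall>k<N. (\<Sum>j\<in>S \<union> Q. x j * ?\<beta> j k) \<in> \<int>" and x: "\<exists>j\<in>S \<union> Q. x j \<noteq> 0"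
      unfolding torus_injective_def un by blast
    have eq: "(\<Sum>j\<in>S \<union> Q. x j * ?\<beta> j k) = (\<Sum>j\<in>S \<union> Q. x j * \<alpha> j k) + x i * z k" for k
    proof -
      have "(\<Sum>j\<in>S \<union> Q. x j * ?\<beta> j k)
          = (\<Sum>j\<in>S \<union> Q. x j * \<alpha> j k + (if j = i then x i * z k else 0))"
        by (intro sum.cong) (auto simp: algebra_simps)
      also have "\<dots> = (\<Sum>j\<in>S \<union> Q. x j * \<alpha> j k) + x i * z k"
        using i fin by (simp add: sum.distrib)
      finally show ?thesis .
    qed
    have "x i \<noteq> 0"
    proof
      assume "x i = 0"
      then have "\<forall>j\<in>Q. x j \<in> \<int>" "\<forall>k<N. (\<Sum>j\<in>S \<union> Q. x j * \<alpha> j k) \<in> \<int>"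
        using xZ s unfolding eq by auto
      with torus_injectiveD[OF inj] x show False by blast
    qed
    then show ?thesis using xZ s unfolding eq by blast
  qed
  define e :: "nat \<Rightarrow> nat \<Rightarrow> real" where "e k l = (if l = k then 1 else 0)" for k l
  from ex[of "\<lambda>_. 0"] obtain y where yZ: "\<forall>j\<in>?Q. y j \<in> \<int>" and yi: "y i \<noteq> 0"
    and ys: "\<forall>l<N. (\<Sum>j\<in>S \<union> Q. y j * \<alpha> j l) \<in> \<int>" by auto
  have "\<forall>k. \<exists>x. (\<forall>j\<in>?Q. x j \<in> \<int>) \<and> x i \<noteq> 0 \<and>
      (\<forall>l<N. (\<Sum>j\<in>S \<union> Q. x j * \<alpha> j l) + x i * e k l \<in> \<int>)"
    using ex[of "e k" for k] by (auto simp: e_def)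
  then obtain x where xZ: "\<And>k j. j \<in> ?Q \<Longrightarrow> x k j \<in> \<int>" and xi: "\<And>k. x k i \<noteq> 0"
    and xs: "\<And>k l. l < N \<Longrightarrow> (\<Sum>j\<in>S \<union> Q. x k j * \<alpha> j l) + x k i * e k l \<in> \<int>"
    by metis
  \<comment> \<open>If \<open>x k i\<close> were rational, a multiple of \<open>x k\<close> would be
    integral at \<open>i\<close>. The correction by \<open>e k\<close> would then add integers only,
    and the multiple would be a relation for the uncorrected \<alpha>.\<close>
  have irrational: "b = 0" if "of_int a + of_int b * x k i = 0" for a b k
  proof (rule ccontr)
    assume b: "b \<noteq> 0"
    let ?x = "\<lambda>j. of_int b * x k j"
    have bi: "?x i = - of_int a" using that by simp
    have "\<forall>j\<in>Q. ?x j \<in> \<int>"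
    proof
      fix j assume "j \<in> Q"
      then show "?x j \<in> \<int>" using xZ[of j k] bi by (cases "j = i") auto
    qed
    moreover have "(\<Sum>j\<in>S \<union> Q. ?x j * \<alpha> j l) \<in> \<int>" if "l < N" for l
    proof -
      have "(\<Sum>j\<in>S \<union> Q. ?x j * \<alpha> j l)
          = of_int b * ((\<Sum>j\<in>S \<union> Q. x k j * \<alpha> j l) + x k i * e k l) + of_int a * e k l"
        using bi by (simp add: sum_distrib_left mult.assoc algebra_simps e_def)
      also have "\<dots> \<in> \<int>"
        by (intro Ints_add Ints_mult[OF Ints_of_int] xs[OF that]) (auto simp: e_def)
      finally show ?thesis .
    qed
    ultimately have "?x i = 0" using torus_injectiveD[OF inj, of ?x i] i by blast
    then show False using b xi by simp
  qed
  have colinj: "\<forall>j\<in>insert i S. c j = 0"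
    if "\<forall>l\<in>{..<N}. (\<Sum>j\<in>insert i S. c j * \<alpha> j l) = 0" for c
  proof -
    \<comment> \<open>Scaling makes the coordinate at \<open>i\<close> equal to 0 or 1, hence
      integral, so \<open>inj\<close> applies although it still treats \<open>i\<close> as an
      integral coordinate.\<close>
    let ?d = "\<lambda>j. if j \<in> insert i S then if c i = 0 then c j else c j / c i else 0"
    have "(\<Sum>j\<in>S \<union> Q. ?d j * \<alpha> j l) = 0" if "l < N" for l
    proof -
      have "(\<Sum>j\<in>S \<union> Q. ?d j * \<alpha> j l) = (\<Sum>j\<in>insert i S. ?d j * \<alpha> j l)"
        using fin i by (intro sum.mono_neutral_right) auto
      also have "\<dots> = (\<Sum>j\<in>insert i S. c j * \<alpha> j l) / (if c i = 0 then 1 else c i)"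
        unfolding sum_divide_distrib by (intro sum.cong) auto
      also have "\<dots> = 0" using \<open>\<forall>l\<in>{..<N}. _ l = 0\<close> that by simp
      finally show ?thesis .
    qed
    then have dN: "\<forall>l<N. (\<Sum>j\<in>S \<union> Q. ?d j * \<alpha> j l) \<in> \<int>" by simp
    have dQ: "\<forall>j\<in>Q. ?d j \<in> \<int>" using SQ by auto
    have d0: "?d j = 0" if "j \<in> S \<union> Q" for j
      by (rule torus_injectiveD[OF inj dQ dN that])
    have "c i = 0"
    proof (rule ccontr)
      assume "c i \<noteq> 0"
      then show False using d0[of i] i by simp
    qed
    show ?thesis
    proof
      fix j assume j: "j \<in> insert i S"
      then have "j \<in> S \<union> Q" using i by auto
      from d0[OF this] j \<open>c i = 0\<close> show "c j = 0" by simp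
    qed
  qed
  \<comment> \<open>At most \<open>card S + 1\<close> rows determine the coefficients of the real
    columns. The relations \<open>x k\<close> are used only for the other rows
    \<open>k\<close>.\<close>
  obtain J where J: "J \<subseteq> {..<N}" "card J \<le> card (insert i S)"
    and Jinj: "\<And>c. \<forall>l\<in>J. (\<Sum>j\<in>insert i S. c j * \<alpha> j l) = 0 \<Longrightarrow> \<forall>j\<in>insert i S. c j = 0"
    by (rule independent_columns_minor[of "insert i S" "{..<N}" \<alpha>, OF _ _ colinj])
      (simp_all add: fin(1))
  define K where "K = {..<N} - J"
  have finK: "finite K" by (simp add: K_def)
  have cardK: "N \<le> card K + card S + 1"
    using J iS fin(1) by (simp add: K_def card_Diff_subset finite_subset[OF J(1)])
  \<comment> \<open>Unknowns: \<open>(0, k)\<close> is the multiplicity of the unit vector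
    \<open>e k\<close>, \<open>(1, k)\<close> that of \<open>x k\<close>, and \<open>(2, 0)\<close>
    that of \<open>y\<close>. Equations: \<open>Inl j\<close> cancels the integral coordinate
    \<open>j\<close>, and \<open>Inr l\<close> cancels the integer in row \<open>l\<close>.\<close>
  define U where "U = {0, 1} \<times> K \<union> {(2::nat, 0::nat)}"
  define E where "E = Inl ` ?Q \<union> Inr ` {..<N}"
  have "card U = 2 * card K + 1"
    unfolding U_def using finK by (subst card_Un_disjoint) (auto simp: card_cartesian_product)
  moreover have "card E = (card Q - 1) + N"
    unfolding E_def using fin i by (subst card_Un_disjoint) (auto simp: card_image)
  moreover have "card Q > 0" using i fin card_gt_0_iff by blast
  \<comment> \<open>At least \<open>2 * (N - card S - 1) + 1\<close> unknowns stand against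
    \<open>card Q - 1 + N\<close> equations.\<close>
  ultimately have cardlt: "card E < card U" using cardK N by linarith
  define wx where "wx k l = (\<Sum>j\<in>S \<union> Q. x k j * \<alpha> j l) + x k i * e k l" for k l
  define wy where "wy l = (\<Sum>j\<in>S \<union> Q. y j * \<alpha> j l)" for l
  define M :: "'a + nat \<Rightarrow> nat \<times> nat \<Rightarrow> int" where
    "M q u = (case q of
        Inl j \<Rightarrow> if fst u = 0 then 0 else if fst u = 1 then \<lfloor>x (snd u) j\<rfloor> else \<lfloor>y j\<rfloor>
      | Inr l \<Rightarrow> if fst u = 0 then (if l = snd u then 1 else 0)
          else if fst u = 1 then \<lfloor>wx (snd u) l\<rfloor> else \<lfloor>wy l\<rfloor>)" for q u
  have "finite E" "finite U" using fin finK by (auto simp: E_def U_def)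
  from homogeneous_solution[OF this cardlt, of M] obtain c
    where c: "\<exists>u\<in>U. c u \<noteq> 0" and sol: "\<forall>q\<in>E. (\<Sum>u\<in>U. M q u * c u) = 0" by blast
  have sumU: "(\<Sum>u\<in>U. g u) = (\<Sum>k\<in>K. g (0, k)) + (\<Sum>k\<in>K. g (1, k)) + g (2, 0)" for g :: "_ \<Rightarrow> int"
  proof -
    define A B where "A = Pair (0::nat) ` K" and "B = Pair (1::nat) ` K"
    have U: "U = insert (2, 0) (A \<union> B)" unfolding U_def A_def B_def by auto
    have AB1: "finite A" "finite B" unfolding A_def B_def using finK by (rule finite_imageI)+
    have AB2: "fst u = 0" if "u \<in> A" for u using that unfolding A_def by (elim imageE) simp
    have AB3: "fst u = 1" if "u \<in> B" for u using that unfolding B_def by (elim imageE) simp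
    have AB4: "A \<inter> B = {}" using AB2 AB3 by fastforce
    have AB5: "(2, 0) \<notin> A \<union> B" using AB2 AB3 by fastforce
    note AB = AB4 AB5 AB1
    have "sum g A = (\<Sum>k\<in>K. g (0, k))" "sum g B = (\<Sum>k\<in>K. g (1, k))"
      unfolding A_def B_def by (simp_all add: sum.reindex inj_on_def)
    moreover have "sum g U = g (2, 0) + (sum g A + sum g B)"
      using AB(2,3,4) sum.union_disjoint[OF AB(3,4,1), of g] unfolding U by simp
    ultimately show ?thesis by linarith
  qed
  have fl: "of_int \<lfloor>r\<rfloor> = r" if "r \<in> \<int>" for r :: real using that by (simp add: of_int_floor)
  \<comment> \<open>The combination of the relations. The equations \<open>Inl j\<close> annihilate
    its integral coordinates, so only the columns in \<open>insert i S\<close> remain.\<close>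
  define X where "X j = (\<Sum>k\<in>K. of_int (c (1, k)) * x k j) + of_int (c (2, 0)) * y j" for j
  have XQ: "X j = 0" if "j \<in> ?Q" for j
  proof -
    have "(\<Sum>u\<in>U. M (Inl j) u * c u) = 0" using sol that by (auto simp: E_def)
    then have "(\<Sum>k\<in>K. \<lfloor>x k j\<rfloor> * c (1, k)) + \<lfloor>y j\<rfloor> * c (2, 0) = 0"
      by (simp add: sumU M_def)
    then have "of_int ((\<Sum>k\<in>K. \<lfloor>x k j\<rfloor> * c (1, k)) + \<lfloor>y j\<rfloor> * c (2, 0)) = (0::real)" by simp
    then show ?thesis
      using xZ[OF that] yZ that by (simp add: X_def fl mult.commute)
  qed
  have row: "(if l \<in> K then of_int (c (0, l)) + of_int (c (1, l)) * x l i else 0)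
      + (\<Sum>j\<in>insert i S. X j * \<alpha> j l) = 0" if l: "l < N" for l
  proof -
    have wZ: "wx k l \<in> \<int>" "wy l \<in> \<int>" for k using xs[OF l] ys l by (auto simp: wx_def wy_def)
    have "(\<Sum>u\<in>U. M (Inr l) u * c u) = 0" using sol l by (auto simp: E_def)
    then have "(\<Sum>k\<in>K. (if l = k then 1 else 0) * c (0, k)) + (\<Sum>k\<in>K. \<lfloor>wx k l\<rfloor> * c (1, k)) + \<lfloor>wy l\<rfloor> * c (2, 0) = 0"
      by (simp add: sumU M_def)
    moreover have "(\<Sum>k\<in>K. (if l = k then 1 else 0) * c (0, k)) = (\<Sum>k\<in>K. if l = k then c (0, k) else 0)"
      by (intro sum.cong) auto
    ultimately have "of_int ((\<Sum>k\<in>K. if l = k then c (0, k) else 0) + (\<Sum>k\<in>K. \<lfloor>wx k l\<rfloor> * c (1, k)) + \<lfloor>wy l\<rfloor> * c (2, 0)) = (0::real)"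
      by (simp only: of_int_0)
    then have 1: "(if l \<in> K then of_int (c (0, l)) else 0) + (\<Sum>k\<in>K. of_int (c (1, k)) * wx k l)
        + of_int (c (2, 0)) * wy l = 0"
      using wZ finK by (cases "l \<in> K") (simp_all add: fl mult.commute[of "of_int (c _)"])
    have 2: "(\<Sum>k\<in>K. of_int (c (1, k)) * wx k l)
        = (\<Sum>j\<in>S \<union> Q. (\<Sum>k\<in>K. of_int (c (1, k)) * x k j) * \<alpha> j l)
          + (if l \<in> K then of_int (c (1, l)) * x l i else 0)"
    proof -
      have "(\<Sum>k\<in>K. of_int (c (1, k)) * wx k l)
        = (\<Sum>k\<in>K. \<Sum>j\<in>S \<union> Q. of_int (c (1, k)) * x k j * \<alpha> j l)
          + (\<Sum>k\<in>K. if l = k then of_int (c (1, k)) * x k i else 0)"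
        unfolding wx_def e_def distrib_left sum.distrib sum_distrib_left
        by (intro arg_cong2[of _ _ _ _ "(+)"] sum.cong) (auto simp: mult.assoc)
      also have "(\<Sum>k\<in>K. \<Sum>j\<in>S \<union> Q. of_int (c (1, k)) * x k j * \<alpha> j l)
          = (\<Sum>j\<in>S \<union> Q. (\<Sum>k\<in>K. of_int (c (1, k)) * x k j) * \<alpha> j l)"
        by (subst sum.swap) (simp only: sum_distrib_right)
      finally show ?thesis using finK by simp
    qed
    have "(if l \<in> K then of_int (c (0, l)) + of_int (c (1, l)) * x l i else 0)
      + (\<Sum>j\<in>S \<union> Q. X j * \<alpha> j l) = 0"
    proof -
      have "(\<Sum>j\<in>S \<union> Q. X j * \<alpha> j l) = (\<Sum>j\<in>S \<union> Q. (\<Sum>k\<in>K. of_int (c (1, k)) * x k j) * \<alpha> j l)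
          + of_int (c (2, 0)) * wy l"
        unfolding X_def wy_def distrib_right sum.distrib by (simp only: sum_distrib_left mult.assoc)
      then show ?thesis using 1 unfolding 2 by (cases "l \<in> K") simp_all
    qed
    then show ?thesis unfolding split using XQ by simp
  qed
  \<comment> \<open>Rows in \<open>J\<close> carry no correction, so there the combination of the
    real columns itself is zero.\<close>
  have X0: "\<forall>j\<in>insert i S. X j = 0"
  proof (rule Jinj, rule ballI)
    fix l assume "l \<in> J"
    then show "(\<Sum>j\<in>insert i S. X j * \<alpha> j l) = 0" using row[of l] J by (auto simp: K_def)
  qed
  \<comment> \<open>With \<open>X\<close> zero, row \<open>k\<close> reads
    \<open>c (0, k) + c (1, k) * x k i = 0\<close>, and \<open>x k i\<close> is irrational.\<close>
  have cK: "c (0, k) = 0 \<and> c (1, k) = 0" if "k \<in> K" for k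
  proof -
    have "of_int (c (0, k)) + of_int (c (1, k)) * x k i = 0"
      using row[of k] X0 that by (simp add: K_def)
    with irrational[OF this] show ?thesis by simp
  qed
  then have "X i = of_int (c (2, 0)) * y i" by (simp add: X_def)
  then have "c (2, 0) = 0" using X0 yi by simp
  with cK c show False by (auto simp: U_def)
qed

text \<open>All missing coordinates are first added as integral ones, which needs only
  \<open>card S0 < N\<close>; then those in \<open>S - S0\<close> are made real one at a time.
  Columns in \<open>S0\<close> stay fixed and columns in \<open>Q0\<close> change by integers, which
  is exactly the freedom of choosing lifts of given elements of a quotient.\<close>

lemma torus_injective_extend:
  assumes I: "finite I" "S0 \<union> Q0 \<subseteq> I" "S0 \<inter> Q0 = {}" and S: "S0 \<subseteq> S" "S \<subseteq> I"
    and N: "0 < N" "S \<noteq> {} \<Longrightarrow> 2 * card S + card (I - S) \<le> N"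
    and inj: "torus_injective S0 Q0 N \<alpha>"
  obtains \<beta> where "torus_injective S (I - S) N \<beta>" "\<And>i. i \<in> S0 \<Longrightarrow> \<beta> i = \<alpha> i"
    "\<And>i k. i \<in> Q0 \<Longrightarrow> \<beta> i k - \<alpha> i k \<in> \<int>"
proof -
  have fin: "finite S0" "finite Q0" "finite S" 
  proof -
    show "finite S" using S(2) I(1) by (rule finite_subset)
    then show "finite S0" using S(1) by (rule finite_subset[rotated])
    show "finite Q0" using I(1,2) by (auto dest: finite_subset)
  qed
  have "card S0 \<le> card S" using fin S by (intro card_mono)
  \<comment> \<open>For empty \<open>S\<close> only \<open>0 < N\<close> is available; otherwise
    \<open>2 * card S \<le> N\<close> leaves room.\<close>
  then have S0N: "card S0 < N" using N by (cases "S = {}") (simp, linarith)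
  have step1: "\<exists>\<beta>. torus_injective S0 (Q0 \<union> D) N \<beta> \<and> (\<forall>i\<in>S0 \<union> Q0. \<beta> i = \<alpha> i)"
    if "finite D" "D \<inter> (S0 \<union> Q0) = {}" for D
    using that
  proof (induction D rule: finite_induct)
    case empty
    then show ?case using inj by auto
  next
    case (insert i D)
    then obtain \<beta> where \<beta>: "torus_injective S0 (Q0 \<union> D) N \<beta>" "\<forall>i\<in>S0 \<union> Q0. \<beta> i = \<alpha> i" by auto
    have "i \<notin> S0 \<union> (Q0 \<union> D)" "S0 \<inter> (Q0 \<union> D) = {}" "finite (Q0 \<union> D)"
      using insert.prems insert.hyps fin I(3) by auto
    from torus_injective_add_integer[OF fin(1) this(3,1,2) S0N \<beta>(1)]
    obtain v where "torus_injective S0 (insert i (Q0 \<union> D)) N (\<beta>(i := v))" by blast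
    moreover have "\<forall>j\<in>S0 \<union> Q0. (\<beta>(i := v)) j = \<alpha> j" using \<beta>(2) insert.prems by auto
    ultimately show ?case by (intro exI[of _ "\<beta>(i := v)"] conjI) (simp_all only: Un_insert_right)
  qed
  have Q0I: "Q0 \<union> (I - (S0 \<union> Q0)) = I - S0" using I by blast
  have "finite (I - (S0 \<union> Q0))" "(I - (S0 \<union> Q0)) \<inter> (S0 \<union> Q0) = {}" using I(1) by auto
  from step1[OF this] obtain \<gamma>
    where \<gamma>: "torus_injective S0 (I - S0) N \<gamma>" "\<forall>i\<in>S0 \<union> Q0. \<gamma> i = \<alpha> i"
    unfolding Q0I by (elim exE conjE)
  have "\<exists>\<beta>. torus_injective (S0 \<union> D) (I - (S0 \<union> D)) N \<beta> \<and> (\<forall>i\<in>S0. \<beta> i = \<alpha> i) \<and>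
      (\<forall>i\<in>Q0. \<forall>k. \<beta> i k - \<alpha> i k \<in> \<int>)"
    if "finite D" "D \<subseteq> S - S0" for D
    using that
  proof (induction D rule: finite_induct)
    case empty
    then show ?case using \<gamma> by (intro exI[of _ \<gamma>]) auto
  next
    case (insert i D)
    then obtain \<beta> where \<beta>: "torus_injective (S0 \<union> D) (I - (S0 \<union> D)) N \<beta>" "\<forall>i\<in>S0. \<beta> i = \<alpha> i"
      "\<forall>i\<in>Q0. \<forall>k. \<beta> i k - \<alpha> i k \<in> \<int>" by auto
    have lt: "card (S0 \<union> D) < card S"
      using insert.prems insert.hyps(2) fin(3) S(1) by (intro psubset_card_mono) auto
    have finD: "finite (S0 \<union> D)" "finite (I - (S0 \<union> D))" using insert.hyps(1) fin(1) I(1) by simp_all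
    have c1: "card (I - (S0 \<union> D)) = card I - card (S0 \<union> D)" "card (I - S) = card I - card S"
      "card S \<le> card I"
      
    proof -
      have "S0 \<union> D \<subseteq> I" using I S insert.prems by auto
      then show "card (I - (S0 \<union> D)) = card I - card (S0 \<union> D)" using finD(1) by (rule card_Diff_subset[rotated])
      show "card (I - S) = card I - card S" using fin(3) S(2) by (rule card_Diff_subset)
      show "card S \<le> card I" using I(1) S(2) by (rule card_mono)
    qed
    have "S \<noteq> {}" using insert.prems by auto
    \<comment> \<open>For \<open>D' = S0 \<union> D\<close> the left-hand side is
      \<open>card I + card D'\<close>, which stays below its value at \<open>S\<close> as long as
      \<open>D'\<close> is a proper subset of \<open>S\<close>.\<close>
    then have lt': "2 * card (S0 \<union> D) + card (I - (S0 \<union> D)) < N"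
      using N c1 lt by auto
    have i: "i \<in> I - (S0 \<union> D)" using insert.prems insert.hyps(2) S by auto
    from torus_injective_integer_to_real[OF finD i _ lt' \<beta>(1)]
    obtain z where z: "\<forall>k. z k \<in> \<int>"
      "torus_injective (insert i (S0 \<union> D)) (I - (S0 \<union> D) - {i}) N (\<beta>(i := \<lambda>k. \<beta> i k + z k))"
      by blast
    define \<beta>' where "\<beta>' = \<beta>(i := \<lambda>k. \<beta> i k + z k)"
    have eq: "I - (S0 \<union> D) - {i} = I - (S0 \<union> insert i D)" "insert i (S0 \<union> D) = S0 \<union> insert i D" by auto
    have "torus_injective (S0 \<union> insert i D) (I - (S0 \<union> insert i D)) N \<beta>'"
      using z(2) unfolding eq \<beta>'_def .
    moreover have "\<forall>j\<in>S0. \<beta>' j = \<alpha> j" using \<beta>(2) i by (auto simp: \<beta>'_def)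
    moreover have "\<forall>j\<in>Q0. \<forall>k. \<beta>' j k - \<alpha> j k \<in> \<int>"
    proof (intro ballI allI)
      fix j k assume j: "j \<in> Q0"
      have "\<beta>' j k - \<alpha> j k = (\<beta> j k - \<alpha> j k) + (if j = i then z k else 0)"
        by (simp add: \<beta>'_def)
      moreover have "(if j = i then z k else 0) \<in> \<int>" using z(1) by simp
      ultimately show "\<beta>' j k - \<alpha> j k \<in> \<int>" using \<beta>(3) j by (metis Ints_add)
    qed
    ultimately show ?case by (intro exI[of _ \<beta>'] conjI)
  qed
  from this[of "S - S0"] obtain \<beta> where "torus_injective (S0 \<union> (S - S0)) (I - (S0 \<union> (S - S0))) N \<beta>"
    "\<forall>i\<in>S0. \<beta> i = \<alpha> i" "\<forall>i\<in>Q0. \<forall>k. \<beta> i k - \<alpha> i k \<in> \<int>" using fin by auto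
  moreover have "S0 \<union> (S - S0) = S" using S by blast
  ultimately show ?thesis by (intro that[of \<beta>]) auto
qed

subsection \<open>Closed subgroups of vector groups\<close>

text \<open>Makes spans, independence and \<open>linear\<close> available for the points of
  \<open>Euclidean_space n\<close>.\<close>

instantiation "fun" :: (type, real_vector) real_vector
begin
definition "scaleR r f = (\<lambda>x. r *\<^sub>R f x)"
instance
  by standard
    (simp_all add: scaleR_fun_def fun_eq_iff scaleR_right_distrib scaleR_left_distrib)
end

lemma scaleR_fun_apply [simp]: "(r *\<^sub>R f) x = r *\<^sub>R f x"
  by (simp add: scaleR_fun_def)

lemma sum_fun_apply [simp]: "(\<Sum>a\<in>A. f a) x = (\<Sum>a\<in>A. f a x)"
  by (induction A rule: infinite_finite_induct) auto

section \<open>The vector space underlying \<open>Euclidean_space n\<close>, its bases and dual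
  functionals\<close>

definition vecs :: "nat \<Rightarrow> (nat \<Rightarrow> real) set" where
  "vecs n = {x. \<forall>i\<ge>n. x i = 0}"

lemma topspace_Euclidean_vecs [simp]: "topspace (Euclidean_space n) = vecs n"
  by (simp add: vecs_def topspace_Euclidean_space)

lemma subspace_vecs: "subspace (vecs n)"
  by (auto simp: subspace_def vecs_def)

lemmas vecs_closed [simp] = subspace_0[OF subspace_vecs] subspace_add[OF subspace_vecs]
  subspace_diff[OF subspace_vecs] subspace_scale[OF subspace_vecs] subspace_neg[OF subspace_vecs]

lemma vecs_eqI: "\<lbrakk>x \<in> vecs n; y \<in> vecs n; \<And>i. i < n \<Longrightarrow> x i = y i\<rbrakk> \<Longrightarrow> x = y"
proof (rule ext)
  fix i assume "x \<in> vecs n" "y \<in> vecs n" "\<And>i. i < n \<Longrightarrow> x i = y i"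
  then show "x i = y i" by (cases "i < n") (simp_all add: vecs_def)
qed

definition axis_vec :: "nat \<Rightarrow> nat \<Rightarrow> real" where
  "axis_vec i j = (if j = i then 1 else 0)"

lemma axis_vec_in_vecs [simp]: "i < n \<Longrightarrow> axis_vec i \<in> vecs n"
  by (auto simp: axis_vec_def vecs_def)

lemma vecs_axis_expansion:
  assumes "x \<in> vecs n"
  shows "x = (\<Sum>i<n. x i *\<^sub>R axis_vec i)"
proof
  fix j
  have "(\<Sum>i<n. x i *\<^sub>R axis_vec i) j = (\<Sum>i<n. if i = j then x i else 0)"
    by (simp add: axis_vec_def if_distrib cong: if_cong)
  also have "\<dots> = x j" using assms by (auto simp: vecs_def)
  finally show "x j = (\<Sum>i<n. x i *\<^sub>R axis_vec i) j" ..
qed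

lemma vecs_eq_span: "vecs n = span (axis_vec ` {..<n})"
proof
  show "vecs n \<subseteq> span (axis_vec ` {..<n})"
  proof
    fix x assume "x \<in> vecs n"
    then have "x = (\<Sum>i<n. x i *\<^sub>R axis_vec i)" by (rule vecs_axis_expansion)
    also have "\<dots> \<in> span (axis_vec ` {..<n})"
      by (intro span_sum span_scale span_base) auto
    finally show "x \<in> span (axis_vec ` {..<n})" .
  qed
  show "span (axis_vec ` {..<n}) \<subseteq> vecs n"
    by (intro span_minimal subspace_vecs) auto
qed

lemma inj_axis_vec: "inj axis_vec"
proof (rule injI)
  fix i k assume "axis_vec i = axis_vec k"
  then have "axis_vec i i = axis_vec k i" by simp
  then show "i = k" by (simp add: axis_vec_def split: if_splits)
qed

lemma independent_axis_vec: "independent (axis_vec ` {..<n})"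
  unfolding dependent_finite[OF finite_imageI[OF finite_lessThan]]
proof safe
  fix u j
  assume 0: "(\<Sum>v\<in>axis_vec ` {..<n}. u v *\<^sub>R v) = 0" and j: "j < n" "u (axis_vec j) \<noteq> 0"
  have "(\<Sum>v\<in>axis_vec ` {..<n}. u v *\<^sub>R v) j = (\<Sum>i<n. if i = j then u (axis_vec i) else 0)"
  proof -
    have "(\<Sum>v\<in>axis_vec ` {..<n}. u v *\<^sub>R v) j = (\<Sum>i<n. u (axis_vec i) * axis_vec i j)"
      by (subst sum.reindex[OF inj_on_subset[OF inj_axis_vec subset_UNIV]]) simp
    also have "\<dots> = (\<Sum>i<n. if i = j then u (axis_vec i) else 0)"
      by (intro sum.cong) (auto simp: axis_vec_def)
    finally show ?thesis .
  qed
  then show False using 0 j by simp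
qed

lemma basis_card:
  assumes "independent B" "B \<subseteq> vecs n" "vecs n \<subseteq> span B"
  shows "finite B" "card B = n"
proof -
  have c: "card (axis_vec ` {..<n}) = n"
    by (simp add: card_image inj_on_subset[OF inj_axis_vec])
  have "B \<subseteq> span (axis_vec ` {..<n})" using assms vecs_eq_span by simp
  from independent_span_bound[OF _ assms(1) this]
  have B: "finite B" "card B \<le> n" using c by auto
  have "axis_vec ` {..<n} \<subseteq> span B" using assms(3) by auto
  from independent_span_bound[OF B(1) independent_axis_vec this] show "finite B" "card B = n"
    using B c by auto
qed

text \<open>A basis of \<open>vecs n\<close> with its dual functionals. Each \<open>c b\<close> is
  linear on the whole function space, so that facts about \<open>linear\<close> apply directly; only
  its restriction to \<open>vecs n\<close> is determined by the basis.\<close>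

definition coordinates ::
    "nat \<Rightarrow> (nat \<Rightarrow> real) set \<Rightarrow> ((nat \<Rightarrow> real) \<Rightarrow> (nat \<Rightarrow> real) \<Rightarrow> real) \<Rightarrow> bool" where
  "coordinates n B c \<longleftrightarrow> finite B \<and> card B = n \<and> B \<subseteq> vecs n \<and> (\<forall>b\<in>B. linear (c b)) \<and>
     (\<forall>b\<in>B. \<forall>b'\<in>B. c b b' = (if b' = b then 1 else 0)) \<and>
     (\<forall>v\<in>vecs n. v = (\<Sum>b\<in>B. c b v *\<^sub>R b))"

lemma coordinatesD:
  assumes "coordinates n B c"
  shows "finite B" "card B = n" "B \<subseteq> vecs n" "\<And>b. b \<in> B \<Longrightarrow> linear (c b)"
    "\<And>b b'. \<lbrakk>b \<in> B; b' \<in> B\<rbrakk> \<Longrightarrow> c b b' = (if b' = b then 1 else 0)"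
    "\<And>v. v \<in> vecs n \<Longrightarrow> v = (\<Sum>b\<in>B. c b v *\<^sub>R b)"
proof -
  note A = assms[unfolded coordinates_def]
  show "finite B" "card B = n" "B \<subseteq> vecs n" using A by - (elim conjE, assumption)+
  show "linear (c b)" if "b \<in> B" for b using A that by (elim conjE) (erule (1) bspec)
  show "c b b' = (if b' = b then 1 else 0)" if "b \<in> B" "b' \<in> B" for b b'
    using A that by (elim conjE) (drule (1) bspec, erule (1) bspec)
  show "v = (\<Sum>b\<in>B. c b v *\<^sub>R b)" if "v \<in> vecs n" for v
    using A that by (elim conjE) (erule (1) bspec)
qed

lemma coordinates_sum:
  assumes B: "coordinates n B c" and D: "D \<subseteq> B" and b: "b \<in> B"
  shows "c b (\<Sum>d\<in>D. x d *\<^sub>R d) = (if b \<in> D then x b else 0)"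
proof -
  have fin: "finite D" using D coordinatesD(1)[OF B] by (rule finite_subset)
  have "c b (\<Sum>d\<in>D. x d *\<^sub>R d) = (\<Sum>d\<in>D. x d * c b d)"
    using coordinatesD(4)[OF B b] by (simp add: linear_sum linear_cmul)
  also have "\<dots> = (\<Sum>d\<in>D. if d = b then x d else 0)"
    using coordinatesD(5)[OF B b] D by (intro sum.cong) auto
  also have "\<dots> = (if b \<in> D then x b else 0)" using fin by simp
  finally show ?thesis .
qed

lemma coordinates_exist:
  assumes "independent B" "B \<subseteq> vecs n" "vecs n \<subseteq> span B"
  obtains c where "coordinates n B c"
proof -
  have "\<exists>g. linear g \<and> (\<forall>x\<in>B. g x = (if x = b then 1 else 0 :: real))" for b
    using linear_independent_extend[OF assms(1), of "\<lambda>x. if x = b then 1 else 0 :: real"] by simp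
  then obtain c where c: "\<And>b. linear (c b)" "\<And>b x. x \<in> B \<Longrightarrow> c b x = (if x = b then 1 else 0 :: real)"
    by metis
  note fin = basis_card[OF assms]
  have "v = (\<Sum>b\<in>B. c b v *\<^sub>R b)" if "v \<in> vecs n" for v
  proof -
    have "v \<in> span B" using that assms(3) by blast
    then obtain u where u: "v = (\<Sum>b\<in>B. u b *\<^sub>R b)"
      unfolding span_finite[OF fin(1)] by blast
    have "c b v = u b" if "b \<in> B" for b
    proof -
      have "c b v = (\<Sum>d\<in>B. u d * c b d)"
        unfolding u using c(1)[of b] by (simp add: linear_sum linear_cmul)
      also have "\<dots> = (\<Sum>d\<in>B. if d = b then u d else 0)" using c(2) by (intro sum.cong) auto
      finally show ?thesis using fin that by simp
    qed
    then show ?thesis using u by simp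
  qed
  then have "coordinates n B c"
    unfolding coordinates_def using fin assms(2) c by (intro conjI ballI)
  then show ?thesis by (rule that)
qed

section \<open>Additive subgroups and the structure of closed ones\<close>

definition additive_subgroup :: "'v::ab_group_add set \<Rightarrow> bool" where
  "additive_subgroup C \<longleftrightarrow> 0 \<in> C \<and> (\<forall>x\<in>C. \<forall>y\<in>C. x - y \<in> C)"

lemma additive_subgroup_simps:
  assumes "additive_subgroup C"
  shows "0 \<in> C" "\<And>x y. \<lbrakk>x \<in> C; y \<in> C\<rbrakk> \<Longrightarrow> x - y \<in> C" "\<And>x. x \<in> C \<Longrightarrow> - x \<in> C"
    "\<And>x y. \<lbrakk>x \<in> C; y \<in> C\<rbrakk> \<Longrightarrow> x + y \<in> C"
proof -
  show 0: "0 \<in> C" and d: "\<And>x y. \<lbrakk>x \<in> C; y \<in> C\<rbrakk> \<Longrightarrow> x - y \<in> C"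
    using assms unfolding additive_subgroup_def by simp_all
  show m: "- x \<in> C" if "x \<in> C" for x using d[OF 0 that] by simp
  show "x + y \<in> C" if "x \<in> C" "y \<in> C" for x y using d[OF that(1) m[OF that(2)]] by simp
qed

lemma additive_subgroup_sum:
  assumes "additive_subgroup C" "\<And>i. i \<in> I \<Longrightarrow> f i \<in> C"
  shows "(\<Sum>i\<in>I. f i) \<in> C"
  using assms(2) by (induction I rule: infinite_finite_induct)
    (simp_all add: additive_subgroup_simps[OF assms(1)])

lemma additive_subgroup_int:
  fixes x :: "'v::real_vector"
  assumes C: "additive_subgroup C" and x: "x \<in> C" and "r \<in> \<int>"
  shows "r *\<^sub>R x \<in> C"
proof -
  obtain m where m: "r = of_int m" using assms(3) by (elim Ints_cases)
  have "real k *\<^sub>R x \<in> C" for k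
    by (induction k) (simp_all add: additive_subgroup_simps[OF C] x scaleR_left_distrib)
  then have "of_int m *\<^sub>R x \<in> C"
  proof (cases m rule: int_cases2)
    case (nonneg k)
    then show ?thesis using \<open>\<And>k. real k *\<^sub>R x \<in> C\<close>[of k] by simp
  next
    case (nonpos k)
    then show ?thesis
      using additive_subgroup_simps(3)[OF C \<open>\<And>k. real k *\<^sub>R x \<in> C\<close>[of k]] by simp
  qed
  then show ?thesis using m by simp
qed

text \<open>Closedness in sequential form, with convergence tested in the first \<open>n\<close>
  coordinates. It fits kernels of Hausdorff quotients as well as closures taken with respect to
  \<open>norm1\<close>.\<close>

definition seq_closed :: "nat \<Rightarrow> (nat \<Rightarrow> real) set \<Rightarrow> bool" where
  "seq_closed n C \<longleftrightarrow>
     (\<forall>s y. (\<forall>k::nat. s k \<in> C) \<and> y \<in> vecs n \<and> (\<forall>i<n. (\<lambda>k. s k i) \<longlonglongrightarrow> y i) \<longrightarrow> y \<in> C)"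

lemma bounded_family_convergent_subseq:
  fixes Y :: "nat \<Rightarrow> 'i \<Rightarrow> real"
  assumes "finite G" "\<And>k g. g \<in> G \<Longrightarrow> \<bar>Y k g\<bar> \<le> 1"
  shows "\<exists>r y. strict_mono (r::nat \<Rightarrow> nat) \<and> (\<forall>g\<in>G. (\<lambda>k. Y (r k) g) \<longlonglongrightarrow> y g)"
  using assms
proof (induction G rule: finite_induct)
  case empty
  have "strict_mono (id :: nat \<Rightarrow> nat)" by (simp add: strict_mono_def)
  then show ?case by blast
next
  case (insert g G)
  have "\<exists>r y. strict_mono (r::nat \<Rightarrow> nat) \<and> (\<forall>g\<in>G. (\<lambda>k. Y (r k) g) \<longlonglongrightarrow> y g)"
    by (rule insert.IH) (simp add: insert.prems)
  then obtain r y where r: "strict_mono (r::nat \<Rightarrow> nat)" and y: "\<forall>g\<in>G. (\<lambda>k. Y (r k) g) \<longlonglongrightarrow> y g"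
    by (elim exE conjE)
  have "\<forall>k. Y (r k) g \<in> {-1..1}" using insert.prems[of g] by (auto simp: abs_le_iff minus_le_iff)
  from seq_compactE[OF compact_imp_seq_compact[OF compact_Icc] this]
  obtain l q where q: "strict_mono (q::nat \<Rightarrow> nat)" "((\<lambda>k. Y (r k) g) \<circ> q) \<longlonglongrightarrow> l"
    by metis
  show ?case
  proof (intro exI[of _ "r \<circ> q"] exI[of _ "y(g := l)"] conjI ballI)
    show "strict_mono (r \<circ> q)" using r q(1) by (rule strict_mono_o)
    fix h assume h: "h \<in> insert g G"
    show "(\<lambda>k. Y ((r \<circ> q) k) h) \<longlonglongrightarrow> (y(g := l)) h"
    proof (cases "h = g")
      case True
      then show ?thesis using q(2) by (simp add: o_def)
    next
      case False
      then have "(\<lambda>k. Y (r k) h) \<longlonglongrightarrow> y h" using h y by simp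
      from LIMSEQ_subseq_LIMSEQ[OF this q(1)] False show ?thesis by (simp add: o_def)
    qed
  qed
qed

text \<open>A sequence of nonzero combinations in \<open>C\<close> tending to zero would, after normalisation,
  accumulate at a vector spanning a line inside \<open>C\<close>.\<close>

lemma closed_subgroup_discrete_part:
  assumes C: "additive_subgroup C" "seq_closed n C" and G: "finite G" "G \<subseteq> vecs n"
    and lines: "\<And>x. \<lbrakk>\<And>t::real. t *\<^sub>R (\<Sum>g\<in>G. x g *\<^sub>R g) \<in> C\<rbrakk> \<Longrightarrow> \<forall>g\<in>G. x g = 0"
  shows "\<exists>\<epsilon>>0. \<forall>x. (\<Sum>g\<in>G. x g *\<^sub>R g) \<in> C \<and> (\<Sum>g\<in>G. \<bar>x g\<bar>) < \<epsilon> \<longrightarrow> (\<forall>g\<in>G. x g = 0)"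
proof (rule ccontr)
  assume contr: "\<not> ?thesis"
  have "\<exists>x. (\<Sum>g\<in>G. x g *\<^sub>R g) \<in> C \<and> (\<Sum>g\<in>G. \<bar>x g\<bar>) < 1 / real (Suc k) \<and> (\<exists>g\<in>G. x g \<noteq> 0)" for k
  proof -
    have "1 / real (Suc k) > 0" by simp
    with contr show ?thesis by meson
  qed
  then have "\<forall>k. \<exists>x. (\<Sum>g\<in>G. x g *\<^sub>R g) \<in> C \<and> (\<Sum>g\<in>G. \<bar>x g\<bar>) < 1 / real (Suc k) \<and> (\<exists>g\<in>G. x g \<noteq> 0)" ..
  from choice[OF this] obtain X where
    X: "\<forall>k. (\<Sum>g\<in>G. X k g *\<^sub>R g) \<in> C \<and> (\<Sum>g\<in>G. \<bar>X k g\<bar>) < 1 / real (Suc k) \<and> (\<exists>g\<in>G. X k g \<noteq> 0)" ..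
  define s where "s k = (\<Sum>g\<in>G. \<bar>X k g\<bar>)" for k
  have XC: "(\<Sum>g\<in>G. X k g *\<^sub>R g) \<in> C" and sk: "s k < 1 / real (Suc k)" for k
    using X by (simp_all add: s_def)
  have spos: "s k > 0" for k
  proof -
    obtain g where g: "g \<in> G" "X k g \<noteq> 0" using X by blast
    have "0 < \<bar>X k g\<bar>" using g by simp
    also have "\<dots> \<le> s k" unfolding s_def using g G by (intro member_le_sum) auto
    finally show ?thesis .
  qed
  have s0: "s \<longlonglongrightarrow> 0"
  proof (rule tendsto_sandwich[OF _ _ tendsto_const LIMSEQ_inverse_real_of_nat])
    show "\<forall>\<^sub>F k in sequentially. 0 \<le> s k" using spos by (simp add: less_imp_le)
    show "\<forall>\<^sub>F k in sequentially. s k \<le> inverse (real (Suc k))"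
      using sk by (simp add: less_imp_le inverse_eq_divide)
  qed
  define Y where "Y k g = X k g / s k" for k g
  have XY: "X k g = s k * Y k g" for k g using spos[of k] by (simp add: Y_def)
  have Y1: "\<bar>Y k g\<bar> \<le> 1" if "g \<in> G" for k g
  proof -
    have "\<bar>X k g\<bar> \<le> s k" unfolding s_def using that G by (intro member_le_sum) auto
    then show ?thesis using spos[of k] by (simp add: Y_def abs_divide)
  qed
  have Ysum: "(\<Sum>g\<in>G. \<bar>Y k g\<bar>) = 1" for k
    using spos[of k] by (simp add: Y_def abs_divide s_def flip: sum_divide_distrib)
  from bounded_family_convergent_subseq[of G Y, OF G(1) Y1] obtain r y
    where r: "strict_mono (r::nat \<Rightarrow> nat)" and y: "\<forall>g\<in>G. (\<lambda>k. Y (r k) g) \<longlonglongrightarrow> y g" by blast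
  have "(\<lambda>k. \<Sum>g\<in>G. \<bar>Y (r k) g\<bar>) \<longlonglongrightarrow> (\<Sum>g\<in>G. \<bar>y g\<bar>)"
    using y by (intro tendsto_intros) simp
  then have ysum: "(\<Sum>g\<in>G. \<bar>y g\<bar>) = 1"
    unfolding Ysum using LIMSEQ_unique tendsto_const by blast
  have sr: "(\<lambda>k. s (r k)) \<longlonglongrightarrow> 0"
    using LIMSEQ_subseq_LIMSEQ[OF s0 r] by (simp add: o_def)
  have "\<forall>g\<in>G. y g = 0"
  proof (rule lines)
    fix t :: real
    \<comment> \<open>Integral multiples of elements of \<open>C\<close> stay in \<open>C\<close>.
      Rounding \<open>t / s (r k)\<close> down makes \<open>m k * s (r k)\<close> tend to
      \<open>t\<close>, since the error is at most \<open>s (r k)\<close>.\<close>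
    define m where "m k = real_of_int \<lfloor>t / s (r k)\<rfloor>" for k
    have ms: "(\<lambda>k. m k * s (r k)) \<longlonglongrightarrow> t"
    proof -
      have "\<bar>m k * s (r k) - t\<bar> \<le> s (r k)" for k
      proof -
        have "m k \<le> t / s (r k)" "t / s (r k) < m k + 1" unfolding m_def by linarith+
        then have "m k * s (r k) \<le> t" "t < (m k + 1) * s (r k)"
          using spos[of "r k"] by (simp_all add: field_simps)
        then show ?thesis by (simp add: distrib_right)
      qed
      then have "(\<lambda>k. m k * s (r k) - t) \<longlonglongrightarrow> 0"
        by (intro Lim_null_comparison[OF _ sr] always_eventually) simp
      then show ?thesis by (simp add: LIM_zero_iff)
    qed
    have "m k *\<^sub>R (\<Sum>g\<in>G. X (r k) g *\<^sub>R g) \<in> C" for k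
      by (intro additive_subgroup_int[OF C(1) XC]) (simp add: m_def)
    moreover have "t *\<^sub>R (\<Sum>g\<in>G. y g *\<^sub>R g) \<in> vecs n"
      using G(2) by (intro subspace_scale subspace_sum subspace_vecs) auto
    moreover have "(\<lambda>k. (m k *\<^sub>R (\<Sum>g\<in>G. X (r k) g *\<^sub>R g)) i) \<longlonglongrightarrow> (t *\<^sub>R (\<Sum>g\<in>G. y g *\<^sub>R g)) i" for i
    proof -
      have "(\<lambda>k. (m k * s (r k)) * (\<Sum>g\<in>G. Y (r k) g * g i)) \<longlonglongrightarrow> t * (\<Sum>g\<in>G. y g * g i)"
        using y by (intro tendsto_intros ms) simp
      then show ?thesis by (simp add: XY sum_distrib_left mult.assoc)
    qed
    ultimately show "t *\<^sub>R (\<Sum>g\<in>G. y g *\<^sub>R g) \<in> C"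
      using C(2)[unfolded seq_closed_def, rule_format,
          of "\<lambda>k. m k *\<^sub>R (\<Sum>g\<in>G. X (r k) g *\<^sub>R g)" "t *\<^sub>R (\<Sum>g\<in>G. y g *\<^sub>R g)"] by blast
  qed
  then show False using ysum by simp
qed

text \<open>By Dirichlet's theorem some bounded multiple \<open>q\<close> of the coefficients is
  within \<open>1 / N\<close> of integers. The difference still lies in \<open>C\<close> and is too
  short to be nonzero, so \<open>q\<close> clears the denominators. This takes the place of a
  lattice basis.\<close>

lemma bounded_denominators:
  fixes C :: "'v::real_vector set"
  assumes C: "additive_subgroup C" and G: "finite G" "G \<subseteq> C" and "\<epsilon> > 0"
    and disc: "\<And>x. \<lbrakk>(\<Sum>g\<in>G. x g *\<^sub>R g) \<in> C; (\<Sum>g\<in>G. \<bar>x g\<bar>) < \<epsilon>\<rbrakk> \<Longrightarrow> \<forall>g\<in>G. x g = 0"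
  obtains k :: nat where "k > 0" "\<And>x g. \<lbrakk>(\<Sum>g\<in>G. x g *\<^sub>R g) \<in> C; g \<in> G\<rbrakk> \<Longrightarrow> real k * x g \<in> \<int>"
proof -
  obtain N :: nat where N: "real (card G) / \<epsilon> < real N" "N > 0"
  proof -
    obtain N where "real (card G) / \<epsilon> < real N" using reals_Archimedean2 by blast
    then show ?thesis using that[of "Suc N"] by simp
  qed
  obtain h where h: "bij_betw h {0..<card G} G" using ex_bij_betw_nat_finite[OF G(1)] by blast
  \<comment> \<open>Every \<open>q\<close> that can occur is at most \<open>N ^ card G\<close> and
    so divides this factorial; one \<open>k\<close> serves all elements of \<open>C\<close>.\<close>
  define k where "k = (fact (N ^ card G) :: nat)"
  have "real k * x g \<in> \<int>" if x: "(\<Sum>g\<in>G. x g *\<^sub>R g) \<in> C" and g: "g \<in> G" for x g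
  proof -
    obtain q p where q: "0 < q" "q \<le> int (N ^ card G)"
      and p: "\<And>i. i < card G \<Longrightarrow> \<bar>of_int q * x (h i) - of_int (p i)\<bar> < 1 / real N"
      using Dirichlet_approx_simult[OF N(2), of "card G" "\<lambda>i. x (h i)"] by metis
    define h' where "h' = inv_into {0..<card G} h"
    have h': "h' g < card G" "h (h' g) = g" if "g \<in> G" for g
      using that h unfolding h'_def
      by (metis atLeastLessThan_iff bij_betw_def inv_into_into,
          metis bij_betw_def f_inv_into_f)
    define z where "z g = of_int q * x g - of_int (p (h' g))" for g
    have zN: "\<bar>z g\<bar> < 1 / real N" if "g \<in> G" for g
      using p[OF h'(1)[OF that]] h'(2)[OF that] by (simp add: z_def)
    have "(\<Sum>g\<in>G. z g *\<^sub>R g) = of_int q *\<^sub>R (\<Sum>g\<in>G. x g *\<^sub>R g) - (\<Sum>g\<in>G. of_int (p (h' g)) *\<^sub>R g)"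
      by (simp add: z_def[abs_def] scaleR_diff_left sum_subtractf scaleR_sum_right)
    also have "\<dots> \<in> C"
      using G(2) by (intro additive_subgroup_simps(2)[OF C additive_subgroup_int[OF C x]
          additive_subgroup_sum[OF C additive_subgroup_int[OF C]]]) auto
    finally have zC: "(\<Sum>g\<in>G. z g *\<^sub>R g) \<in> C" .
    have "(\<Sum>g\<in>G. \<bar>z g\<bar>) \<le> (\<Sum>g\<in>G. 1 / real N)" using zN by (intro sum_mono) (simp add: less_imp_le)
    also have "\<dots> < \<epsilon>" using N \<open>\<epsilon> > 0\<close> by (simp add: field_simps)
    finally have "\<forall>g\<in>G. z g = 0" by (rule disc[OF zC])
    then have qx: "of_int q * x g = of_int (p (h' g))" using g by (simp add: z_def)
    have "nat q dvd k" unfolding k_def using q by (intro dvd_fact) (auto simp: nat_le_iff)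
    then obtain d where d: "k = nat q * d" by (elim dvdE)
    have "real k * x g = real d * (of_int q * x g)" using q(1) by (simp add: d)
    also have "\<dots> \<in> \<int>" unfolding qx by (intro Ints_mult) auto
    finally show ?thesis .
  qed
  moreover have "k > 0" by (simp add: k_def)
  ultimately show ?thesis by (intro that[of k])
qed

text \<open>The basis follows the flag from the largest subspace \<open>W\<close> inside
  \<open>C\<close> to the span of \<open>C\<close> to \<open>vecs n\<close>, and it is adapted to
  the smaller subgroup \<open>L\<close> at the same time. For the lifting problem \<open>C\<close>
  is the kernel of the map to the quotient and \<open>L\<close> the kernel of the map to the group;
  \<open>Q\<close> is the part of the basis that spans \<open>L\<close>.\<close>

lemma closed_subgroup_basis:
  assumes C: "additive_subgroup C" "C \<subseteq> vecs n" "seq_closed n C"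
    and L: "additive_subgroup L" "L \<subseteq> C"
  obtains BW BG BS Q c and k :: nat where
    "coordinates n (BW \<union> BG \<union> BS) c" "BW \<inter> BG = {}" "(BW \<union> BG) \<inter> BS = {}"
    "\<And>b t. b \<in> BW \<Longrightarrow> t *\<^sub>R b \<in> C" "BG \<subseteq> C" "k > 0"
    "\<And>v b. \<lbrakk>v \<in> C; b \<in> BS\<rbrakk> \<Longrightarrow> c b v = 0" "\<And>v b. \<lbrakk>v \<in> C; b \<in> BG\<rbrakk> \<Longrightarrow> real k * c b v \<in> \<int>"
    "Q \<subseteq> BW \<union> BG" "Q \<subseteq> L" "L \<subseteq> span Q"
proof -
  define W where "W = {w. \<forall>t::real. t *\<^sub>R w \<in> C}"
  have WC: "W \<subseteq> C"
  proof
    fix w assume "w \<in> W"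
    then have "1 *\<^sub>R w \<in> C" unfolding W_def by blast
    then show "w \<in> C" by simp
  qed
  have W: "subspace W"
    unfolding subspace_def W_def
    by (simp add: additive_subgroup_simps[OF C(1)] scaleR_right_distrib)
  \<comment> \<open>Elements of \<open>L\<close> come first at each stage: inside \<open>W\<close>,
    then modulo \<open>W\<close> before further elements of \<open>C\<close> are added. This order
    is what makes \<open>Q\<close> span \<open>L\<close>.\<close>
  obtain B1 where B1: "B1 \<subseteq> L \<inter> W" "independent B1" "L \<inter> W \<subseteq> span B1"
    using maximal_independent_subset[of "L \<inter> W"] by blast
  have "B1 \<subseteq> W" using B1(1) by blast
  from maximal_independent_subset_extend[OF this B1(2)]
  obtain BW where BW: "B1 \<subseteq> BW" "BW \<subseteq> W" "independent BW" "W \<subseteq> span BW" .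
  have "BW \<subseteq> BW \<union> L" by blast
  from maximal_independent_subset_extend[OF this BW(3)]
  obtain D where D: "BW \<subseteq> D" "D \<subseteq> BW \<union> L" "independent D" "BW \<union> L \<subseteq> span D" .
  have "D \<subseteq> C" using D(2) BW(2) WC L(2) by blast
  from maximal_independent_subset_extend[OF this D(3)]
  obtain E where E: "D \<subseteq> E" "E \<subseteq> C" "independent E" "C \<subseteq> span E" .
  have "E \<subseteq> vecs n" using E(2) C(2) by blast
  from maximal_independent_subset_extend[OF this E(3)]
  obtain B where B: "E \<subseteq> B" "B \<subseteq> vecs n" "independent B" "vecs n \<subseteq> span B" .
  obtain c where c: "coordinates n B c" using coordinates_exist[OF B(3,2,4)] .
  note cD = coordinatesD[OF c]
  define BG where "BG = E - BW"
  define BS where "BS = B - E"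
  have span0: "c b v = 0" if "v \<in> span F" "F \<subseteq> B" "b \<in> B" "b \<notin> F" for b v F
  proof (rule linear_eq_0_on_span[of "c b" F])
    show "linear (c b)" using cD(4) that by blast
    show "c b x = 0" if "x \<in> F" for x
      using cD(5)[of b x] that \<open>F \<subseteq> B\<close> \<open>b \<in> B\<close> \<open>b \<notin> F\<close> by auto
  qed (use that in auto)
  have BWE: "BW \<subseteq> E" using D(1) E(1) by blast
  have un: "BW \<union> BG \<union> BS = B" unfolding BG_def BS_def using BWE B(1) by blast
  have finB: "finite B" by (rule cD(1))
  have finG: "finite BG" "BG \<subseteq> vecs n"
    using B(1,2) unfolding BG_def by (auto intro: finite_subset[OF _ finB])
  have finW: "finite BW" using BWE B(1) by (intro finite_subset[OF _ finB]) blast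
  \<comment> \<open>A line in \<open>C\<close> spanned by a combination of \<open>BG\<close> would
    lie in \<open>W\<close>, which is the span of \<open>BW\<close> and meets the span of
    \<open>BG\<close> only in 0.\<close>
  have "\<exists>\<epsilon>>0. \<forall>x. (\<Sum>g\<in>BG. x g *\<^sub>R g) \<in> C \<and> (\<Sum>g\<in>BG. \<bar>x g\<bar>) < \<epsilon> \<longrightarrow> (\<forall>g\<in>BG. x g = 0)"
  proof (rule closed_subgroup_discrete_part[OF C(1,3) finG])
    fix x assume "\<And>t::real. t *\<^sub>R (\<Sum>g\<in>BG. x g *\<^sub>R g) \<in> C"
    then have inW: "(\<Sum>g\<in>BG. x g *\<^sub>R g) \<in> span BW" using BW(4) unfolding W_def by blast
    show "\<forall>g\<in>BG. x g = 0"
    proof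
      fix g assume g: "g \<in> BG"
      then have gB: "g \<in> B" "BW \<subseteq> B" "g \<notin> BW" "BG \<subseteq> B" using B(1) BWE by (auto simp: BG_def)
      have "x g = c g (\<Sum>g\<in>BG. x g *\<^sub>R g)" using coordinates_sum[OF c gB(4,1), of x] g by simp
      also have "\<dots> = 0" using span0[OF inW gB(2,1,3)] .
      finally show "x g = 0" .
    qed
  qed
  then obtain \<epsilon> where \<epsilon>: "\<epsilon> > 0 \<and>
    (\<forall>x. (\<Sum>g\<in>BG. x g *\<^sub>R g) \<in> C \<and> (\<Sum>g\<in>BG. \<bar>x g\<bar>) < \<epsilon> \<longrightarrow> (\<forall>g\<in>BG. x g = 0))" ..
  have disc: "\<forall>g\<in>BG. x g = 0" if "(\<Sum>g\<in>BG. x g *\<^sub>R g) \<in> C" "(\<Sum>g\<in>BG. \<bar>x g\<bar>) < \<epsilon>" for x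
    using conjunct2[OF \<epsilon>, THEN spec, of x] that by (rule mp[OF _ conjI])
  have BGC: "BG \<subseteq> C" using E(2) by (auto simp: BG_def)
  obtain k :: nat where k: "k > 0"
    "\<And>x g. \<lbrakk>(\<Sum>g\<in>BG. x g *\<^sub>R g) \<in> C; g \<in> BG\<rbrakk> \<Longrightarrow> real k * x g \<in> \<int>"
    using bounded_denominators[OF C(1) finG(1) BGC conjunct1[OF \<epsilon>] disc] by blast
  have cS: "c b v = 0" if "v \<in> C" "b \<in> BS" for v b
    using span0[of v E b] that E(4) B(1) by (auto simp: BS_def)
  have decomp: "v = (\<Sum>b\<in>BW. c b v *\<^sub>R b) + (\<Sum>b\<in>BG. c b v *\<^sub>R b)" if "v \<in> C" for v
  proof -
    have "v = (\<Sum>b\<in>B. c b v *\<^sub>R b)" by (rule cD(6)) (use that C(2) in blast)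
    also have "\<dots> = (\<Sum>b\<in>BW \<union> BG. c b v *\<^sub>R b)"
      using cS[OF that] un by (intro sum.mono_neutral_right[OF finB]) auto
    also have "\<dots> = (\<Sum>b\<in>BW. c b v *\<^sub>R b) + (\<Sum>b\<in>BG. c b v *\<^sub>R b)"
      using finG finW by (intro sum.union_disjoint) (auto simp: BG_def)
    finally show ?thesis .
  qed
  have sumW: "(\<Sum>b\<in>BW. y b *\<^sub>R b) \<in> W" for y
    using BW(2) by (intro subspace_sum[OF W] subspace_scale[OF W]) auto
  have cG: "real k * c b v \<in> \<int>" if "v \<in> C" "b \<in> BG" for v b
  proof (rule k(2)[OF _ that(2)])
    define p q where "p = (\<Sum>b\<in>BW. c b v *\<^sub>R b)" and "q = (\<Sum>b\<in>BG. c b v *\<^sub>R b)"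
    have "v = p + q" unfolding p_def q_def by (rule decomp[OF that(1)])
    then have "q = v - p" by simp
    moreover have "p \<in> C" unfolding p_def by (rule subsetD[OF WC sumW])
    ultimately have "q \<in> C" using that(1) additive_subgroup_simps(2)[OF C(1)] by simp
    then show "(\<Sum>b\<in>BG. c b v *\<^sub>R b) \<in> C" unfolding q_def .
  qed
  define Q where "Q = B1 \<union> (D - BW)"
  have QL: "D - BW \<subseteq> L" "Q \<subseteq> L" using B1(1) D(2) by (auto simp: Q_def)
  have "L \<subseteq> span Q"
  proof
    fix v assume v: "v \<in> L"
    then have vC: "v \<in> C" using L(2) by blast
    define p s where "p = (\<Sum>b\<in>BW. c b v *\<^sub>R b)" and "s = (\<Sum>b\<in>D - BW. c b v *\<^sub>R b)"
    have "(\<Sum>b\<in>BG. c b v *\<^sub>R b) = s"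
      unfolding s_def
    proof (rule sum.mono_neutral_right[OF finG(1)])
      show "D - BW \<subseteq> BG" using E(1) by (auto simp: BG_def)
      show "\<forall>b\<in>BG - (D - BW). c b v *\<^sub>R b = 0"
      proof
        fix b assume "b \<in> BG - (D - BW)"
        then have "b \<in> B" "b \<notin> D" using B(1) by (auto simp: BG_def)
        moreover have "v \<in> span D" "D \<subseteq> B" using v D(4) E(1) B(1) by blast+
        ultimately have "c b v = 0" by (intro span0)
        then show "c b v *\<^sub>R b = 0" by simp
      qed
    qed
    then have v_eq: "v = p + s" using decomp[OF vC] unfolding p_def by argo
    \<comment> \<open>Multiplication by \<open>k\<close> makes the coefficients along
      \<open>D - BW\<close> integral, so \<open>k\<close> times \<open>s\<close>, and with it
      \<open>k\<close> times \<open>p\<close>, lies in \<open>L\<close>. The latter also lies in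
      \<open>W\<close>, where \<open>B1\<close> spans.\<close>
    have ks: "real k *\<^sub>R s \<in> L"
      unfolding s_def scaleR_sum_right scaleR_scaleR
    proof (rule additive_subgroup_sum[OF L(1)])
      fix b assume b: "b \<in> D - BW"
      show "(real k * c b v) *\<^sub>R b \<in> L"
        using b QL(1) E(1) by (intro additive_subgroup_int[OF L(1)] cG[OF vC]) (auto simp: BG_def)
    qed
    have "real k *\<^sub>R v - real k *\<^sub>R s \<in> L" using ks v
      by (intro additive_subgroup_simps(2)[OF L(1)] additive_subgroup_int[OF L(1) v]) auto
    then have 1: "real k *\<^sub>R p \<in> L" unfolding v_eq by (simp add: scaleR_right_distrib)
    have "real k *\<^sub>R p \<in> W" unfolding p_def by (rule subspace_scale[OF W sumW])
    with 1 have "real k *\<^sub>R p \<in> span B1" using B1(3) by blast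
    then have "(1 / real k) *\<^sub>R (real k *\<^sub>R p) \<in> span B1" by (rule span_scale)
    then have "p \<in> span B1" using k(1) by simp
    then have "p \<in> span Q" using span_mono[of B1 Q] by (auto simp: Q_def)
    moreover have "s \<in> span Q" unfolding s_def by (intro span_sum span_scale span_base) (auto simp: Q_def)
    ultimately show "v \<in> span Q" unfolding v_eq by (rule span_add)
  qed
  then have LQ: "L \<subseteq> span Q" .
  have QB: "Q \<subseteq> BW \<union> BG" using BW(1) E(1) by (auto simp: Q_def BG_def)
  have line: "t *\<^sub>R b \<in> C" if "b \<in> BW" for b t using subsetD[OF BW(2) that] unfolding W_def by simp
  have co: "coordinates n (BW \<union> BG \<union> BS) c" using c unfolding un .
  have dis: "BW \<inter> BG = {}" "(BW \<union> BG) \<inter> BS = {}" using BWE by (auto simp: BG_def BS_def)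
  show ?thesis by (rule that[OF co dis line BGC k(1) cS cG QB QL(2) LQ])
qed

section \<open>The sum norm and the topology of \<open>Euclidean_space n\<close>\<close>

definition norm1 :: "nat \<Rightarrow> (nat \<Rightarrow> real) \<Rightarrow> real" where
  "norm1 n x = (\<Sum>i<n. \<bar>x i\<bar>)"

lemma norm1_nonneg [simp]: "0 \<le> norm1 n x"
  by (simp add: norm1_def sum_nonneg)

lemma norm1_zero [simp]: "norm1 n 0 = 0"
  by (simp add: norm1_def)

lemma norm1_minus [simp]: "norm1 n (- x) = norm1 n x"
  by (simp add: norm1_def)

lemma norm1_minus_commute: "norm1 n (x - y) = norm1 n (y - x)"
  by (simp add: norm1_def abs_minus_commute)

lemma norm1_scaleR [simp]: "norm1 n (r *\<^sub>R x) = \<bar>r\<bar> * norm1 n x"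
  by (simp add: norm1_def abs_mult sum_distrib_left)

lemma norm1_triangle: "norm1 n (x + y) \<le> norm1 n x + norm1 n y"
  unfolding norm1_def sum.distrib[symmetric] by (intro sum_mono) (simp add: abs_triangle_ineq)

lemma norm1_diff_triangle: "norm1 n (x - z) \<le> norm1 n (x - y) + norm1 n (y - z)"
  using norm1_triangle[of n "x - y" "y - z"] by simp

lemma norm1_triangle_diff: "norm1 n (x - y) \<le> norm1 n x + norm1 n y"
  using norm1_triangle[of n x "- y"] by simp

lemma component_le_norm1: "i < n \<Longrightarrow> \<bar>x i\<bar> \<le> norm1 n x"
  unfolding norm1_def by (intro member_le_sum) auto

lemma norm1_axis_vec [simp]: "i < n \<Longrightarrow> norm1 n (axis_vec i) = 1"
proof -
  assume "i < n"
  have "norm1 n (axis_vec i) = (\<Sum>k<n. if k = i then 1 else 0)"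
    unfolding norm1_def by (intro sum.cong) (auto simp: axis_vec_def)
  then show ?thesis using \<open>i < n\<close> by simp
qed

lemma norm1_eq_0: "\<lbrakk>norm1 n x = 0; x \<in> vecs n\<rbrakk> \<Longrightarrow> x = 0"
  using component_le_norm1[of _ n x] by (intro vecs_eqI[of x n 0]) auto

lemma continuous_map_Euclidean_component:
  "continuous_map (Euclidean_space n) euclideanreal (\<lambda>x. x i)"
  unfolding Euclidean_space_def
  by (intro continuous_map_from_subtopology continuous_map_product_coordinates) simp

lemma openin_norm1_ball: "openin (Euclidean_space n) {y \<in> vecs n. norm1 n (y - x) < e}"
proof -
  have "continuous_map (Euclidean_space n) euclideanreal (\<lambda>y. norm1 n (y - x))"
    unfolding norm1_def minus_apply
    by (intro continuous_intros continuous_map_Euclidean_component continuous_map_sum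
        continuous_map_real_abs continuous_map_diff continuous_map_const[THEN iffD2]) auto
  from openin_continuous_map_preimage[OF this, of "{..<e}"] show ?thesis by simp
qed

text \<open>Only the first \<open>n\<close> coordinates vary on \<open>vecs n\<close>, so just
  finitely many radii of a product neighbourhood matter, and their minimum is positive. Most later
  arguments about open sets go through this epsilon criterion.\<close>

lemma openin_Euclidean_norm1:
  "openin (Euclidean_space n) U \<longleftrightarrow>
     U \<subseteq> vecs n \<and> (\<forall>x\<in>U. \<exists>e>0. \<forall>y\<in>vecs n. norm1 n (y - x) < e \<longrightarrow> y \<in> U)"
proof (intro iffI conjI ballI)
  assume U: "openin (Euclidean_space n) U"
  then show sub: "U \<subseteq> vecs n" using openin_subset by fastforce
  fix x assume x: "x \<in> U"
  obtain T where T: "openin (powertop_real UNIV) T" and UT: "U = T \<inter> {x. \<forall>i\<ge>n. x i = 0}"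
    using U unfolding Euclidean_space_def openin_subtopology by blast
  have "x \<in> T" using x UT by simp
  from bspec[OF T[unfolded openin_product_topology_alt] this]
  obtain V where V': "\<forall>i\<in>UNIV. openin euclideanreal (V i)" "x \<in> Pi\<^sub>E UNIV V" and VT: "Pi\<^sub>E UNIV V \<subseteq> T"
    by (elim exE conjE)
  have V: "open (V i)" "x i \<in> V i" for i using V' by (auto simp: PiE_iff)
  have "\<exists>e>0. \<forall>r. \<bar>r - x i\<bar> < e \<longrightarrow> r \<in> V i" for i
    using V(1,2)[of i] unfolding open_dist dist_real_def by blast
  then obtain e where e: "\<And>i. e i > 0" "\<And>i r. \<bar>r - x i\<bar> < e i \<Longrightarrow> r \<in> V i" by metis
  \<comment> \<open>The entry 1 keeps the set nonempty when \<open>n = 0\<close>.\<close>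
  define d where "d = Min (insert 1 (e ` {..<n}))"
  have d: "d > 0" "\<And>i. i < n \<Longrightarrow> d \<le> e i" using e(1) by (auto simp: d_def)
  have "y \<in> U" if y: "y \<in> vecs n" "norm1 n (y - x) < d" for y
  proof -
    have "y i \<in> V i" for i
    proof (cases "i < n")
      case True
      have "\<bar>y i - x i\<bar> \<le> norm1 n (y - x)" using component_le_norm1[OF True, of "y - x"] by simp
      then show ?thesis using e(2)[of "y i" i] d(2)[OF True] y(2) by linarith
    next
      case False
      then have "y i = x i" using y(1) x sub by (auto simp: vecs_def)
      then show ?thesis using V(2) by simp
    qed
    then have "y \<in> T" using VT by auto
    then show ?thesis using UT y(1) by (simp add: vecs_def)
  qed
  then show "\<exists>e>0. \<forall>y\<in>vecs n. norm1 n (y - x) < e \<longrightarrow> y \<in> U" using d(1) by blast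
next
  assume R: "U \<subseteq> vecs n \<and> (\<forall>x\<in>U. \<exists>e>0. \<forall>y\<in>vecs n. norm1 n (y - x) < e \<longrightarrow> y \<in> U)"
  show "openin (Euclidean_space n) U"
    unfolding openin_subopen[of _ U]
  proof
    fix x assume x: "x \<in> U"
    then obtain e where e: "e > 0" "\<forall>y\<in>vecs n. norm1 n (y - x) < e \<longrightarrow> y \<in> U" using R by blast
    show "\<exists>T. openin (Euclidean_space n) T \<and> x \<in> T \<and> T \<subseteq> U"
      using openin_norm1_ball[of n x e] e x R
      by (intro exI[of _ "{y \<in> vecs n. norm1 n (y - x) < e}"]) auto
  qed
qed

lemma openin_Euclidean_norm1D:
  assumes "openin (Euclidean_space n) U" "x \<in> U"
  obtains e where "e > 0" "\<And>y. \<lbrakk>y \<in> vecs n; norm1 n (y - x) < e\<rbrakk> \<Longrightarrow> y \<in> U"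
proof -
  have "\<exists>e>0. \<forall>y\<in>vecs n. norm1 n (y - x) < e \<longrightarrow> y \<in> U"
    using assms unfolding openin_Euclidean_norm1 by blast
  then show ?thesis using that by blast
qed

lemma norm1_tendsto_0:
  assumes "\<And>i. i < n \<Longrightarrow> (\<lambda>k. s k i) \<longlonglongrightarrow> y i"
  shows "(\<lambda>k. norm1 n (s k - y)) \<longlonglongrightarrow> 0"
proof -
  have "(\<lambda>k. \<Sum>i<n. \<bar>s k i - y i\<bar>) \<longlonglongrightarrow> (\<Sum>i<n. \<bar>y i - y i\<bar>)"
    using assms by (intro tendsto_intros) simp
  then show ?thesis by (simp add: norm1_def)
qed

lemma linear_vecs_expansion:
  assumes "linear \<xi>" "x \<in> vecs n"
  shows "\<xi> x = (\<Sum>i<n. x i * \<xi> (axis_vec i))"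
proof -
  have "\<xi> (\<Sum>i<n. x i *\<^sub>R axis_vec i) = (\<Sum>i<n. x i * \<xi> (axis_vec i))"
    using assms(1) by (simp add: linear_sum linear_cmul)
  then show ?thesis by (subst vecs_axis_expansion[OF assms(2)]) simp
qed

lemma continuous_map_linear:
  fixes \<xi> :: "(nat \<Rightarrow> real) \<Rightarrow> real"
  assumes "linear \<xi>"
  shows "continuous_map (Euclidean_space n) euclideanreal \<xi>"
proof (rule continuous_map_eq)
  show "continuous_map (Euclidean_space n) euclideanreal (\<lambda>x. \<Sum>i<n. x i * \<xi> (axis_vec i))"
    by (intro continuous_map_sum continuous_map_real_mult continuous_map_Euclidean_component) auto
  show "(\<Sum>i<n. x i * \<xi> (axis_vec i)) = \<xi> x" if "x \<in> topspace (Euclidean_space n)" for x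
    using linear_vecs_expansion[OF assms, of x n] that by simp
qed

subsection \<open>Duality for quotients of vector groups\<close>

text \<open>Kernels may contain lines here, so that one notion serves the Lie group, its quotients
  and the powers of the circle alike.\<close>

locale vector_cover =
  fixes n :: nat and G :: "('g, 'm) monoid_scheme" and Y :: "'g topology"
    and F :: "(nat \<Rightarrow> real) \<Rightarrow> 'g"
  assumes topological_group: "topological_group G Y"
    and continuous: "continuous_map (Euclidean_space n) Y F"
    and open_map: "open_map (Euclidean_space n) Y F"
    and surjective: "F ` vecs n = carrier G"
    and add: "\<And>x y. \<lbrakk>x \<in> vecs n; y \<in> vecs n\<rbrakk> \<Longrightarrow> F (x + y) = F x \<otimes>\<^bsub>G\<^esub> F y"
begin

lemma group: "group G" and topspace_eq: "topspace Y = carrier G"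
  using topological_group by (simp_all add: topological_group_def)

lemma closed: "x \<in> vecs n \<Longrightarrow> F x \<in> carrier G"
  using surjective by blast

lemma zero: "F 0 = \<one>\<^bsub>G\<^esub>"
proof -
  have "F 0 \<otimes>\<^bsub>G\<^esub> F 0 = F 0" using add[of 0 0] by simp
  then show ?thesis using group.l_cancel_one'[OF group closed closed, of 0 0] by simp
qed

lemma minus: "x \<in> vecs n \<Longrightarrow> F (- x) = inv\<^bsub>G\<^esub> F x"
  using add[of "- x" x] zero closed group.inv_equality[OF group] by simp

lemma diff: "\<lbrakk>x \<in> vecs n; y \<in> vecs n\<rbrakk> \<Longrightarrow> F (x - y) = F x \<otimes>\<^bsub>G\<^esub> inv\<^bsub>G\<^esub> F y"
  using add[of x "- y"] minus[of y] by simp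

definition ker :: "(nat \<Rightarrow> real) set" where
  "ker = {x \<in> vecs n. F x = \<one>\<^bsub>G\<^esub>}"

lemma ker_subset: "ker \<subseteq> vecs n"
  by (auto simp: ker_def)

lemma eq_iff_ker:
  assumes "x \<in> vecs n" "y \<in> vecs n"
  shows "F x = F y \<longleftrightarrow> x - y \<in> ker"
proof -
  interpret group G by (rule group)
  have "F x \<otimes>\<^bsub>G\<^esub> inv\<^bsub>G\<^esub> F y = \<one>\<^bsub>G\<^esub> \<longleftrightarrow> F x = F y"
    using closed[OF assms(1)] closed[OF assms(2)] by (metis inv_closed inv_equality inv_inv r_inv)
  then show ?thesis using assms by (simp add: ker_def diff)
qed

lemma additive_subgroup_preimage:
  assumes "subgroup K G"
  shows "additive_subgroup {x \<in> vecs n. F x \<in> K}"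
  unfolding additive_subgroup_def
  by (auto simp: zero diff subgroup.one_closed[OF assms] subgroup.m_closed[OF assms]
      subgroup.m_inv_closed[OF assms])

lemma additive_subgroup_ker: "additive_subgroup ker"
  using additive_subgroup_preimage[OF group.triv_subgroup[OF group]] by (simp add: ker_def)

lemma openin_preimage: "openin Y U \<Longrightarrow> openin (Euclidean_space n) {x \<in> vecs n. F x \<in> U}"
  using openin_continuous_map_preimage[OF continuous] by simp

lemma seq_closed_ker:
  assumes "Hausdorff_space Y"
  shows "seq_closed n ker"
  unfolding seq_closed_def
proof (intro allI impI, elim conjE)
  fix s :: "nat \<Rightarrow> nat \<Rightarrow> real" and y
  assume s: "\<forall>k. s k \<in> ker" and y: "y \<in> vecs n" and lim: "\<forall>i<n. (\<lambda>k. s k i) \<longlonglongrightarrow> y i"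
  have "closedin Y {\<one>\<^bsub>G\<^esub>}"
    using assms topspace_eq group.is_monoid[OF group] monoid.one_closed
    by (intro closedin_Hausdorff_singleton) auto
  then have "openin Y (carrier G - {\<one>\<^bsub>G\<^esub>})" unfolding topspace_eq[symmetric] by (rule openin_diff[OF openin_topspace])
  note op = openin_preimage[OF this]
  show "y \<in> ker"
  proof (rule ccontr)
    assume "y \<notin> ker"
    then have "y \<in> {x \<in> vecs n. F x \<in> carrier G - {\<one>\<^bsub>G\<^esub>}}" using y closed by (simp add: ker_def)
    from openin_Euclidean_norm1D[OF op this] obtain e where e: "e > 0"
      "\<And>x. \<lbrakk>x \<in> vecs n; norm1 n (x - y) < e\<rbrakk> \<Longrightarrow> x \<in> {x \<in> vecs n. F x \<in> carrier G - {\<one>\<^bsub>G\<^esub>}}" by blast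
    have "(\<lambda>k. norm1 n (s k - y)) \<longlonglongrightarrow> 0" using lim by (intro norm1_tendsto_0) simp
    then have "\<forall>\<^sub>F k in sequentially. norm1 n (s k - y) < e" using e(1) by (rule order_tendstoD)
    then obtain k where "norm1 n (s k - y) < e" using eventually_happens'[OF sequentially_bot] by blast
    then show False using e(2)[of "s k"] s by (auto simp: ker_def)
  qed
qed

text \<open>The points with integral \<xi> form a union of cosets of \<open>ker\<close>, so their
  image is a subgroup disjoint from the image of the remaining points, which is open. It contains
  the generated dense subgroup, so there are no remaining points, and a linear functional with
  integral values only is zero.\<close>

lemma generates_annihilator:
  fixes \<xi> :: "(nat \<Rightarrow> real) \<Rightarrow> real"
  assumes gen: "topologically_generates G Y ((\<lambda>k. F (v k)) ` {..<N})"
    and v: "\<And>k. k < N \<Longrightarrow> v k \<in> vecs n" and \<xi>: "linear \<xi>"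
    and ker: "\<And>x. x \<in> ker \<Longrightarrow> \<xi> x \<in> \<int>" and vZ: "\<And>k. k < N \<Longrightarrow> \<xi> (v k) \<in> \<int>"
    and x: "x \<in> vecs n"
  shows "\<xi> x = 0"
proof -
  interpret group G by (rule group)
  define D where "D = {x \<in> vecs n. \<xi> x \<in> \<int>}"
  define U where "U = {x \<in> vecs n. \<xi> x \<in> - \<int>}"
  have "openin (Euclidean_space n) U"
    unfolding U_def
    using openin_continuous_map_preimage[OF continuous_map_linear[OF \<xi>, of n], of "- \<int>"]
      open_Compl[OF closed_Ints] by simp
  then have FU: "openin Y (F ` U)" using open_map by (simp add: open_map_def)
  have disj: "F ` U \<inter> F ` D = {}"
  proof (rule ccontr)
    assume "F ` U \<inter> F ` D \<noteq> {}"
    then obtain a b where ab: "a \<in> U" "b \<in> D" "F a = F b" by auto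
    then have "\<xi> (a - b) \<in> \<int>" using eq_iff_ker[of a b] ker by (auto simp: U_def D_def)
    then have "\<xi> (a - b) + \<xi> b \<in> \<int>" using ab(2) by (intro Ints_add) (auto simp: D_def)
    then show False using ab(1) \<xi> by (simp add: U_def linear_diff)
  qed
  have "subgroup (F ` D) G"
  proof (rule subgroupI)
    show "F ` D \<subseteq> carrier G" using closed by (auto simp: D_def)
    have "0 \<in> D" using \<xi> by (simp add: D_def linear_0)
    then show "F ` D \<noteq> {}" by blast
    fix a b assume "a \<in> F ` D" "b \<in> F ` D"
    then obtain p q where p: "p \<in> D" "a = F p" and q: "q \<in> D" "b = F q" by blast
    have "- p \<in> D" using p \<xi> by (simp add: D_def linear_neg)
    then have "F (- p) \<in> F ` D" by (rule imageI)
    moreover have "F (- p) = inv\<^bsub>G\<^esub> a" using p minus[of p] by (simp add: D_def)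
    ultimately show "inv\<^bsub>G\<^esub> a \<in> F ` D" by simp
    have "p + q \<in> D" using p q \<xi> by (simp add: D_def linear_add)
    then have "F (p + q) \<in> F ` D" by (rule imageI)
    moreover have "F (p + q) = a \<otimes>\<^bsub>G\<^esub> b" using p q add[of p q] by (simp add: D_def)
    ultimately show "a \<otimes>\<^bsub>G\<^esub> b \<in> F ` D" by simp
  qed
  moreover have "(\<lambda>k. F (v k)) ` {..<N} \<subseteq> F ` D" using v vZ by (auto simp: D_def)
  ultimately have gD: "generate G ((\<lambda>k. F (v k)) ` {..<N}) \<subseteq> F ` D"
    by (intro generate_subgroup_incl)
  have "U = {}"
  proof (rule ccontr)
    assume "U \<noteq> {}"
    then obtain a where a: "a \<in> U" by blast
    have "F a \<in> Y closure_of (generate G ((\<lambda>k. F (v k)) ` {..<N}))"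
      using gen a closed[of a] topspace_eq by (simp add: topologically_generates_def U_def)
    from conjunct2[OF this[unfolded in_closure_of], THEN spec, THEN mp, OF conjI, OF imageI[OF a] FU]
    obtain g where "g \<in> generate G ((\<lambda>k. F (v k)) ` {..<N})" "g \<in> F ` U"
      by (elim exE conjE)
    then show False using disj gD by blast
  qed
  then have all: "\<xi> y \<in> \<int>" if "y \<in> vecs n" for y using that by (auto simp: U_def)
  show ?thesis
  proof (rule ccontr)
    assume nz: "\<xi> x \<noteq> 0"
    \<comment> \<open>A suitable multiple of \<open>x\<close> has the value 1/2.\<close>
    have "\<xi> ((1 / (2 * \<xi> x)) *\<^sub>R x) \<in> \<int>" by (rule all) (simp add: x)
    moreover have "\<xi> ((1 / (2 * \<xi> x)) *\<^sub>R x) = 1 / 2"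
      using \<xi> nz by (simp add: linear_cmul)
    ultimately have "(1 / 2 :: real) \<in> \<int>" by simp
    then obtain m :: int where "(1 / 2 :: real) = of_int m" by (elim Ints_cases)
    then have "of_int (2 * m) = (1 :: real)" by simp
    then have "2 * m = 1" by linarith
    then show False by presburger
  qed
qed

text \<open>Let \<open>C\<close> be the closure of the preimage of the generated subgroup. If its
  subspace part were not everything, a dual coordinate multiplied by the common denominator of
  \<open>C\<close> would be a nonzero functional with integral values on \<open>C\<close>, contrary
  to \<open>ann\<close>.\<close>

lemma annihilator_generates:
  assumes v: "\<And>k. k < N \<Longrightarrow> v k \<in> vecs n"
    and ann: "\<And>\<xi> :: (nat \<Rightarrow> real) \<Rightarrow> real. \<lbrakk>linear \<xi>; \<And>x. x \<in> ker \<Longrightarrow> \<xi> x \<in> \<int>;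
      \<And>k. k < N \<Longrightarrow> \<xi> (v k) \<in> \<int>\<rbrakk> \<Longrightarrow> \<forall>x\<in>vecs n. \<xi> x = 0"
  shows "topologically_generates G Y ((\<lambda>k. F (v k)) ` {..<N})"
proof -
  interpret group G by (rule group)
  define g where "g = generate G ((\<lambda>k. F (v k)) ` {..<N})"
  have g: "subgroup g G" unfolding g_def using v closed by (intro generate_is_subgroup) auto
  define D where "D = {x \<in> vecs n. F x \<in> g}"
  have D: "additive_subgroup D" unfolding D_def by (rule additive_subgroup_preimage[OF g])
  have Dv: "D \<subseteq> vecs n" by (auto simp: D_def)
  define C where "C = {x \<in> vecs n. \<forall>e>0. \<exists>d\<in>D. norm1 n (x - d) < e}"
  have DC: "D \<subseteq> C"
  proof
    fix x assume "x \<in> D"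
    moreover have "norm1 n (x - x) < e" if "e > 0" for e using that by simp
    ultimately show "x \<in> C" unfolding C_def using Dv by blast
  qed
  have C: "additive_subgroup C"
    unfolding additive_subgroup_def
  proof (intro conjI ballI)
    show "0 \<in> C" using DC additive_subgroup_simps(1)[OF D] by blast
    fix x y assume x: "x \<in> C" and y: "y \<in> C"
    have "\<exists>d\<in>D. norm1 n (x - y - d) < e" if "e > 0" for e
    proof -
      have "e / 2 > 0" using that by simp
      then obtain a b where a: "a \<in> D" "norm1 n (x - a) < e / 2" and b: "b \<in> D" "norm1 n (y - b) < e / 2"
        using x y unfolding C_def by blast
      have eq: "x - y - (a - b) = (x - a) - (y - b)" by simp
      have "norm1 n (x - y - (a - b)) < e"
        unfolding eq using norm1_triangle_diff[of n "x - a" "y - b"] a(2) b(2) by linarith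
      then show ?thesis using additive_subgroup_simps(2)[OF D a(1) b(1)] by blast
    qed
    then show "x - y \<in> C" using x y by (simp add: C_def)
  qed
  have "seq_closed n C"
    unfolding seq_closed_def
  proof (intro allI impI, elim conjE)
    fix s :: "nat \<Rightarrow> nat \<Rightarrow> real" and y
    assume s: "\<forall>k. s k \<in> C" and y: "y \<in> vecs n" and lim: "\<forall>i<n. (\<lambda>k. s k i) \<longlonglongrightarrow> y i"
    have "\<exists>d\<in>D. norm1 n (y - d) < e" if "e > 0" for e
    proof -
      have "(\<lambda>k. norm1 n (s k - y)) \<longlonglongrightarrow> 0" using lim by (intro norm1_tendsto_0) simp
      from order_tendstoD(2)[OF this, of "e / 2"]
      have "\<forall>\<^sub>F k in sequentially. norm1 n (s k - y) < e / 2" using that by simp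
      then obtain k where k: "norm1 n (s k - y) < e / 2"
        using eventually_happens'[OF sequentially_bot] by blast
      have "s k \<in> C" "e / 2 > 0" using s that by simp_all
      then obtain d where d: "d \<in> D" "norm1 n (s k - d) < e / 2" unfolding C_def by blast
      have "norm1 n (y - d) < e"
        using norm1_diff_triangle[of n y d "s k"] norm1_minus_commute[of n y "s k"] k d(2) by linarith
      then show ?thesis using d(1) by blast
    qed
    then show "y \<in> C" using y by (simp add: C_def)
  qed
  moreover have "additive_subgroup {0 :: nat \<Rightarrow> real}" by (simp add: additive_subgroup_def)
  moreover have "C \<subseteq> vecs n" by (auto simp: C_def)
  moreover have "{0} \<subseteq> C" using additive_subgroup_simps(1)[OF C] by simp
  ultimately obtain BW BG BS Q c and k :: nat where
    co: "coordinates n (BW \<union> BG \<union> BS) c" and BW: "\<And>b t. b \<in> BW \<Longrightarrow> t *\<^sub>R b \<in> C" and k: "k > 0"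
    and cS: "\<And>v b. \<lbrakk>v \<in> C; b \<in> BS\<rbrakk> \<Longrightarrow> c b v = 0"
    and cG: "\<And>v b. \<lbrakk>v \<in> C; b \<in> BG\<rbrakk> \<Longrightarrow> real k * c b v \<in> \<int>"
    using closed_subgroup_basis[OF C] by (metis (no_types, lifting))
  have vD: "v k \<in> D" if "k < N" for k
    using v[OF that] that by (auto simp: D_def g_def intro!: generate.incl)
  have kerD: "ker \<subseteq> D" using subgroup.one_closed[OF g] by (auto simp: ker_def D_def)
  have "BG \<union> BS = {}"
  proof (rule ccontr)
    assume "BG \<union> BS \<noteq> {}"
    then obtain b where b: "b \<in> BG \<union> BS" by blast
    then have bB: "b \<in> BW \<union> BG \<union> BS" by blast
    \<comment> \<open>On \<open>C\<close> this vanishes for \<open>b\<close> in \<open>BS\<close>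
      and is integral for \<open>b\<close> in \<open>BG\<close>, but its value at \<open>b\<close>
      is \<open>k\<close>.\<close>
    define \<xi> where "\<xi> x = real k * c b x" for x
    have lin: "linear \<xi>"
      using linear_compose[OF coordinatesD(4)[OF co bB], of "\<lambda>x. real k * x"]
      by (simp add: \<xi>_def[abs_def] o_def linear_times)
    have \<xi>C: "\<xi> x \<in> \<int>" if "x \<in> C" for x
      using b cS[OF that, of b] cG[OF that, of b] by (auto simp: \<xi>_def)
    have "\<forall>x\<in>vecs n. \<xi> x = 0"
      using \<xi>C DC kerD vD by (intro ann lin) blast+
    then have "\<xi> b = 0" using coordinatesD(3)[OF co] bB by blast
    moreover have "\<xi> b = real k" using coordinatesD(5)[OF co bB bB] by (simp add: \<xi>_def)
    ultimately show False using k by simp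
  qed
  then have un: "BW \<union> BG \<union> BS = BW" by blast
  have CV: "x \<in> C" if "x \<in> vecs n" for x
  proof -
    have "x = (\<Sum>b\<in>BW. c b x *\<^sub>R b)" using coordinatesD(6)[OF co that] unfolding un .
    moreover have "(\<Sum>b\<in>BW. c b x *\<^sub>R b) \<in> C" by (intro additive_subgroup_sum[OF C] BW)
    ultimately show ?thesis by argo
  qed
  have "y \<in> Y closure_of g" if y: "y \<in> topspace Y" for y
    unfolding in_closure_of
  proof (intro conjI y allI impI, elim conjE)
    fix T assume T: "y \<in> T" "openin Y T"
    obtain x where x: "x \<in> vecs n" "y = F x" using y surjective topspace_eq by auto
    have "x \<in> {x \<in> vecs n. F x \<in> T}" using x T by simp
    from openin_Euclidean_norm1D[OF openin_preimage[OF T(2)] this] obtain e where e: "e > 0"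
      "\<And>z. \<lbrakk>z \<in> vecs n; norm1 n (z - x) < e\<rbrakk> \<Longrightarrow> z \<in> {x \<in> vecs n. F x \<in> T}" by blast
    obtain d where d: "d \<in> D" "norm1 n (x - d) < e"
      using CV[OF x(1)] e(1) unfolding C_def by blast
    then have "d \<in> {x \<in> vecs n. F x \<in> T}" using Dv norm1_minus_commute[of n x d] by (intro e(2)) auto
    then have "F d \<in> T" by simp
    then show "\<exists>z. z \<in> g \<and> z \<in> T" using d(1) by (auto simp: D_def)
  qed
  then show ?thesis
    unfolding topologically_generates_def g_def[symmetric]
    using closure_of_subset_topspace[of Y g] by blast
qed

end

subsection \<open>The exponential map\<close>

lemma mean_value_estimate:
  fixes u :: "(nat \<Rightarrow> real) \<Rightarrow> real"
  assumes z: "z \<in> vecs m" "z' \<in> vecs m"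
    and diff: "\<And>x i. \<lbrakk>x \<in> vecs m; norm1 m (x - a) \<le> norm1 m (z - a) + norm1 m (z' - a); i < m\<rbrakk>
      \<Longrightarrow> (\<lambda>t. u (x(i := t))) field_differentiable at (x i)"
    and bound: "\<And>x i. \<lbrakk>x \<in> vecs m; norm1 m (x - a) \<le> norm1 m (z - a) + norm1 m (z' - a); i < m\<rbrakk>
      \<Longrightarrow> \<bar>partial_deriv i u x - c i\<bar> \<le> M"
  shows "\<bar>u z - u z' - (\<Sum>i<m. c i * (z i - z' i))\<bar> \<le> M * norm1 m (z - z')"
proof -
  \<comment> \<open>A path from \<open>z'\<close> to \<open>z\<close> that replaces one coordinate
    at a time. On it each coordinate lies between those of \<open>z'\<close> and \<open>z\<close>,
    so the distance to \<open>a\<close> is at most the sum of the two distances.\<close>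
  define w where "w j i = (if i < j then z i else z' i)" for j i
  have claim: "\<bar>u (w j) - u z' - (\<Sum>i<j. c i * (z i - z' i))\<bar> \<le> M * (\<Sum>i<j. \<bar>z i - z' i\<bar>)"
    if "j \<le> m" for j
    using that
  proof (induction j)
    case 0
    have "w 0 = z'" by (auto simp: w_def)
    then show ?case by simp
  next
    case (Suc j)
    then have j: "j < m" by simp
    define f where "f t = u ((w j)(j := t)) - c j * t" for t
    define f' where "f' t = partial_deriv j u ((w j)(j := t)) - c j" for t
    have der: "(f has_field_derivative f' t) (at t within closed_segment (z' j) (z j)) \<and> norm (f' t) \<le> M"
      if t: "t \<in> closed_segment (z' j) (z j)" for t
    proof -
      let ?x = "(w j)(j := t)"
      have x: "?x \<in> vecs m" using z j by (auto simp: w_def vecs_def)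
      have "\<bar>?x i - a i\<bar> \<le> \<bar>z i - a i\<bar> + \<bar>z' i - a i\<bar>" for i
        using t by (auto simp: w_def closed_segment_eq_real_ivl split: if_splits)
      then have "norm1 m (?x - a) \<le> norm1 m (z - a) + norm1 m (z' - a)"
        unfolding norm1_def sum.distrib[symmetric] minus_apply by (intro sum_mono)
      note d = diff[OF x this j] and b = bound[OF x this j]
      have "(\<lambda>s. u (?x(j := s))) = (\<lambda>s. u ((w j)(j := s)))" by simp
      then have "((\<lambda>s. u ((w j)(j := s))) has_field_derivative partial_deriv j u ?x) (at t)"
        using d unfolding partial_deriv_def by (simp add: DERIV_deriv_iff_field_differentiable)
      then have "(f has_field_derivative f' t) (at t)"
        unfolding f_def f'_def by (auto intro!: derivative_eq_intros)
      then show ?thesis using b by (auto simp: f'_def intro: has_field_derivative_at_within)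
    qed
    have "norm (f (z j) - f (z' j)) \<le> M * norm (z j - z' j)"
      by (rule field_differentiable_bound[of "closed_segment (z' j) (z j)" f f']) (use der in auto)
    moreover have "(w j)(j := z' j) = w j" "(w j)(j := z j) = w (Suc j)"
      by (auto simp: w_def fun_eq_iff less_Suc_eq)
    ultimately have "\<bar>u (w (Suc j)) - u (w j) - c j * (z j - z' j)\<bar> \<le> M * \<bar>z j - z' j\<bar>"
      by (simp add: f_def algebra_simps)
    then show ?case using Suc.IH j by (simp add: algebra_simps)
  qed
  have "w m = z" using z by (auto simp: w_def vecs_def)
  then show ?thesis using claim[of m] by (simp add: norm1_def)
qed

lemma continuous_map_norm1D:
  assumes v: "continuous_map (subtopology (Euclidean_space m) S) euclideanreal v"
    and S: "openin (Euclidean_space m) S" "a \<in> S" and e: "e > 0"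
  obtains r where "r > 0"
    "\<And>x. \<lbrakk>x \<in> vecs m; norm1 m (x - a) < r\<rbrakk> \<Longrightarrow> x \<in> S \<and> \<bar>v x - v a\<bar> < e"
proof -
  have "openin (subtopology (Euclidean_space m) S)
    {x \<in> topspace (subtopology (Euclidean_space m) S). v x \<in> {v a - e<..<v a + e}}"
    by (rule openin_continuous_map_preimage[OF v]) simp
  then have "openin (Euclidean_space m)
    {x \<in> topspace (subtopology (Euclidean_space m) S). v x \<in> {v a - e<..<v a + e}}"
    using S(1) by (rule openin_trans_full)
  moreover have "a \<in> {x \<in> topspace (subtopology (Euclidean_space m) S). v x \<in> {v a - e<..<v a + e}}"
    using S e openin_subset[OF S(1)] by auto
  ultimately obtain r where r: "r > 0" "\<And>x. \<lbrakk>x \<in> vecs m; norm1 m (x - a) < r\<rbrakk> \<Longrightarrow>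
      x \<in> {x \<in> topspace (subtopology (Euclidean_space m) S). v x \<in> {v a - e<..<v a + e}}"
    using openin_Euclidean_norm1D by blast
  show ?thesis
  proof (rule that[OF r(1)])
    fix x assume "x \<in> vecs m" "norm1 m (x - a) < r"
    from r(2)[OF this] show "x \<in> S \<and> \<bar>v x - v a\<bar> < e" by (auto simp: abs_less_iff)
  qed
qed

lemma uniform_radius:
  fixes P :: "nat \<Rightarrow> real \<Rightarrow> bool"
  assumes "\<And>i. i < m \<Longrightarrow> \<exists>r>0. P i r" and mono: "\<And>i r s. \<lbrakk>P i r; 0 < s; s \<le> r\<rbrakk> \<Longrightarrow> P i s"
  shows "\<exists>r>0. \<forall>i<m. P i r"
proof -
  have "\<forall>i\<in>{..<m}. \<exists>r. 0 < r \<and> P i r" using assms(1) by auto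
  from bchoice[OF this] obtain f where f: "\<forall>i\<in>{..<m}. 0 < f i \<and> P i (f i)" ..
  define r where "r = Min (insert 1 (f ` {..<m}))"
  have "r > 0" using f by (auto simp: r_def)
  moreover have "P i r" if "i < m" for i
    using f that \<open>r > 0\<close> by (intro mono[of i "f i" r]) (auto simp: r_def)
  ultimately show ?thesis by blast
qed

lemma C1_lipschitz_at:
  assumes u: "Ck_on (Suc 0) m S u" and S: "openin (Euclidean_space m) S" "a \<in> S"
  shows "\<exists>r>0. \<exists>L>0. \<forall>x\<in>vecs m. norm1 m (x - a) < r \<longrightarrow> x \<in> S \<and> \<bar>u x - u a\<bar> \<le> L * norm1 m (x - a)"
proof -
  let ?P = "\<lambda>i r. \<forall>x\<in>vecs m. norm1 m (x - a) < r \<longrightarrow>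
      x \<in> S \<and> \<bar>partial_deriv i u x - partial_deriv i u a\<bar> < 1"
  have "\<exists>r>0. ?P i r" if "i < m" for i
  proof -
    have "continuous_map (subtopology (Euclidean_space m) S) euclideanreal (partial_deriv i u)"
      using u that by simp
    from continuous_map_norm1D[OF this S zero_less_one] obtain r where "r > 0"
      "\<And>x. \<lbrakk>x \<in> vecs m; norm1 m (x - a) < r\<rbrakk> \<Longrightarrow>
        x \<in> S \<and> \<bar>partial_deriv i u x - partial_deriv i u a\<bar> < 1" by blast
    then show ?thesis by (intro exI[of _ r]) simp
  qed
  moreover have "?P i s" if "?P i r" "0 < s" "s \<le> r" for i r s
    using that by (meson order.strict_trans2)
  ultimately have "\<exists>r>0. \<forall>i<m. ?P i r" by (rule uniform_radius)
  then obtain r1 where r1: "r1 > 0" "\<forall>i<m. ?P i r1" by (elim exE conjE)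
  obtain r2 where r2: "r2 > 0" "\<And>x. \<lbrakk>x \<in> vecs m; norm1 m (x - a) < r2\<rbrakk> \<Longrightarrow> x \<in> S"
    using openin_Euclidean_norm1D[OF S] by blast
  define r where "r = min r1 r2"
  define L where "L = 1 + (\<Sum>i<m. \<bar>partial_deriv i u a\<bar>)"
  have a: "a \<in> vecs m" using S openin_subset by fastforce
  have "L > 0" unfolding L_def by (simp add: add_pos_nonneg sum_nonneg)
  moreover have "r > 0" using r1 r2 by (simp add: r_def)
  moreover have "x \<in> S \<and> \<bar>u x - u a\<bar> \<le> L * norm1 m (x - a)"
    if x: "x \<in> vecs m" "norm1 m (x - a) < r" for x
  proof -
    have xS: "x \<in> S" using x r2 by (simp add: r_def)
    have "\<bar>u x - u a - (\<Sum>i<m. partial_deriv i u a * (x i - a i))\<bar> \<le> 1 * norm1 m (x - a)"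
    proof (rule mean_value_estimate[OF x(1) a])
      fix y i assume "y \<in> vecs m" "norm1 m (y - a) \<le> norm1 m (x - a) + norm1 m (a - a)" "i < m"
      then have "y \<in> vecs m" "norm1 m (y - a) < r1" "norm1 m (y - a) < r2"
        using x by (simp_all add: r_def)
      then show "(\<lambda>t. u (y(i := t))) field_differentiable at (y i)"
        "\<bar>partial_deriv i u y - partial_deriv i u a\<bar> \<le> 1"
        using u r1(2)[rule_format, of i y] r2(2)[of y] \<open>i < m\<close> by (auto simp: less_imp_le)
    qed
    moreover have "\<bar>\<Sum>i<m. partial_deriv i u a * (x i - a i)\<bar> \<le> (\<Sum>i<m. \<bar>partial_deriv i u a\<bar>) * norm1 m (x - a)"
    proof -
      have "\<bar>\<Sum>i<m. partial_deriv i u a * (x i - a i)\<bar> \<le> (\<Sum>i<m. \<bar>partial_deriv i u a\<bar> * norm1 m (x - a))"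
        using component_le_norm1[of _ m "x - a"]
        by (intro order.trans[OF sum_abs] sum_mono) (auto simp: abs_mult intro!: mult_left_mono)
      then show ?thesis by (simp add: sum_distrib_right)
    qed
    ultimately show ?thesis using xS by (simp add: L_def distrib_right)
  qed
  ultimately show ?thesis by blast
qed

text \<open>The partial derivatives are Lipschitz at \<open>a\<close>, so on the way from
  \<open>z'\<close> to \<open>z\<close> they deviate from their values at \<open>a\<close> by a
  multiple of the two distances. A bound for differences, not only for single values, is what later
  makes the error of the group law Lipschitz with a small constant.\<close>

lemma C2_estimate:
  assumes u: "Ck_on (Suc (Suc 0)) m S u" and S: "openin (Euclidean_space m) S" "a \<in> S"
  shows "\<exists>r>0. \<exists>C>0. \<forall>z\<in>vecs m. \<forall>z'\<in>vecs m. norm1 m (z - a) < r \<and> norm1 m (z' - a) < r \<longrightarrow>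
    z \<in> S \<and> \<bar>u z - u z' - (\<Sum>i<m. partial_deriv i u a * (z i - z' i))\<bar>
      \<le> C * (norm1 m (z - a) + norm1 m (z' - a)) * norm1 m (z - z')"
proof -
  let ?P = "\<lambda>i r. \<exists>L>0. \<forall>x\<in>vecs m. norm1 m (x - a) < r \<longrightarrow>
      x \<in> S \<and> \<bar>partial_deriv i u x - partial_deriv i u a\<bar> \<le> L * norm1 m (x - a)"
  have "\<exists>r>0. ?P i r" if "i < m" for i
    by (rule C1_lipschitz_at[OF _ S]) (use u that in simp)
  moreover have "?P i s" if "?P i r" "0 < s" "s \<le> r" for i r s
    using that by (meson order.strict_trans2)
  ultimately have "\<exists>r>0. \<forall>i<m. ?P i r" by (rule uniform_radius)
  then obtain r1 where r1: "r1 > 0" "\<forall>i\<in>{..<m}. ?P i r1" by auto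
  from bchoice[OF r1(2)] obtain L where L: "\<forall>i\<in>{..<m}. L i > 0 \<and> (\<forall>x\<in>vecs m. norm1 m (x - a) < r1 \<longrightarrow>
      x \<in> S \<and> \<bar>partial_deriv i u x - partial_deriv i u a\<bar> \<le> L i * norm1 m (x - a))" ..
  obtain r2 where r2: "r2 > 0" "\<And>x. \<lbrakk>x \<in> vecs m; norm1 m (x - a) < r2\<rbrakk> \<Longrightarrow> x \<in> S"
    using openin_Euclidean_norm1D[OF S] by blast
  \<comment> \<open>Halved, since intermediate points may be as far from \<open>a\<close> as the sum
    of both distances.\<close>
  define r where "r = min r1 r2 / 2"
  define C where "C = 1 + (\<Sum>i<m. L i)"
  have Li: "L i \<le> C" if "i < m" for i
  proof -
    have "L i \<le> (\<Sum>i<m. L i)" using L that by (intro member_le_sum) (auto intro: less_imp_le)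
    then show ?thesis by (simp add: C_def)
  qed
  have "C > 0" unfolding C_def using L by (intro add_pos_nonneg sum_nonneg) (auto intro: less_imp_le)
  moreover have "r > 0" using r1 r2 by (simp add: r_def)
  moreover have "z \<in> S \<and> \<bar>u z - u z' - (\<Sum>i<m. partial_deriv i u a * (z i - z' i))\<bar>
      \<le> C * (norm1 m (z - a) + norm1 m (z' - a)) * norm1 m (z - z')"
    if z: "z \<in> vecs m" "z' \<in> vecs m" "norm1 m (z - a) < r" "norm1 m (z' - a) < r" for z z'
  proof
    show "z \<in> S"
      using z(1,3) norm1_nonneg[of m "z - a"] by (intro r2(2)) (auto simp: r_def simp del: norm1_nonneg)
    show "\<bar>u z - u z' - (\<Sum>i<m. partial_deriv i u a * (z i - z' i))\<bar>
      \<le> C * (norm1 m (z - a) + norm1 m (z' - a)) * norm1 m (z - z')"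
    proof (rule mean_value_estimate[OF z(1,2)])
      fix y i assume y: "y \<in> vecs m" "norm1 m (y - a) \<le> norm1 m (z - a) + norm1 m (z' - a)" and i: "i < m"
      have yr: "norm1 m (y - a) < r1" "norm1 m (y - a) < r2" using y z(3,4) by (auto simp: r_def min_def split: if_splits)
      then show "(\<lambda>t. u (y(i := t))) field_differentiable at (y i)"
        using u r2(2)[OF y(1)] i by auto
      have "\<bar>partial_deriv i u y - partial_deriv i u a\<bar> \<le> L i * norm1 m (y - a)"
        using L i y(1) yr(1) by simp
      also have "\<dots> \<le> C * (norm1 m (z - a) + norm1 m (z' - a))"
        using Li[OF i] y(2) \<open>C > 0\<close> by (intro mult_mono) auto
      finally show "\<bar>partial_deriv i u y - partial_deriv i u a\<bar> \<le> C * (norm1 m (z - a) + norm1 m (z' - a))" .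
    qed
  qed
  ultimately show ?thesis by blast
qed

section \<open>Translations and concatenation of vectors\<close>

lemma openin_translate:
  assumes V: "openin (Euclidean_space n) V" and a: "a \<in> vecs n"
  shows "openin (Euclidean_space n) ((+) a ` V)"
  unfolding openin_Euclidean_norm1
proof (intro conjI ballI)
  have Vv: "V \<subseteq> vecs n" using openin_subset[OF V] by simp
  then show "(+) a ` V \<subseteq> vecs n" using a by auto
  fix x assume "x \<in> (+) a ` V"
  then obtain v where v: "v \<in> V" "x = a + v" by blast
  obtain e where e: "e > 0" "\<And>y. \<lbrakk>y \<in> vecs n; norm1 n (y - v) < e\<rbrakk> \<Longrightarrow> y \<in> V"
    using openin_Euclidean_norm1D[OF V v(1)] by blast
  have "y \<in> (+) a ` V" if "y \<in> vecs n" "norm1 n (y - x) < e" for y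
  proof -
    have "y - a - v = y - x" using v by simp
    then have "norm1 n (y - a - v) < e" using that(2) by (simp only:)
    then have "y - a \<in> V" using that(1) a by (intro e(2)) simp_all
    moreover have "y = a + (y - a)" by simp
    ultimately show ?thesis by (intro image_eqI[of _ _ "y - a"])
  qed
  then show "\<exists>e>0. \<forall>y\<in>vecs n. norm1 n (y - x) < e \<longrightarrow> y \<in> (+) a ` V" using e(1) by blast
qed

lemma translate_preimage:
  assumes "a \<in> vecs n" "V \<subseteq> vecs n"
  shows "{x \<in> vecs n. a + x \<in> V} = (+) (- a) ` V"
proof (intro equalityI subsetI)
  fix x assume "x \<in> {x \<in> vecs n. a + x \<in> V}"
  then have "a + x \<in> V" by simp
  moreover have "x = - a + (a + x)" by simp
  ultimately show "x \<in> (+) (- a) ` V" by (intro image_eqI[of _ _ "a + x"])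
next
  fix x assume "x \<in> (+) (- a) ` V"
  then obtain v where v: "v \<in> V" "x = - a + v" by blast
  then show "x \<in> {x \<in> vecs n. a + x \<in> V}" using assms by auto
qed

lemma continuous_map_translate:
  assumes "a \<in> vecs n"
  shows "continuous_map (Euclidean_space n) (Euclidean_space n) ((+) a)"
  unfolding continuous_map_def topspace_Euclidean_vecs
proof (intro conjI allI impI)
  show "(+) a \<in> vecs n \<rightarrow> vecs n" using assms by auto
  fix V assume V: "openin (Euclidean_space n) V"
  have "V \<subseteq> vecs n" using openin_subset[OF V] by simp
  show "openin (Euclidean_space n) {x \<in> vecs n. a + x \<in> V}"
    unfolding translate_preimage[OF assms \<open>V \<subseteq> vecs n\<close>]
    by (intro openin_translate[OF V]) (simp add: assms)
qed

lemma sum_lessThan_add: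
  fixes f :: "nat \<Rightarrow> 'a::comm_monoid_add"
  shows "(\<Sum>i<a + b. f i) = (\<Sum>i<a. f i) + (\<Sum>i<b. f (a + i))"
  by (induction b) (simp_all add: add.assoc)

text \<open>The coordinate layout of \<open>prod_atlas\<close>.\<close>

definition join :: "nat \<Rightarrow> (nat \<Rightarrow> real) \<Rightarrow> (nat \<Rightarrow> real) \<Rightarrow> nat \<Rightarrow> real" where
  "join n x y i = (if i < n then x i else y (i - n))"

lemma join_in_vecs [simp]: "y \<in> vecs m \<Longrightarrow> join n x y \<in> vecs (n + m)"
  by (simp add: join_def vecs_def)

lemma join_diff: "join n x y - join n x' y' = join n (x - x') (y - y')"
  by (auto simp: join_def fun_eq_iff)

lemma norm1_join: "norm1 (n + m) (join n x y) = norm1 n x + norm1 m y"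
  by (simp add: norm1_def sum_lessThan_add join_def)

lemma join_inject:
  assumes "join n x y = join n x' y'" "x \<in> vecs n" "x' \<in> vecs n"
  shows "x = x'" "y = y'"
proof -
  have "x i = x' i" if "i < n" for i
    using fun_cong[OF assms(1), of i] that by (simp add: join_def)
  then show "x = x'" by (rule vecs_eqI[OF assms(2,3)])
  show "y = y'"
  proof
    fix i
    show "y i = y' i" using fun_cong[OF assms(1), of "n + i"] by (simp add: join_def)
  qed
qed

text \<open>\<open>p\<close> is an inverse chart, moved so that 0 goes to the identity, and \<mu> is
  the multiplication seen in it. By \<open>estimate\<close> the deviation of \<mu> from addition is
  Lipschitz near 0 with a constant proportional to the size of the arguments. This is all that the
  exponential map uses of smoothness.\<close>

locale local_product =
  fixes n :: nat and A :: "('a, 'b) monoid_scheme" and X :: "'a topology"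
    and p :: "(nat \<Rightarrow> real) \<Rightarrow> 'a" and \<mu> :: "(nat \<Rightarrow> real) \<Rightarrow> (nat \<Rightarrow> real) \<Rightarrow> nat \<Rightarrow> real"
    and \<Omega> :: "(nat \<Rightarrow> real) set" and r C :: real
  assumes comm: "comm_group A" and topological_group: "topological_group A X"
    and r: "r > 0" and C: "C > 0"
    and open_domain: "openin (Euclidean_space n) \<Omega>"
    and ball: "\<And>x. \<lbrakk>x \<in> vecs n; norm1 n x < r\<rbrakk> \<Longrightarrow> x \<in> \<Omega>"
    and p_zero: "p 0 = \<one>\<^bsub>A\<^esub>" and p_inj: "inj_on p \<Omega>"
    and p_continuous: "continuous_map (subtopology (Euclidean_space n) \<Omega>) X p"
    and p_open: "\<And>V. \<lbrakk>openin (Euclidean_space n) V; V \<subseteq> \<Omega>\<rbrakk> \<Longrightarrow> openin X (p ` V)"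
    and product: "\<And>x y. \<lbrakk>x \<in> vecs n; y \<in> vecs n; norm1 n x < r; norm1 n y < r\<rbrakk>
      \<Longrightarrow> \<mu> x y \<in> \<Omega> \<and> p (\<mu> x y) = p x \<otimes>\<^bsub>A\<^esub> p y"
    and estimate: "\<And>x y x' y'. \<lbrakk>x \<in> vecs n; y \<in> vecs n; x' \<in> vecs n; y' \<in> vecs n;
      norm1 n x < r; norm1 n y < r; norm1 n x' < r; norm1 n y' < r\<rbrakk>
      \<Longrightarrow> norm1 n (\<mu> x y - x - y - (\<mu> x' y' - x' - y'))
        \<le> C * (norm1 n x + norm1 n y + norm1 n x' + norm1 n y') * (norm1 n (x - x') + norm1 n (y - y'))"

lemma smooth_atlas_chart:
  assumes atlas: "smooth_atlas n X \<A>" and U\<phi>: "(U, \<phi>) \<in> \<A>"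
  shows "openin X U" "openin (Euclidean_space n) (\<phi> ` U)" "inj_on \<phi> U"
    "continuous_map (subtopology X U) (Euclidean_space n) \<phi>"
    "continuous_map (subtopology (Euclidean_space n) (\<phi> ` U)) X (inv_into U \<phi>)"
    "\<And>V. \<lbrakk>openin (Euclidean_space n) V; V \<subseteq> \<phi> ` U\<rbrakk> \<Longrightarrow> openin X (inv_into U \<phi> ` V)"
proof -
  have "\<forall>(U, \<phi>)\<in>\<A>. openin X U \<and> openin (Euclidean_space n) (\<phi> ` U) \<and>
        homeomorphic_map (subtopology X U) (subtopology (Euclidean_space n) (\<phi> ` U)) \<phi>"
    using atlas by (simp add: smooth_atlas_def)
  from bspec[OF this U\<phi>] have U: "openin X U" and \<phi>U: "openin (Euclidean_space n) (\<phi> ` U)"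
    and hom: "homeomorphic_map (subtopology X U) (subtopology (Euclidean_space n) (\<phi> ` U)) \<phi>" by auto
  have tU: "topspace (subtopology X U) = U" using openin_subset[OF U] by auto
  have inj: "inj_on \<phi> U" using homeomorphic_imp_injective_map[OF hom] tU by simp
  define \<psi> where "\<psi> = inv_into U \<phi>"
  have \<psi>\<phi>: "\<psi> (\<phi> a) = a" if "a \<in> U" for a using inj that by (simp add: \<psi>_def)
  have \<psi>U: "\<psi> x \<in> U" "\<phi> (\<psi> x) = x" if "x \<in> \<phi> ` U" for x
    using that by (simp_all add: \<psi>_def inv_into_into f_inv_into_f)
  have \<phi>cont: "continuous_map (subtopology X U) (Euclidean_space n) \<phi>"
    using homeomorphic_imp_continuous_map[OF hom] by (simp add: continuous_map_in_subtopology)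
  have \<psi>cont: "continuous_map (subtopology (Euclidean_space n) (\<phi> ` U)) X \<psi>"
  proof -
    obtain g where g: "homeomorphic_maps (subtopology X U) (subtopology (Euclidean_space n) (\<phi> ` U)) \<phi> g"
      using hom homeomorphic_map_maps by blast
    have "continuous_map (subtopology (Euclidean_space n) (\<phi> ` U)) X g"
      using g by (simp add: homeomorphic_maps_def continuous_map_in_subtopology)
    moreover have "g x = \<psi> x" if "x \<in> topspace (subtopology (Euclidean_space n) (\<phi> ` U))" for x
    proof -
      have "x \<in> \<phi> ` U" using that by simp
      then obtain a where a: "a \<in> U" "x = \<phi> a" by blast
      then have "g (\<phi> a) = a" using g tU by (simp add: homeomorphic_maps_def)
      then show ?thesis using a \<psi>\<phi> by simp
    qed
    ultimately show ?thesis by (rule continuous_map_eq)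
  qed
  have \<psi>open: "openin X (\<psi> ` V)" if V: "openin (Euclidean_space n) V" "V \<subseteq> \<phi> ` U" for V
  proof -
    from openin_continuous_map_preimage[OF \<phi>cont V(1)]
    have "openin (subtopology X U) {a \<in> U. \<phi> a \<in> V}" unfolding tU .
    then have "openin X {a \<in> U. \<phi> a \<in> V}" using U by (rule openin_trans_full)
    moreover have "{a \<in> U. \<phi> a \<in> V} = \<psi> ` V"
    proof (intro equalityI subsetI)
      fix a assume "a \<in> {a \<in> U. \<phi> a \<in> V}"
      then show "a \<in> \<psi> ` V" using \<psi>\<phi>[of a] by (intro rev_image_eqI[of "\<phi> a"]) auto
    next
      fix a assume "a \<in> \<psi> ` V"
      then show "a \<in> {a \<in> U. \<phi> a \<in> V}" using \<psi>U V(2) by auto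
    qed
    ultimately show ?thesis by simp
  qed
  show "openin X U" "openin (Euclidean_space n) (\<phi> ` U)" "inj_on \<phi> U"
    "continuous_map (subtopology X U) (Euclidean_space n) \<phi>"
    "continuous_map (subtopology (Euclidean_space n) (\<phi> ` U)) X (inv_into U \<phi>)"
    by (fact U \<phi>U inj \<phi>cont \<psi>cont[unfolded \<psi>_def])+
  show "openin X (inv_into U \<phi> ` V)" if "openin (Euclidean_space n) V" "V \<subseteq> \<phi> ` U" for V
    using \<psi>open[OF that] unfolding \<psi>_def .
qed

text \<open>Multiplying by the identity changes nothing, so both partial differentials of the group
  law at the identity are identities and its linear part is addition. The second order estimate at
  this point then becomes \<open>estimate\<close>.\<close>

lemma lie_structure_local_product:
  fixes A :: "('a, 'b) monoid_scheme"
  assumes lie: "lie_structure n A X \<A>" and comm: "comm_group A"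
  shows "\<exists>p \<mu> \<Omega> r C. local_product n A X p \<mu> \<Omega> r C"
proof -
  interpret comm_group A by (rule comm)
  have tg: "topological_group A X" and atlas: "smooth_atlas n X \<A>"
    and smooth: "smooth_map (n + n) (prod_atlas n \<A> \<A>) n \<A> (\<lambda>(x, y). x \<otimes>\<^bsub>A\<^esub> y)"
    using lie by (simp_all add: lie_structure_def)
  have top: "topspace X = carrier A" using tg by (simp add: topological_group_def)
  have "\<one>\<^bsub>A\<^esub> \<in> (\<Union>(U, \<phi>)\<in>\<A>. U)" using atlas top by (simp add: smooth_atlas_def)
  then obtain U \<phi> where U\<phi>: "(U, \<phi>) \<in> \<A>" and one: "\<one>\<^bsub>A\<^esub> \<in> U" by auto
  note chart = smooth_atlas_chart[OF atlas U\<phi>]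
  have Uc: "U \<subseteq> carrier A" using openin_subset[OF chart(1)] top by simp
  have \<phi>U: "openin (Euclidean_space n) (\<phi> ` U)" and inj: "inj_on \<phi> U" by (fact chart)+
  have \<phi>v: "\<phi> ` U \<subseteq> vecs n" using openin_subset[OF \<phi>U] by simp
  then have \<phi>v': "\<phi> a \<in> vecs n" if "a \<in> U" for a using that by blast
  define \<psi> where "\<psi> = inv_into U \<phi>"
  have \<psi>\<phi>: "\<psi> (\<phi> a) = a" if "a \<in> U" for a using inj that by (simp add: \<psi>_def)
  have \<psi>U: "\<psi> x \<in> U" "\<phi> (\<psi> x) = x" if "x \<in> \<phi> ` U" for x
    using that by (simp_all add: \<psi>_def inv_into_into f_inv_into_f)
  note \<psi>cont = chart(5)[folded \<psi>_def] and \<psi>open = chart(6)[folded \<psi>_def]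
  define c where "c = \<phi> \<one>\<^bsub>A\<^esub>"
  have c: "c \<in> vecs n" "c \<in> \<phi> ` U" unfolding c_def using \<phi>v' one by auto
  define \<Omega> where "\<Omega> = {x \<in> vecs n. c + x \<in> \<phi> ` U}"
  define p where "p x = \<psi> (c + x)" for x
  define \<mu> where "\<mu> x y = \<phi> (p x \<otimes>\<^bsub>A\<^esub> p y) - c" for x y
  have \<Omega>open: "openin (Euclidean_space n) \<Omega>"
    unfolding \<Omega>_def translate_preimage[OF c(1) \<phi>v] by (intro openin_translate[OF \<phi>U]) (simp add: c)
  have p0: "p 0 = \<one>\<^bsub>A\<^esub>" using \<psi>\<phi>[OF one] by (simp add: p_def c_def)
  have pU: "p x \<in> U" "\<phi> (p x) = c + x" if "x \<in> \<Omega>" for x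
    using \<psi>U[of "c + x"] that by (simp_all add: p_def \<Omega>_def)
  have pinj: "inj_on p \<Omega>"
  proof (rule inj_onI)
    fix x y assume "x \<in> \<Omega>" "y \<in> \<Omega>" "p x = p y"
    then have "c + x = c + y" using pU(2) by metis
    then show "x = y" by simp
  qed
  have pcont: "continuous_map (subtopology (Euclidean_space n) \<Omega>) X p"
  proof -
    have "continuous_map (subtopology (Euclidean_space n) \<Omega>) (subtopology (Euclidean_space n) (\<phi> ` U)) ((+) c)"
      unfolding continuous_map_in_subtopology
      using continuous_map_from_subtopology[OF continuous_map_translate[OF c(1)]] by (auto simp: \<Omega>_def)
    from continuous_map_compose[OF this \<psi>cont] show ?thesis by (simp add: p_def[abs_def] o_def)
  qed
  have popen: "openin X (p ` V)" if V: "openin (Euclidean_space n) V" "V \<subseteq> \<Omega>" for V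
  proof -
    have "openin X (\<psi> ` ((+) c ` V))"
      using V(2) by (intro \<psi>open openin_translate V c) (auto simp: \<Omega>_def)
    then show ?thesis by (simp add: image_image p_def)
  qed
  define \<Phi> where "\<Phi> = (\<lambda>(x, y) i. if i < n then \<phi> x i else \<phi> y (i - n))"
  have \<Phi>: "\<Phi> (a, b) = join n (\<phi> a) (\<phi> b)" for a b by (auto simp: \<Phi>_def join_def)
  have "(U \<times> U, \<Phi>) \<in> prod_atlas n \<A> \<A>" using U\<phi> unfolding prod_atlas_def \<Phi>_def by blast
  define S where "S = \<Phi> ` {q \<in> U \<times> U. (\<lambda>(x, y). x \<otimes>\<^bsub>A\<^esub> y) q \<in> U}"
  define u where "u j z = \<phi> ((\<lambda>(x, y). x \<otimes>\<^bsub>A\<^esub> y) (inv_into (U \<times> U) \<Phi> z)) j" for j z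
  have "smooth_on (n + n) n S (\<phi> \<circ> (\<lambda>(x, y). x \<otimes>\<^bsub>A\<^esub> y) \<circ> inv_into (U \<times> U) \<Phi>)"
    using bspec[OF smooth[unfolded smooth_map_def] \<open>(U \<times> U, \<Phi>) \<in> _\<close>] U\<phi>
    unfolding S_def by (auto dest: bspec)
  then have S: "openin (Euclidean_space (n + n)) S" and Ck: "\<And>j k. j < n \<Longrightarrow> Ck_on k (n + n) S (u j)"
    by (simp_all add: smooth_on_def u_def[abs_def])
  have inj\<Phi>: "inj_on \<Phi> (U \<times> U)"
  proof (rule inj_onI, clarify)
    fix a b a' b' assume ab: "a \<in> U" "b \<in> U" "a' \<in> U" "b' \<in> U" "\<Phi> (a, b) = \<Phi> (a', b')"
    then have "\<phi> a = \<phi> a'" "\<phi> b = \<phi> b'" using join_inject[of n "\<phi> a" "\<phi> b" "\<phi> a'" "\<phi> b'"] \<phi>v' by (simp_all add: \<Phi>)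
    then show "a = a' \<and> b = b'" using inj ab by (auto dest: inj_onD)
  qed
  define z0 where "z0 = join n c c"
  have "\<Phi> (\<one>\<^bsub>A\<^esub>, \<one>\<^bsub>A\<^esub>) = z0" by (simp add: \<Phi> z0_def c_def)
  then have z0: "z0 \<in> S" unfolding S_def using one by (intro rev_image_eqI[of "(\<one>\<^bsub>A\<^esub>, \<one>\<^bsub>A\<^esub>)"]) auto
  have key: "x \<in> \<Omega> \<and> y \<in> \<Omega> \<and> p x \<otimes>\<^bsub>A\<^esub> p y \<in> U \<and> u j (join n (c + x) (c + y)) = c j + \<mu> x y j"
    if x: "x \<in> vecs n" and y: "y \<in> vecs n" and z: "join n (c + x) (c + y) \<in> S" for x y j
  proof -
    obtain a b where ab: "a \<in> U" "b \<in> U" "a \<otimes>\<^bsub>A\<^esub> b \<in> U" "join n (c + x) (c + y) = \<Phi> (a, b)"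
      using z unfolding S_def by auto
    have eq: "c + x = \<phi> a" "c + y = \<phi> b"
      using join_inject[OF ab(4)[unfolded \<Phi>]] x c(1) \<phi>v'[OF ab(1)] by simp_all
    then have xy: "x \<in> \<Omega>" "y \<in> \<Omega>" using x y ab by (auto simp: \<Omega>_def)
    have p: "p x = a" "p y = b" using \<psi>\<phi> ab by (simp_all add: p_def eq)
    have "inv_into (U \<times> U) \<Phi> (\<Phi> (a, b)) = (a, b)" using inj\<Phi> ab by (intro inv_into_f_f) auto
    then have "u j (join n (c + x) (c + y)) = \<phi> (a \<otimes>\<^bsub>A\<^esub> b) j" unfolding ab(4) u_def by simp
    also have "\<dots> = c j + \<mu> x y j" by (simp add: \<mu>_def p)
    finally show ?thesis using xy ab(3) p by simp
  qed
  let ?P = "\<lambda>j r. \<exists>C>0. \<forall>z\<in>vecs (n + n). \<forall>z'\<in>vecs (n + n).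
      norm1 (n + n) (z - z0) < r \<and> norm1 (n + n) (z' - z0) < r \<longrightarrow>
      z \<in> S \<and> \<bar>u j z - u j z' - (\<Sum>i<n + n. partial_deriv i (u j) z0 * (z i - z' i))\<bar>
        \<le> C * (norm1 (n + n) (z - z0) + norm1 (n + n) (z' - z0)) * norm1 (n + n) (z - z')"
  have "\<exists>r>0. ?P j r" if "j < n" for j
    by (rule C2_estimate[OF Ck[OF that] S z0])
  moreover have "?P j s" if "?P j r" "0 < s" "s \<le> r" for j r s
    using that by (meson order.strict_trans2)
  ultimately have "\<exists>r>0. \<forall>j<n. ?P j r" by (rule uniform_radius)
  then obtain R where R: "R > 0" "\<forall>j\<in>{..<n}. ?P j R" by auto
  from bchoice[OF R(2)] obtain K where K: "\<forall>j\<in>{..<n}. K j > 0 \<and> (\<forall>z\<in>vecs (n + n). \<forall>z'\<in>vecs (n + n).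
      norm1 (n + n) (z - z0) < R \<and> norm1 (n + n) (z' - z0) < R \<longrightarrow>
      z \<in> S \<and> \<bar>u j z - u j z' - (\<Sum>i<n + n. partial_deriv i (u j) z0 * (z i - z' i))\<bar>
        \<le> K j * (norm1 (n + n) (z - z0) + norm1 (n + n) (z' - z0)) * norm1 (n + n) (z - z'))" ..
  obtain R' where R': "R' > 0" "\<And>z. \<lbrakk>z \<in> vecs (n + n); norm1 (n + n) (z - z0) < R'\<rbrakk> \<Longrightarrow> z \<in> S"
    using openin_Euclidean_norm1D[OF S z0] by blast
  \<comment> \<open>The norm of a joined pair is the sum of the two norms, so the radii are
    halved.\<close>
  define r where "r = min R R' / 2"
  have rpos: "r > 0" using R(1) R'(1) by (simp add: r_def)
  have jz: "join n (c + x) (c + y) - z0 = join n x y" for x y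
    by (simp add: z0_def join_diff)
  have jn: "norm1 (n + n) (join n (c + x) (c + y) - z0) = norm1 n x + norm1 n y" for x y
    by (simp add: jz norm1_join)
  have jS: "join n (c + x) (c + y) \<in> S" if "x \<in> vecs n" "y \<in> vecs n" "norm1 n x < r" "norm1 n y < r" for x y
    using that c by (intro R'(2)) (simp_all add: jn r_def)
  have ball: "x \<in> \<Omega>" if "x \<in> vecs n" "norm1 n x < r" for x
    using key[of x 0] jS[of x 0] that rpos by simp
  have mu0: "\<mu> x 0 = x" "\<mu> 0 x = x" if "x \<in> vecs n" "norm1 n x < r" for x
    using pU[OF ball[OF that]] Uc p0 by (auto simp: \<mu>_def subset_iff)
  \<comment> \<open>Along a coordinate axis one factor is the identity, so the function is affine
    there and its derivative can be read off.\<close>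
  have deriv_affine: "partial_deriv i v z0 = s"
    if "\<And>t. \<bar>t - z0 i\<bar> < r \<Longrightarrow> v (z0(i := t)) = b + (t - z0 i) * s" for i v b s
  proof -
    have "\<forall>\<^sub>F t in nhds (z0 i). v (z0(i := t)) = b + (t - z0 i) * s"
      unfolding eventually_nhds_metric using that rpos by (auto simp: dist_real_def)
    then have "deriv (\<lambda>t. v (z0(i := t))) (z0 i) = deriv (\<lambda>t. b + (t - z0 i) * s) (z0 i)"
      by (intro deriv_cong_ev) auto
    also have "\<dots> = s" by (rule DERIV_imp_deriv) (auto intro!: derivative_eq_intros)
    finally show ?thesis by (simp add: partial_deriv_def)
  qed
  have d1: "partial_deriv i (u j) z0 = axis_vec i j" if i: "i < n" for i j
  proof (rule deriv_affine)
    fix t assume t: "\<bar>t - z0 i\<bar> < r"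
    let ?x = "(t - z0 i) *\<^sub>R axis_vec i"
    have x: "?x \<in> vecs n" "norm1 n ?x < r" using t i by simp_all
    have "z0(i := t) = join n (c + ?x) (c + 0)"
      using i by (auto simp: z0_def join_def axis_vec_def fun_eq_iff)
    moreover have "u j (join n (c + ?x) (c + 0)) = c j + \<mu> ?x 0 j"
      using key[of ?x 0 j] jS[of ?x 0] x rpos by simp
    ultimately show "u j (z0(i := t)) = c j + (t - z0 i) * axis_vec i j" using mu0(1)[OF x] by simp
  qed
  have d2: "partial_deriv (n + i) (u j) z0 = axis_vec i j" if i: "i < n" for i j
  proof (rule deriv_affine)
    fix t assume t: "\<bar>t - z0 (n + i)\<bar> < r"
    let ?x = "(t - z0 (n + i)) *\<^sub>R axis_vec i"
    have x: "?x \<in> vecs n" "norm1 n ?x < r" using t i by simp_all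
    have "z0(n + i := t) = join n (c + 0) (c + ?x)"
      using i by (auto simp: z0_def join_def axis_vec_def fun_eq_iff)
    moreover have "u j (join n (c + 0) (c + ?x)) = c j + \<mu> 0 ?x j"
      using key[of 0 ?x j] jS[of 0 ?x] x rpos by simp
    ultimately show "u j (z0(n + i := t)) = c j + (t - z0 (n + i)) * axis_vec i j" using mu0(2)[OF x] by simp
  qed
  \<comment> \<open>The constants of the single coordinates add up in \<open>norm1\<close>; the
    summand 1 keeps \<open>C\<close> positive when \<open>n = 0\<close>.\<close>
  define C where "C = 1 + (\<Sum>j<n. K j)"
  have "C > 0" unfolding C_def using K by (intro add_pos_nonneg sum_nonneg) (auto intro: less_imp_le)
  have est: "norm1 n (\<mu> x y - x - y - (\<mu> x' y' - x' - y'))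
      \<le> C * (norm1 n x + norm1 n y + norm1 n x' + norm1 n y') * (norm1 n (x - x') + norm1 n (y - y'))"
    if v: "x \<in> vecs n" "y \<in> vecs n" "x' \<in> vecs n" "y' \<in> vecs n"
      and s: "norm1 n x < r" "norm1 n y < r" "norm1 n x' < r" "norm1 n y' < r" for x y x' y'
  proof -
    define B where "B = (norm1 n x + norm1 n y + norm1 n x' + norm1 n y') * (norm1 n (x - x') + norm1 n (y - y'))"
    have B0: "B \<ge> 0" unfolding B_def by (intro mult_nonneg_nonneg add_nonneg_nonneg) simp_all
    let ?z = "join n (c + x) (c + y)" and ?z' = "join n (c + x') (c + y')"
    have le: "\<bar>(\<mu> x y - x - y - (\<mu> x' y' - x' - y')) j\<bar> \<le> K j * B" if j: "j < n" for j
    proof -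
      have zz: "?z \<in> vecs (n + n)" "?z' \<in> vecs (n + n)" using v c by simp_all
      have zR: "norm1 (n + n) (?z - z0) < R" "norm1 (n + n) (?z' - z0) < R"
        using s unfolding jn by (simp_all add: r_def)
      have h: "\<bar>u j ?z - u j ?z' - (\<Sum>i<n + n. partial_deriv i (u j) z0 * (?z i - ?z' i))\<bar>
        \<le> K j * (norm1 (n + n) (?z - z0) + norm1 (n + n) (?z' - z0)) * norm1 (n + n) (?z - ?z')"
        using K j zz zR by simp
      have e1: "norm1 (n + n) (?z - ?z') = norm1 n (x - x') + norm1 n (y - y')"
        unfolding join_diff norm1_join by simp
      have e2: "(\<Sum>i<n + n. partial_deriv i (u j) z0 * (?z i - ?z' i)) = (x j - x' j) + (y j - y' j)"
      proof -
        have ax: "(\<Sum>i<n. axis_vec i j * h i) = h j" for h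
        proof -
          have "(\<Sum>i<n. axis_vec i j * h i) = (\<Sum>i<n. if i = j then h i else 0)"
            by (intro sum.cong) (auto simp: axis_vec_def)
          then show ?thesis using j by simp
        qed
        have "(\<Sum>i<n + n. partial_deriv i (u j) z0 * (?z i - ?z' i))
          = (\<Sum>i<n. axis_vec i j * (x i - x' i)) + (\<Sum>i<n. axis_vec i j * (y i - y' i))"
          unfolding sum_lessThan_add
          by (intro arg_cong2[of _ _ _ _ "(+)"] sum.cong) (simp_all add: d1 d2 join_def)
        then show ?thesis by (simp add: ax)
      qed
      have e3: "u j ?z = c j + \<mu> x y j" using key v jS s by blast
      have e4: "u j ?z' = c j + \<mu> x' y' j" using key v jS s by blast
      have e5: "(\<mu> x y - x - y - (\<mu> x' y' - x' - y')) j
          = c j + \<mu> x y j - (c j + \<mu> x' y' j) - (x j - x' j + (y j - y' j))" by simp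
      have e6: "K j * B = K j * (norm1 n x + norm1 n y + (norm1 n x' + norm1 n y')) * (norm1 n (x - x') + norm1 n (y - y'))"
        unfolding B_def by (simp only: mult.assoc add.assoc)
      show ?thesis using h unfolding e1 e2 e3 e4 e5 e6 jn .
    qed
    have "norm1 n (\<mu> x y - x - y - (\<mu> x' y' - x' - y')) \<le> (\<Sum>j<n. K j * B)"
      unfolding norm1_def by (intro sum_mono) (use le in simp)
    also have "\<dots> \<le> C * B" using B0 by (simp add: C_def distrib_right sum_distrib_right)
    finally show ?thesis by (simp add: B_def mult.assoc)
  qed
  have prod: "\<mu> x y \<in> \<Omega> \<and> p (\<mu> x y) = p x \<otimes>\<^bsub>A\<^esub> p y"
    if "x \<in> vecs n" "y \<in> vecs n" "norm1 n x < r" "norm1 n y < r" for x y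
  proof -
    have "p x \<otimes>\<^bsub>A\<^esub> p y \<in> U" using key jS that by blast
    moreover from this have "c + \<mu> x y = \<phi> (p x \<otimes>\<^bsub>A\<^esub> p y)" by (simp add: \<mu>_def)
    moreover have "\<mu> x y \<in> vecs n" unfolding \<mu>_def using calculation(1) \<phi>v' c by simp
    ultimately show ?thesis using \<psi>\<phi> by (simp add: \<Omega>_def p_def[of "\<mu> x y"])
  qed
  have "local_product n A X p \<mu> \<Omega> r C"
    by (rule local_product.intro[OF comm tg rpos \<open>C > 0\<close> \<Omega>open ball p0 pinj pcont popen prod est])
  then show ?thesis by blast
qed

context local_product
begin

lemma domain_subset: "\<Omega> \<subseteq> vecs n"
  using openin_subset[OF open_domain] by simp

lemma carrier_eq: "topspace X = carrier A"
  using topological_group by (simp add: topological_group_def)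

lemma p_closed: "x \<in> \<Omega> \<Longrightarrow> p x \<in> carrier A"
  using continuous_map_image_subset_topspace[OF p_continuous] domain_subset carrier_eq by auto

lemma product_in_vecs:
  "\<lbrakk>x \<in> vecs n; y \<in> vecs n; norm1 n x < r; norm1 n y < r\<rbrakk> \<Longrightarrow> \<mu> x y \<in> vecs n"
  using product domain_subset by blast

lemma product_zero: "\<mu> 0 0 = 0"
proof -
  interpret comm_group A by (rule comm)
  have z: "norm1 n 0 < r" using r by simp
  have "p (\<mu> 0 0) = p 0" using product[of 0 0] z by (simp add: p_zero)
  then show ?thesis using product[of 0 0] ball[of 0] z by (intro inj_onD[OF p_inj]) simp_all
qed

lemma product_approx:
  assumes "x \<in> vecs n" "y \<in> vecs n" "norm1 n x < r" "norm1 n y < r"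
  shows "norm1 n (\<mu> x y - (x + y)) \<le> C * (norm1 n x + norm1 n y)\<^sup>2"
proof -
  have "\<mu> x y - (x + y) = \<mu> x y - x - y - (\<mu> 0 0 - 0 - 0)" by (simp add: product_zero)
  then show ?thesis
    using estimate[of x y 0 0] assms r by (simp add: power2_eq_square mult.assoc diff_diff_eq)
qed

section \<open>Iterated doubling in the chart and its rescaled limit\<close>

definition dbl :: "(nat \<Rightarrow> real) \<Rightarrow> nat \<Rightarrow> real" where
  "dbl x = \<mu> x x"

text \<open>Doubling puts equal vectors into both slots of \<open>estimate\<close>, which doubles
  both factors on its right-hand side.\<close>

definition c :: real where
  "c = 4 * C"

lemma c_pos: "c > 0"
  using C by (simp add: c_def)

lemma dbl_in_vecs: "\<lbrakk>x \<in> vecs n; norm1 n x < r\<rbrakk> \<Longrightarrow> dbl x \<in> vecs n"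
  unfolding dbl_def by (rule product_in_vecs)

lemma dbl_diff:
  assumes "x \<in> vecs n" "y \<in> vecs n" "norm1 n x < r" "norm1 n y < r"
  shows "norm1 n (dbl x - dbl y) \<le> (2 + c * (norm1 n x + norm1 n y)) * norm1 n (x - y)"
proof -
  define d where "d = dbl x - x - x - (dbl y - y - y)"
  have "norm1 n d \<le> C * (norm1 n x + norm1 n x + norm1 n y + norm1 n y) * (norm1 n (x - y) + norm1 n (x - y))"
    unfolding d_def dbl_def using assms by (intro estimate)
  also have "\<dots> = c * (norm1 n x + norm1 n y) * norm1 n (x - y)" by (simp add: c_def algebra_simps)
  finally have d: "norm1 n d \<le> c * (norm1 n x + norm1 n y) * norm1 n (x - y)" .
  have "dbl x - dbl y = d + 2 *\<^sub>R (x - y)" by (simp add: d_def fun_eq_iff)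
  then have "norm1 n (dbl x - dbl y) \<le> norm1 n d + 2 * norm1 n (x - y)"
    using norm1_triangle[of n d "2 *\<^sub>R (x - y)"] by simp
  then show ?thesis using d by (simp add: distrib_right)
qed

lemma dbl_approx:
  assumes "x \<in> vecs n" "norm1 n x < r"
  shows "norm1 n (dbl x - 2 *\<^sub>R x) \<le> c * (norm1 n x)\<^sup>2"
  using product_approx[OF assms(1,1,2,2)]
  by (simp add: dbl_def c_def scaleR_2 power2_eq_square)

lemma dbl_norm:
  assumes "x \<in> vecs n" "norm1 n x < r"
  shows "norm1 n (dbl x) \<le> 2 * norm1 n x + c * (norm1 n x)\<^sup>2"
proof -
  have "dbl x = 2 *\<^sub>R x + (dbl x - 2 *\<^sub>R x)" by simp
  then have "norm1 n (dbl x) \<le> norm1 n (2 *\<^sub>R x) + norm1 n (dbl x - 2 *\<^sub>R x)"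
    by (metis norm1_triangle)
  then show ?thesis using dbl_approx[OF assms] by simp
qed

text \<open>For \<open>t \<le> \<rho>\<close> the error \<open>c * t\<^sup>2\<close> is at most
  \<open>t / 4\<close>, and the bound \<open>r / 4\<close> keeps the iterates, whose norms do not
  exceed \<open>2 * \<rho>\<close>, in the domain of \<mu>.\<close>

definition \<rho> :: real where
  "\<rho> = min (1 / (4 * c)) (r / 4)"

lemma rho: "\<rho> > 0" "4 * c * \<rho> \<le> 1" "4 * \<rho> \<le> r"
proof -
  show "\<rho> > 0" using c_pos r by (simp add: \<rho>_def)
  have "\<rho> \<le> 1 / (4 * c)" by (simp add: \<rho>_def)
  then show "4 * c * \<rho> \<le> 1" using c_pos by (simp add: field_simps)
  show "4 * \<rho> \<le> r" by (simp add: \<rho>_def min_def)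
qed

lemma quadratic_small:
  assumes "0 \<le> t" "t \<le> \<rho>"
  shows "4 * (c * t\<^sup>2) \<le> t"
proof -
  have "4 * c * t \<le> 4 * c * \<rho>" using assms c_pos by simp
  then have "(4 * c * t) * t \<le> 1 * t" using assms rho(2) by (intro mult_right_mono) auto
  then show ?thesis by (simp add: power2_eq_square mult.assoc)
qed

text \<open>The error term reproduces itself: with \<open>t = 2 ^ i * norm1 n x\<close>, one
  doubling turns \<open>t + 2 * c * t\<^sup>2\<close> into at most
  \<open>2 * t + 4 * c * t\<^sup>2 + c * (2 * t)\<^sup>2\<close>, and this equals
  \<open>2 * t + 2 * c * (2 * t)\<^sup>2\<close>.\<close>

lemma iterate:
  assumes x: "x \<in> vecs n" and "2 ^ i * norm1 n x \<le> \<rho>"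
  shows "(dbl ^^ i) x \<in> vecs n \<and>
    norm1 n ((dbl ^^ i) x) \<le> 2 ^ i * norm1 n x + 2 * (c * (2 ^ i * norm1 n x)\<^sup>2) \<and>
    p ((dbl ^^ i) x) = p x [^]\<^bsub>A\<^esub> (2 ^ i :: nat)"
  using assms(2)
proof (induction i)
  case 0
  interpret comm_group A by (rule comm)
  have "norm1 n x < r" using 0 rho by simp
  then show ?case using x c_pos p_closed[OF ball] by simp
next
  case (Suc i)
  interpret comm_group A by (rule comm)
  define t where "t = 2 ^ i * norm1 n x"
  define y where "y = (dbl ^^ i) x"
  have t0: "t \<ge> 0" by (simp add: t_def)
  have "2 * t \<le> \<rho>" using Suc.prems by (simp add: t_def)
  then have t: "t \<le> \<rho>" using t0 by linarith
  from Suc.IH t have y: "y \<in> vecs n" "norm1 n y \<le> t + 2 * (c * t\<^sup>2)"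
    "p y = p x [^]\<^bsub>A\<^esub> (2 ^ i :: nat)" by (simp_all add: t_def y_def)
  have y2: "norm1 n y \<le> 2 * t" using y(2) quadratic_small[OF t0 t] t0 by linarith
  then have yr: "norm1 n y < r" using t rho by linarith
  have "norm1 n (dbl y) \<le> 2 * norm1 n y + c * (norm1 n y)\<^sup>2" by (rule dbl_norm[OF y(1) yr])
  also have "\<dots> \<le> 2 * (t + 2 * (c * t\<^sup>2)) + c * (2 * t)\<^sup>2"
    using y(2) y2 c_pos by (intro add_mono mult_left_mono power_mono) auto
  also have "\<dots> = 2 * t + 2 * (c * (2 * t)\<^sup>2)" by (simp add: power2_eq_square)
  finally have "norm1 n (dbl y) \<le> 2 * t + 2 * (c * (2 * t)\<^sup>2)" .
  moreover have "p (dbl y) = p x [^]\<^bsub>A\<^esub> (2 ^ Suc i :: nat)"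
  proof -
    have xr: "norm1 n x < r"
    proof -
      have "1 * norm1 n x \<le> 2 ^ i * norm1 n x" by (intro mult_right_mono) auto
      then show ?thesis using t rho unfolding t_def by linarith
    qed
    have "p (dbl y) = p y \<otimes>\<^bsub>A\<^esub> p y" using product[OF y(1,1) yr yr] by (simp add: dbl_def)
    also have "\<dots> = p x [^]\<^bsub>A\<^esub> (2 ^ i + 2 ^ i :: nat)"
      unfolding y(3) using p_closed[OF ball[OF x xr]] by (simp add: nat_pow_mult)
    finally show ?thesis by (simp add: mult_2)
  qed
  moreover have "dbl y \<in> vecs n" by (rule dbl_in_vecs[OF y(1) yr])
  ultimately show ?case by (simp add: y_def t_def mult.assoc)
qed

lemma iterate_norm:
  assumes x: "x \<in> vecs n" and "2 ^ i * norm1 n x \<le> \<rho>"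
  shows "norm1 n ((dbl ^^ i) x) \<le> 2 * (2 ^ i * norm1 n x)" "norm1 n ((dbl ^^ i) x) < r"
proof -
  have "0 \<le> 2 ^ i * norm1 n x" by simp
  from quadratic_small[OF this assms(2)] show "norm1 n ((dbl ^^ i) x) \<le> 2 * (2 ^ i * norm1 n x)"
    using iterate[OF assms] \<open>0 \<le> 2 ^ i * norm1 n x\<close> by (elim conjE) linarith
  then show "norm1 n ((dbl ^^ i) x) < r" using assms(2) rho by linarith
qed

text \<open>Each step has Lipschitz constant at most \<open>2 + u\<close> with
  \<open>u = 4 * c * t\<close>, and \<open>u\<close> doubles from step to step. Since
  \<open>u \<le> 1\<close>, \<open>(2 + u) * (1 + u) \<le> 2 * (1 + 2 * u)\<close>, so the product
  keeps the stated form.\<close>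

lemma iterate_diff_aux:
  assumes x: "x \<in> vecs n" "norm1 n x \<le> M" and y: "y \<in> vecs n" "norm1 n y \<le> M"
    and "2 ^ i * M \<le> \<rho>"
  shows "norm1 n ((dbl ^^ i) x - (dbl ^^ i) y) \<le> 2 ^ i * (1 + 4 * c * (2 ^ i * M)) * norm1 n (x - y)"
  using assms(5)
proof (induction i)
  case 0
  have "0 \<le> M" using x(2) norm1_nonneg[of n x] by linarith
  then show ?case using c_pos by (simp add: distrib_right)
next
  case (Suc i)
  define t where "t = 2 ^ i * M"
  define d where "d = norm1 n (x - y)"
  define a b where "a = (dbl ^^ i) x" and "b = (dbl ^^ i) y"
  have "0 \<le> M" using x(2) norm1_nonneg[of n x] by linarith
  then have t0: "t \<ge> 0" by (simp add: t_def)
  have t: "t \<le> \<rho>" using Suc.prems t0 by (simp add: t_def)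
  have ct: "4 * c * t \<le> 1"
  proof -
    have "4 * c * t \<le> 4 * c * \<rho>" using t c_pos by simp
    then show ?thesis using rho(2) by linarith
  qed
  have le: "2 ^ i * norm1 n x \<le> t" "2 ^ i * norm1 n y \<le> t"
    unfolding t_def using x(2) y(2) by (auto intro: mult_left_mono)
  then have le': "2 ^ i * norm1 n x \<le> \<rho>" "2 ^ i * norm1 n y \<le> \<rho>" using t by linarith+
  have ab: "a \<in> vecs n" "b \<in> vecs n" "norm1 n a < r" "norm1 n b < r"
    "norm1 n a \<le> 2 * t" "norm1 n b \<le> 2 * t"
    using iterate[OF x(1) le'(1)] iterate[OF y(1) le'(2)] iterate_norm[OF x(1) le'(1)]
      iterate_norm[OF y(1) le'(2)] le by (simp_all add: a_def b_def)
  have IH: "norm1 n (a - b) \<le> 2 ^ i * (1 + 4 * c * t) * d"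
    using Suc.IH[OF t[unfolded t_def]] unfolding a_def b_def d_def t_def .
  have "norm1 n (dbl a - dbl b) \<le> (2 + c * (norm1 n a + norm1 n b)) * norm1 n (a - b)"
    by (rule dbl_diff[OF ab(1-4)])
  also have "\<dots> \<le> (2 + 4 * c * t) * (2 ^ i * (1 + 4 * c * t) * d)"
  proof (rule mult_mono[OF _ IH])
    have "c * (norm1 n a + norm1 n b) \<le> c * (2 * t + 2 * t)" using ab c_pos by (intro mult_left_mono) auto
    then show "2 + c * (norm1 n a + norm1 n b) \<le> 2 + 4 * c * t" by simp
    show "0 \<le> 2 + 4 * c * t" using c_pos t0 by simp
  qed simp
  also have "\<dots> = 2 ^ i * d * ((2 + 4 * c * t) * (1 + 4 * c * t))" by simp
  also have "\<dots> \<le> 2 ^ i * d * (2 * (1 + 8 * c * t))"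
  proof (rule mult_left_mono)
    have "(4 * c * t) * (4 * c * t) \<le> 1 * (4 * c * t)" using ct c_pos t0 by (intro mult_right_mono) auto
    moreover have "(2 + 4 * c * t) * (1 + 4 * c * t) = 2 + 3 * (4 * c * t) + (4 * c * t) * (4 * c * t)"
      by (simp add: algebra_simps)
    ultimately show "(2 + 4 * c * t) * (1 + 4 * c * t) \<le> 2 * (1 + 8 * c * t)" by simp
    show "0 \<le> 2 ^ i * d" by (simp add: d_def)
  qed
  also have "\<dots> = 2 ^ Suc i * (1 + 4 * c * (2 ^ Suc i * M)) * norm1 n (x - y)"
    by (simp add: t_def d_def)
  finally show ?case unfolding a_def b_def by (simp only: funpow.simps o_apply)
qed

lemma iterate_diff:
  assumes x: "x \<in> vecs n" "2 ^ i * norm1 n x \<le> \<rho>" and y: "y \<in> vecs n" "2 ^ i * norm1 n y \<le> \<rho>"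
  shows "norm1 n ((dbl ^^ i) x - (dbl ^^ i) y) \<le> 2 * (2 ^ i * norm1 n (x - y))"
proof -
  define M where "M = \<rho> / 2 ^ i"
  have M: "2 ^ i * M = \<rho>" "norm1 n x \<le> M" "norm1 n y \<le> M"
    using x(2) y(2) by (simp_all add: M_def field_simps)
  have "norm1 n ((dbl ^^ i) x - (dbl ^^ i) y) \<le> 2 ^ i * (1 + 4 * c * (2 ^ i * M)) * norm1 n (x - y)"
    using M by (intro iterate_diff_aux x(1) y(1)) simp_all
  also have "\<dots> \<le> 2 ^ i * (1 + 1) * norm1 n (x - y)"
    unfolding M(1) using rho(2) by (intro mult_right_mono mult_left_mono) auto
  finally show ?thesis by simp
qed

definition E :: "nat \<Rightarrow> (nat \<Rightarrow> real) \<Rightarrow> nat \<Rightarrow> real" where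
  "E k x = (dbl ^^ k) ((1 / 2 ^ k) *\<^sub>R x)"

lemma E_facts:
  assumes x: "x \<in> vecs n" "norm1 n x \<le> \<rho>"
  shows "E k x \<in> vecs n" "norm1 n (E k x) \<le> 2 * norm1 n x" "norm1 n (E k x) < r"
    "p (E k x) = p ((1 / 2 ^ k) *\<^sub>R x) [^]\<^bsub>A\<^esub> (2 ^ k :: nat)"
proof -
  have y: "(1 / 2 ^ k) *\<^sub>R x \<in> vecs n" "2 ^ k * norm1 n ((1 / 2 ^ k) *\<^sub>R x) \<le> \<rho>" using x by simp_all
  show "E k x \<in> vecs n" "norm1 n (E k x) \<le> 2 * norm1 n x" "norm1 n (E k x) < r"
    "p (E k x) = p ((1 / 2 ^ k) *\<^sub>R x) [^]\<^bsub>A\<^esub> (2 ^ k :: nat)"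
    using iterate[OF y] iterate_norm[OF y] by (simp_all add: E_def)
qed

lemma E_lipschitz:
  assumes "x \<in> vecs n" "norm1 n x \<le> \<rho>" "y \<in> vecs n" "norm1 n y \<le> \<rho>"
  shows "norm1 n (E k x - E k y) \<le> 2 * norm1 n (x - y)"
  using iterate_diff[of "(1 / 2 ^ k) *\<^sub>R x" k "(1 / 2 ^ k) *\<^sub>R y"] assms
  by (simp add: E_def flip: scaleR_diff_right)

text \<open>Both terms are \<open>k\<close> doublings, applied to \<open>dbl y\<close> and to
  \<open>2 *\<^sub>R y\<close> with \<open>y\<close> equal to \<open>x\<close> divided by
  \<open>2 ^ Suc k\<close>. These two vectors are quadratically close, while the doublings expand
  distances by \<open>2 * 2 ^ k\<close> only, so the steps decay geometrically.\<close>

lemma E_step: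
  assumes x: "x \<in> vecs n" "norm1 n x \<le> \<rho> / 2"
  shows "norm1 n (E (Suc k) x - E k x) \<le> c * (norm1 n x)\<^sup>2 / 2 ^ Suc k"
proof -
  define y where "y = (1 / 2 ^ Suc k) *\<^sub>R x"
  have y: "y \<in> vecs n" "norm1 n y = norm1 n x / 2 ^ Suc k" using x by (simp_all add: y_def)
  have "norm1 n x / 2 ^ Suc k \<le> norm1 n x / 1"
    using one_le_power[of "2 :: real" "Suc k"] by (intro divide_left_mono) auto
  then have le: "norm1 n x / 2 ^ Suc k \<le> norm1 n x" by simp
  have y1: "2 ^ 1 * norm1 n y \<le> \<rho>" using le x(2) rho(1) unfolding y(2) by simp
  have yr: "norm1 n y < r" using le x(2) rho unfolding y(2) by linarith
  have d: "dbl y \<in> vecs n" "2 ^ k * norm1 n (dbl y) \<le> \<rho>"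
    using iterate[OF y(1) y1] iterate_norm[OF y(1) y1] x(2) by (simp_all add: y(2) field_simps)
  have h: "(1 / 2 ^ k) *\<^sub>R x = 2 *\<^sub>R y" by (simp add: y_def)
  have y2: "2 *\<^sub>R y \<in> vecs n" "2 ^ k * norm1 n (2 *\<^sub>R y) \<le> \<rho>" using y x(2) rho(1) by simp_all
  have "norm1 n (E (Suc k) x - E k x) = norm1 n ((dbl ^^ k) (dbl y) - (dbl ^^ k) (2 *\<^sub>R y))"
    unfolding E_def h y_def[symmetric] by (simp add: funpow_swap1)
  also have "\<dots> \<le> 2 * (2 ^ k * norm1 n (dbl y - 2 *\<^sub>R y))" by (rule iterate_diff[OF d y2])
  also have "\<dots> \<le> 2 * (2 ^ k * (c * (norm1 n y)\<^sup>2))"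
    using dbl_approx[OF y(1) yr] by (intro mult_left_mono) auto
  also have "\<dots> = c * (norm1 n x)\<^sup>2 / 2 ^ Suc k"
    by (simp add: y(2) power2_eq_square field_simps)
  finally show ?thesis .
qed

lemma E_close:
  assumes x: "x \<in> vecs n" "norm1 n x \<le> \<rho> / 2"
  shows "norm1 n (E k x - x) \<le> c * (norm1 n x)\<^sup>2"
proof -
  \<comment> \<open>The factor \<open>1 - 1 / 2 ^ k\<close> is the partial sum of the geometric
    bounds from \<open>E_step\<close>.\<close>
  have "norm1 n (E k x - x) \<le> c * (norm1 n x)\<^sup>2 * (1 - 1 / 2 ^ k)"
  proof (induction k)
    case 0
    then show ?case by (simp add: E_def norm1_def)
  next
    case (Suc k)
    have "norm1 n (E (Suc k) x - x) \<le> norm1 n (E (Suc k) x - E k x) + norm1 n (E k x - x)"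
      by (rule norm1_diff_triangle)
    also have "\<dots> \<le> c * (norm1 n x)\<^sup>2 / 2 ^ Suc k + c * (norm1 n x)\<^sup>2 * (1 - 1 / 2 ^ k)"
      by (intro add_mono E_step[OF x] Suc.IH)
    also have "\<dots> = c * (norm1 n x)\<^sup>2 * (1 - 1 / 2 ^ Suc k)" by (simp add: field_simps)
    finally show ?case .
  qed
  also have "\<dots> \<le> c * (norm1 n x)\<^sup>2 * 1" using c_pos by (intro mult_left_mono) auto
  finally show ?thesis by simp
qed

lemma E_convergent:
  assumes x: "x \<in> vecs n" "norm1 n x \<le> \<rho> / 2" and i: "i < n"
  shows "convergent (\<lambda>k. E k x i)"
proof -
  define K where "K = c * (norm1 n x)\<^sup>2"
  have "summable (\<lambda>k. E (Suc k) x i - E k x i)"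
  proof (rule summable_comparison_test')
    show "summable (\<lambda>k. K * (1 / 2) ^ k)" by (intro summable_mult summable_geometric) simp
    fix k :: nat
    have "\<bar>(E (Suc k) x - E k x) i\<bar> \<le> K / 2 ^ Suc k"
      using component_le_norm1[OF i, of "E (Suc k) x - E k x"] E_step[OF x, of k] unfolding K_def by linarith
    also have "\<dots> \<le> K * (1 / 2) ^ k" using c_pos by (simp add: K_def power_divide field_simps)
    finally show "norm (E (Suc k) x i - E k x i) \<le> K * (1 / 2) ^ k" by simp
  qed
  from summable_LIMSEQ[OF this]
  have "(\<lambda>k. E k x i - E 0 x i) \<longlonglongrightarrow> suminf (\<lambda>k. E (Suc k) x i - E k x i)"
    unfolding sum_lessThan_telescope[of "\<lambda>k. E k x i"] .
  from tendsto_add[OF this tendsto_const[of "E 0 x i"]] show ?thesis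
    unfolding convergent_def by auto
qed

definition e :: "(nat \<Rightarrow> real) \<Rightarrow> nat \<Rightarrow> real" where
  "e x i = (if i < n then lim (\<lambda>k. E k x i) else 0)"

lemma e_in_vecs [simp]: "e x \<in> vecs n"
  by (simp add: e_def vecs_def)

lemma E_tendsto_e:
  assumes x: "x \<in> vecs n" "norm1 n x \<le> \<rho> / 2"
  shows "(\<lambda>k. norm1 n (E k x - e x)) \<longlonglongrightarrow> 0"
proof (rule norm1_tendsto_0)
  fix i assume i: "i < n"
  then show "(\<lambda>k. E k x i) \<longlonglongrightarrow> e x i"
    using E_convergent[OF x i] by (simp add: e_def convergent_LIMSEQ_iff)
qed

lemma e_lipschitz:
  assumes x: "x \<in> vecs n" "norm1 n x \<le> \<rho> / 2" and y: "y \<in> vecs n" "norm1 n y \<le> \<rho> / 2"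
  shows "norm1 n (e x - e y) \<le> 2 * norm1 n (x - y)"
proof -
  have "(\<lambda>k. norm1 n (E k x - e x) + 2 * norm1 n (x - y) + norm1 n (E k y - e y)) \<longlonglongrightarrow> 0 + 2 * norm1 n (x - y) + 0"
    by (intro tendsto_add tendsto_const E_tendsto_e x y)
  moreover have "norm1 n (e x - e y) \<le> norm1 n (E k x - e x) + 2 * norm1 n (x - y) + norm1 n (E k y - e y)" for k
    using norm1_diff_triangle[of n "e x" "e y" "E k x"] norm1_diff_triangle[of n "E k x" "e y" "E k y"]
      norm1_minus_commute[of n "e x" "E k x"] E_lipschitz[OF x(1) _ y(1), of k] x(2) y(2) rho(1) by simp
  ultimately show ?thesis by (intro LIMSEQ_le_const) auto
qed

lemma e_close:
  assumes x: "x \<in> vecs n" "norm1 n x \<le> \<rho> / 2"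
  shows "norm1 n (e x - x) \<le> c * (norm1 n x)\<^sup>2"
proof -
  have "(\<lambda>k. norm1 n (E k x - e x) + c * (norm1 n x)\<^sup>2) \<longlonglongrightarrow> 0 + c * (norm1 n x)\<^sup>2"
    by (intro tendsto_add tendsto_const E_tendsto_e x)
  moreover have "norm1 n (e x - x) \<le> norm1 n (E k x - e x) + c * (norm1 n x)\<^sup>2" for k
    using norm1_diff_triangle[of n "e x" x "E k x"] norm1_minus_commute[of n "e x" "E k x"]
      E_close[OF x, of k] by simp
  ultimately show ?thesis by (intro LIMSEQ_le_const) auto
qed

lemma e_norm:
  assumes x: "x \<in> vecs n" "norm1 n x \<le> \<rho> / 2"
  shows "norm1 n (e x) \<le> 2 * norm1 n x" "norm1 n (e x) < r"
proof -
  have "norm1 n (e x) \<le> norm1 n (e x - x) + norm1 n x"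
    using norm1_triangle[of n "e x - x" x] by simp
  moreover have "4 * (c * (norm1 n x)\<^sup>2) \<le> norm1 n x"
    using x(2) rho(1) by (intro quadratic_small) auto
  ultimately show "norm1 n (e x) \<le> 2 * norm1 n x"
    using e_close[OF x] norm1_nonneg[of n x] by linarith
  then show "norm1 n (e x) < r" using x(2) rho by linarith
qed

text \<open>By commutativity, a product of \<open>2 ^ k\<close>-th powers is the power of the
  product, so \<open>\<mu> (E k x) (E k y)\<close> is the iterate of the product of the two rescaled
  vectors. That product is quadratically close to their sum, and the iterates expand distances by
  \<open>2 * 2 ^ k\<close> only.\<close>

lemma e_add:
  assumes x: "x \<in> vecs n" and y: "y \<in> vecs n" and xy: "norm1 n x + norm1 n y \<le> \<rho> / 2"
  shows "\<mu> (e x) (e y) = e (x + y)"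
proof -
  interpret comm_group A by (rule comm)
  define s where "s = norm1 n x + norm1 n y"
  have nx: "norm1 n x \<le> \<rho> / 2" "norm1 n y \<le> \<rho> / 2"
    using xy norm1_nonneg[of n x] norm1_nonneg[of n y] by linarith+
  have nxy: "norm1 n (x + y) \<le> s" "s \<le> \<rho> / 2" using norm1_triangle[of n x y] xy by (simp_all add: s_def)
  have s0: "s \<ge> 0" by (simp add: s_def)
  have step: "norm1 n (\<mu> (E k x) (E k y) - E k (x + y)) \<le> 2 * C * s\<^sup>2 * (1 / 2) ^ k" for k
  proof -
    define x' y' where "x' = (1 / 2 ^ k) *\<^sub>R x" and "y' = (1 / 2 ^ k) *\<^sub>R y"
    have v: "x' \<in> vecs n" "y' \<in> vecs n" using x y by (simp_all add: x'_def y'_def)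
    have nx': "norm1 n x' + norm1 n y' = s / 2 ^ k"
      by (simp add: x'_def y'_def s_def add_divide_distrib)
    have sk: "s / 2 ^ k \<le> s" using s0 by (simp add: divide_le_eq mult_le_cancel_left1)
    have r': "norm1 n x' < r" "norm1 n y' < r"
      using nx' sk nxy(2) rho norm1_nonneg[of n x'] norm1_nonneg[of n y'] by linarith+
    define w where "w = \<mu> x' y'"
    have w: "w \<in> vecs n" "p w = p x' \<otimes>\<^bsub>A\<^esub> p y'"
      using product[OF v r'] domain_subset by (auto simp: w_def)
    have wa: "norm1 n (w - (x' + y')) \<le> C * (s / 2 ^ k)\<^sup>2"
      using product_approx[OF v r'] unfolding w_def nx' .
    have "4 * (c * (s / 2 ^ k)\<^sup>2) \<le> s / 2 ^ k" using s0 sk nxy(2) rho(1) by (intro quadratic_small) auto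
    moreover have "0 \<le> C * (s / 2 ^ k)\<^sup>2" using C by simp
    ultimately have "C * (s / 2 ^ k)\<^sup>2 \<le> s / 2 ^ k" unfolding c_def by linarith
    moreover have "norm1 n w \<le> norm1 n (w - (x' + y')) + norm1 n (x' + y')"
      using norm1_triangle[of n "w - (x' + y')" "x' + y'"] by simp
    moreover have nxy': "norm1 n (x' + y') \<le> s / 2 ^ k" using norm1_triangle[of n x' y'] nx' by simp
    ultimately have "norm1 n w \<le> 2 * (s / 2 ^ k)" using wa by linarith
    then have wk: "2 ^ k * norm1 n w \<le> \<rho>" using nxy(2) by (simp add: field_simps)
    have xyk: "2 ^ k * norm1 n (x' + y') \<le> \<rho>" using nxy' nxy(2) s0 rho(1) by (simp add: field_simps)
    have Ex: "norm1 n x \<le> \<rho>" "norm1 n y \<le> \<rho>" using nx rho(1) by linarith+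
    note Efx = E_facts[OF x Ex(1), of k] and Efy = E_facts[OF y Ex(2), of k]
    have "p (\<mu> (E k x) (E k y)) = p x' [^]\<^bsub>A\<^esub> (2 ^ k :: nat) \<otimes>\<^bsub>A\<^esub> p y' [^]\<^bsub>A\<^esub> (2 ^ k :: nat)"
      using product[OF Efx(1) Efy(1) Efx(3) Efy(3)] Efx(4) Efy(4) by (simp add: x'_def y'_def)
    also have "\<dots> = p w [^]\<^bsub>A\<^esub> (2 ^ k :: nat)"
      unfolding w(2) using p_closed[OF ball] v r' by (simp add: nat_pow_distrib)
    also have "\<dots> = p ((dbl ^^ k) w)" using iterate[OF w(1) wk] by simp
    finally have peq: "p (\<mu> (E k x) (E k y)) = p ((dbl ^^ k) w)" .
    have "\<mu> (E k x) (E k y) \<in> \<Omega>" using product[OF Efx(1) Efy(1) Efx(3) Efy(3)] by simp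
    moreover have "(dbl ^^ k) w \<in> \<Omega>"
      using iterate[OF w(1) wk] iterate_norm[OF w(1) wk] by (intro ball) simp_all
    ultimately have "\<mu> (E k x) (E k y) = (dbl ^^ k) w"
      using peq p_inj unfolding inj_on_def by simp
    moreover have "E k (x + y) = (dbl ^^ k) (x' + y')"
      by (simp add: E_def x'_def y'_def scaleR_right_distrib)
    ultimately have "norm1 n (\<mu> (E k x) (E k y) - E k (x + y)) \<le> 2 * (2 ^ k * norm1 n (w - (x' + y')))"
      using iterate_diff[OF w(1) wk _ xyk] v by simp
    also have "\<dots> \<le> 2 * (2 ^ k * (C * (s / 2 ^ k)\<^sup>2))" using wa by simp
    also have "\<dots> = 2 * C * s\<^sup>2 * (1 / 2) ^ k" by (simp add: power2_eq_square power_divide field_simps)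
    finally show ?thesis .
  qed
  have ex: "norm1 n (e x) < r" "norm1 n (e y) < r" using e_norm(2) x y nx by simp_all
  \<comment> \<open>Near 0, \<mu> is addition plus a Lipschitz error, so the limit can be taken in
    both arguments.\<close>
  have cont: "norm1 n (\<mu> (e x) (e y) - \<mu> (E k x) (E k y))
      \<le> (1 + C * (4 * r)) * (norm1 n (E k x - e x) + norm1 n (E k y - e y))" for k
  proof -
    have Ex: "norm1 n x \<le> \<rho>" "norm1 n y \<le> \<rho>" using nx rho(1) by linarith+
    note Efx = E_facts[OF x Ex(1), of k] and Efy = E_facts[OF y Ex(2), of k]
    define D where "D = norm1 n (E k x - e x) + norm1 n (E k y - e y)"
    define d where "d = \<mu> (e x) (e y) - e x - e y - (\<mu> (E k x) (E k y) - E k x - E k y)"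
    have D: "D = norm1 n (e x - E k x) + norm1 n (e y - E k y)"
      unfolding D_def using norm1_minus_commute by metis
    have D0: "0 \<le> D" by (simp add: D_def)
    have "norm1 n d \<le> C * (norm1 n (e x) + norm1 n (e y) + norm1 n (E k x) + norm1 n (E k y)) * D"
      unfolding d_def D by (intro estimate e_in_vecs Efx Efy ex)
    also have "\<dots> \<le> C * (4 * r) * D"
      using ex Efx(3) Efy(3) C D0 by (intro mult_right_mono mult_left_mono) auto
    finally have d: "norm1 n d \<le> C * (4 * r) * D" .
    have "\<mu> (e x) (e y) - \<mu> (E k x) (E k y) = d + ((e x - E k x) + (e y - E k y))"
      by (simp add: d_def)
    then have "norm1 n (\<mu> (e x) (e y) - \<mu> (E k x) (E k y)) \<le> norm1 n d + norm1 n ((e x - E k x) + (e y - E k y))"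
      by (metis norm1_triangle)
    also have "\<dots> \<le> C * (4 * r) * D + D"
      using d norm1_triangle[of n "e x - E k x" "e y - E k y"] D by linarith
    finally show ?thesis by (simp add: D_def distrib_right)
  qed
  have "(\<lambda>k. (1 + C * (4 * r)) * (norm1 n (E k x - e x) + norm1 n (E k y - e y)) + 2 * C * s\<^sup>2 * (1 / 2) ^ k
      + norm1 n (E k (x + y) - e (x + y))) \<longlonglongrightarrow> (1 + C * (4 * r)) * (0 + 0) + 2 * C * s\<^sup>2 * 0 + 0"
    using x y nx nxy by (intro tendsto_add tendsto_mult tendsto_const E_tendsto_e LIMSEQ_power_zero) auto
  moreover have "norm1 n (\<mu> (e x) (e y) - e (x + y))
      \<le> (1 + C * (4 * r)) * (norm1 n (E k x - e x) + norm1 n (E k y - e y)) + 2 * C * s\<^sup>2 * (1 / 2) ^ k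
        + norm1 n (E k (x + y) - e (x + y))" for k
    using norm1_diff_triangle[of n "\<mu> (e x) (e y)" "e (x + y)" "\<mu> (E k x) (E k y)"]
      norm1_diff_triangle[of n "\<mu> (E k x) (E k y)" "e (x + y)" "E k (x + y)"] cont[of k] step[of k] by linarith
  ultimately have "norm1 n (\<mu> (e x) (e y) - e (x + y)) \<le> (1 + C * (4 * r)) * (0 + 0) + 2 * C * s\<^sup>2 * 0 + 0"
    by (intro LIMSEQ_le_const) auto
  then have "norm1 n (\<mu> (e x) (e y) - e (x + y)) = 0"
    using norm1_nonneg[of n "\<mu> (e x) (e y) - e (x + y)"] by simp
  then have "\<mu> (e x) (e y) - e (x + y) = 0"
    using product_in_vecs[OF _ _ ex] by (intro norm1_eq_0[of n]) simp_all
  then show ?thesis by simp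
qed

lemma e_in_domain: "\<lbrakk>x \<in> vecs n; norm1 n x \<le> \<rho> / 2\<rbrakk> \<Longrightarrow> e x \<in> \<Omega>"
  using e_norm(2) by (intro ball) simp_all

lemma p_e_add:
  assumes x: "x \<in> vecs n" and y: "y \<in> vecs n" and xy: "norm1 n x + norm1 n y \<le> \<rho> / 2"
  shows "p (e (x + y)) = p (e x) \<otimes>\<^bsub>A\<^esub> p (e y)"
proof -
  have "norm1 n x \<le> \<rho> / 2" "norm1 n y \<le> \<rho> / 2"
    using xy norm1_nonneg[of n x] norm1_nonneg[of n y] by linarith+
  then show ?thesis
    using product[of "e x" "e y"] e_norm(2) x y unfolding e_add[OF assms, symmetric] by simp
qed

text \<open>The difference \<open>d\<close> satisfies \<open>e d = 0\<close>, whereas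
  \<open>e\<close> moves \<open>d\<close> by at most a quarter of its norm.\<close>

lemma p_e_inj:
  assumes x: "x \<in> vecs n" "norm1 n x \<le> \<rho> / 8" and y: "y \<in> vecs n" "norm1 n y \<le> \<rho> / 8"
    and eq: "p (e x) = p (e y)"
  shows "x = y"
proof -
  interpret comm_group A by (rule comm)
  define d where "d = x - y"
  have d: "d \<in> vecs n" "norm1 n d \<le> \<rho> / 4"
    using norm1_triangle_diff[of n x y] x y by (simp_all add: d_def)
  have d2: "norm1 n d \<le> \<rho> / 2" "norm1 n y \<le> \<rho> / 2" using d y rho(1) by simp_all
  have "p (e (y + d)) = p (e y) \<otimes>\<^bsub>A\<^esub> p (e d)" using d y rho(1) by (intro p_e_add) simp_all
  moreover have "y + d = x" by (simp add: d_def)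
  ultimately have "p (e y) \<otimes>\<^bsub>A\<^esub> p (e d) = p (e y)" using eq by simp
  moreover have cl: "p (e y) \<in> carrier A" "p (e d) \<in> carrier A"
    using p_closed e_in_domain d2 d y by simp_all
  ultimately have "p (e d) = p 0" unfolding p_zero using l_cancel_one[OF cl] by simp
  then have "e d = 0"
    using e_in_domain[OF d(1) d2(1)] ball[of 0] r by (intro inj_onD[OF p_inj]) simp_all
  then have "norm1 n d \<le> c * (norm1 n d)\<^sup>2" using e_close[OF d(1) d2(1)] by simp
  moreover have "4 * (c * (norm1 n d)\<^sup>2) \<le> norm1 n d" using d2(1) rho(1) by (intro quadratic_small) simp_all
  ultimately have "norm1 n d = 0" using norm1_nonneg[of n d] by linarith
  then have "d = 0" using d(1) by (rule norm1_eq_0)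
  then show ?thesis by (simp add: d_def)
qed

definition ball_rho :: "(nat \<Rightarrow> real) set" where
  "ball_rho = {x \<in> vecs n. norm1 n (x - 0) < \<rho> / 8}"

lemma openin_ball_rho: "openin (Euclidean_space n) ball_rho"
  unfolding ball_rho_def by (rule openin_norm1_ball)

lemma e_preimage_open:
  assumes V: "openin (Euclidean_space n) V"
  shows "openin (Euclidean_space n) {x \<in> ball_rho. e x \<in> V}"
  unfolding openin_Euclidean_norm1
proof (intro conjI ballI)
  show "{x \<in> ball_rho. e x \<in> V} \<subseteq> vecs n" by (auto simp: ball_rho_def)
  fix x assume x: "x \<in> {x \<in> ball_rho. e x \<in> V}"
  then have xv: "x \<in> vecs n" "norm1 n x < \<rho> / 8" "e x \<in> V" by (simp_all add: ball_rho_def)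
  obtain d where d: "d > 0" "\<And>y. \<lbrakk>y \<in> vecs n; norm1 n (y - e x) < d\<rbrakk> \<Longrightarrow> y \<in> V"
    using openin_Euclidean_norm1D[OF V xv(3)] by blast
  define d' where "d' = min (d / 2) (\<rho> / 8 - norm1 n x)"
  have "d' > 0" using d(1) xv(2) by (simp add: d'_def)
  moreover have "y \<in> {x \<in> ball_rho. e x \<in> V}" if y: "y \<in> vecs n" "norm1 n (y - x) < d'" for y
  proof -
    have "norm1 n y < \<rho> / 8" using norm1_triangle[of n "y - x" x] y(2) by (simp add: d'_def)
    moreover from this have "norm1 n (e y - e x) < d"
      using e_lipschitz[of y x] y xv rho(1) by (simp add: d'_def)
    ultimately show ?thesis using y(1) d(2)[of "e y"] by (simp add: ball_rho_def)
  qed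
  ultimately show "\<exists>d>0. \<forall>y\<in>vecs n. norm1 n (y - x) < d \<longrightarrow> y \<in> {x \<in> ball_rho. e x \<in> V}" by blast
qed

lemma local_exponential:
  "\<exists>\<sigma> \<eta>. \<sigma> > 0 \<and>
    (\<forall>x\<in>vecs n. norm1 n x < \<sigma> \<longrightarrow> \<eta> x \<in> carrier A) \<and>
    (\<forall>x\<in>vecs n. \<forall>y\<in>vecs n. norm1 n x < \<sigma> \<and> norm1 n y < \<sigma> \<longrightarrow> \<eta> (x + y) = \<eta> x \<otimes>\<^bsub>A\<^esub> \<eta> y) \<and>
    (\<forall>W. openin X W \<longrightarrow> openin (Euclidean_space n) {x \<in> vecs n. norm1 n x < \<sigma> \<and> \<eta> x \<in> W}) \<and>
    (\<forall>V. openin (Euclidean_space n) V \<and> (\<forall>x\<in>V. norm1 n x < \<sigma>) \<longrightarrow> openin X (\<eta> ` V)) \<and>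
    (\<forall>x\<in>vecs n. \<forall>y\<in>vecs n. norm1 n x < \<sigma> \<and> norm1 n y < \<sigma> \<and> \<eta> x = \<eta> y \<longrightarrow> x = y)"
proof (intro exI[of _ "\<rho> / 8"] exI[of _ "\<lambda>x. p (e x)"] conjI ballI allI impI)
  show "\<rho> / 8 > 0" using rho(1) by simp
next
  fix x assume "x \<in> vecs n" "norm1 n x < \<rho> / 8"
  then show "p (e x) \<in> carrier A" using rho(1) by (intro p_closed e_in_domain) simp_all
next
  fix x y assume "x \<in> vecs n" "y \<in> vecs n" "norm1 n x < \<rho> / 8 \<and> norm1 n y < \<rho> / 8"
  then show "p (e (x + y)) = p (e x) \<otimes>\<^bsub>A\<^esub> p (e y)" using rho(1) by (intro p_e_add) simp_all
next
  fix W assume W: "openin X W"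
  have sub: "e x \<in> \<Omega>" if "x \<in> ball_rho" for x
    using that rho(1) by (intro e_in_domain) (simp_all add: ball_rho_def)
  have "openin (subtopology (Euclidean_space n) \<Omega>) {x \<in> topspace (subtopology (Euclidean_space n) \<Omega>). p x \<in> W}"
    by (rule openin_continuous_map_preimage[OF p_continuous W])
  then have "openin (Euclidean_space n) {x \<in> topspace (subtopology (Euclidean_space n) \<Omega>). p x \<in> W}"
    using open_domain by (rule openin_trans_full)
  from e_preimage_open[OF this]
  have "openin (Euclidean_space n) {x \<in> ball_rho. e x \<in> {x \<in> topspace (subtopology (Euclidean_space n) \<Omega>). p x \<in> W}}" .
  moreover have "{x \<in> ball_rho. e x \<in> {x \<in> topspace (subtopology (Euclidean_space n) \<Omega>). p x \<in> W}}
      = {x \<in> vecs n. norm1 n x < \<rho> / 8 \<and> p (e x) \<in> W}"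
    using sub by (auto simp: ball_rho_def)
  ultimately show "openin (Euclidean_space n) {x \<in> vecs n. norm1 n x < \<rho> / 8 \<and> p (e x) \<in> W}" by simp
next
  fix V assume V: "openin (Euclidean_space n) V \<and> (\<forall>x\<in>V. norm1 n x < \<rho> / 8)"
  then have Vb: "V \<subseteq> ball_rho" using openin_subset[of "Euclidean_space n" V] by (auto simp: ball_rho_def)
  have e\<Omega>: "e ` V \<subseteq> \<Omega>"
    using Vb rho(1) by (intro image_subsetI e_in_domain) (auto simp: ball_rho_def)
  have inj: "inj_on e V"
  proof (rule inj_onI)
    fix x y assume "x \<in> V" "y \<in> V" "e x = e y"
    then show "x = y" using Vb by (intro p_e_inj) (auto simp: ball_rho_def)
  qed
  have "continuous_map (subtopology (Euclidean_space n) ball_rho) (Euclidean_space n) e"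
    unfolding continuous_map_def
  proof (intro conjI allI impI)
    show "e \<in> topspace (subtopology (Euclidean_space n) ball_rho) \<rightarrow> topspace (Euclidean_space n)" by simp
    fix U assume "openin (Euclidean_space n) U"
    from openin_subset_topspace_eq e_preimage_open[OF this]
    have "openin (subtopology (Euclidean_space n) ball_rho) {x \<in> ball_rho. e x \<in> U}"
      by (intro openin_open_subtopology[OF openin_ball_rho, THEN iffD2]) auto
    then show "openin (subtopology (Euclidean_space n) ball_rho)
        {x \<in> topspace (subtopology (Euclidean_space n) ball_rho). e x \<in> U}"
      using openin_subset[OF openin_ball_rho] by (simp add: Int_absorb1)
  qed
  \<comment> \<open>Injectivity and continuity of \<open>e\<close> suffice here: invariance of
    domain makes its images open, with no derivative of the limit involved.\<close>
  from continuous_map_from_subtopology_mono[OF this Vb]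
  have "openin (Euclidean_space n) (e ` V)"
    using V by (intro invariance_of_domain_Euclidean_space inj) simp_all
  from p_open[OF this e\<Omega>] show "openin X ((\<lambda>x. p (e x)) ` V)" by (simp add: image_image)
next
  fix x y assume "x \<in> vecs n" "y \<in> vecs n"
    "norm1 n x < \<rho> / 8 \<and> norm1 n y < \<rho> / 8 \<and> p (e x) = p (e y)"
  then show "x = y" by (intro p_e_inj) simp_all
qed

end

subsection \<open>Connected abelian Lie groups as quotients of vector groups\<close>

lemma openin_left_translation:
  assumes tg: "topological_group G X" and a: "a \<in> carrier G" and W: "openin X W"
  shows "openin X {g \<in> carrier G. a \<otimes>\<^bsub>G\<^esub> g \<in> W}" "openin X ((\<lambda>g. a \<otimes>\<^bsub>G\<^esub> g) ` W)"
proof -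
  interpret group G using tg by (simp add: topological_group_def)
  have top: "topspace X = carrier G" using tg by (simp add: topological_group_def)
  have mult: "continuous_map (prod_topology X X) X (\<lambda>(x, y). x \<otimes>\<^bsub>G\<^esub> y)"
    using tg by (simp add: topological_group_def)
  have pre: "openin X {g \<in> carrier G. b \<otimes>\<^bsub>G\<^esub> g \<in> W}" if b: "b \<in> carrier G" for b
  proof -
    have "continuous_map X (prod_topology X X) (\<lambda>g. (b, g))"
      using b top by (simp add: continuous_map_pairedI)
    from continuous_map_compose[OF this mult] have "continuous_map X X (\<lambda>g. b \<otimes>\<^bsub>G\<^esub> g)"
      by (simp add: o_def)
    from openin_continuous_map_preimage[OF this W] show ?thesis unfolding top .
  qed
  then show "openin X {g \<in> carrier G. a \<otimes>\<^bsub>G\<^esub> g \<in> W}" using a by simp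
  have "(\<lambda>g. a \<otimes>\<^bsub>G\<^esub> g) ` W = {g \<in> carrier G. inv\<^bsub>G\<^esub> a \<otimes>\<^bsub>G\<^esub> g \<in> W}"
  proof (intro equalityI subsetI)
    fix g assume "g \<in> (\<lambda>g. a \<otimes>\<^bsub>G\<^esub> g) ` W"
    then obtain h where "h \<in> W" "g = a \<otimes>\<^bsub>G\<^esub> h" by blast
    moreover from this have "h \<in> carrier G" using openin_subset[OF W] top by auto
    ultimately show "g \<in> {g \<in> carrier G. inv\<^bsub>G\<^esub> a \<otimes>\<^bsub>G\<^esub> g \<in> W}"
      using a by (simp add: m_assoc[symmetric])
  next
    fix g assume "g \<in> {g \<in> carrier G. inv\<^bsub>G\<^esub> a \<otimes>\<^bsub>G\<^esub> g \<in> W}"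
    then show "g \<in> (\<lambda>g. a \<otimes>\<^bsub>G\<^esub> g) ` W"
      using a by (intro image_eqI[of _ _ "inv\<^bsub>G\<^esub> a \<otimes>\<^bsub>G\<^esub> g"]) (simp_all add: m_assoc[symmetric])
  qed
  then show "openin X ((\<lambda>g. a \<otimes>\<^bsub>G\<^esub> g) ` W)" using pre[of "inv\<^bsub>G\<^esub> a"] a by simp
qed

lemma open_subgroup_connected:
  assumes tg: "topological_group G X" and conn: "connected_space X"
    and K: "subgroup K G" "openin X K"
  shows "K = carrier G"
proof -
  interpret group G using tg by (simp add: topological_group_def)
  interpret K: subgroup K G by (rule K(1))
  have top: "topspace X = carrier G" using tg by (simp add: topological_group_def)
  have "openin X (carrier G - K)"
    unfolding openin_subopen[of _ "carrier G - K"]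
  proof
    fix a assume a: "a \<in> carrier G - K"
    have "(\<lambda>g. a \<otimes>\<^bsub>G\<^esub> g) ` K \<subseteq> carrier G - K"
    proof
      fix x assume "x \<in> (\<lambda>g. a \<otimes>\<^bsub>G\<^esub> g) ` K"
      then obtain k where k: "k \<in> K" "x = a \<otimes>\<^bsub>G\<^esub> k" by blast
      have "x \<notin> K"
      proof
        assume "x \<in> K"
        then have "x \<otimes>\<^bsub>G\<^esub> inv\<^bsub>G\<^esub> k \<in> K" using k(1) by simp
        then show False using a k by (simp add: m_assoc)
      qed
      then show "x \<in> carrier G - K" using a k by simp
    qed
    moreover have "a \<in> (\<lambda>g. a \<otimes>\<^bsub>G\<^esub> g) ` K" using a by (intro image_eqI[of _ _ "\<one>\<^bsub>G\<^esub>"]) simp_all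
    moreover have "openin X ((\<lambda>g. a \<otimes>\<^bsub>G\<^esub> g) ` K)" using a by (intro openin_left_translation[OF tg] K(2)) simp
    ultimately show "\<exists>T. openin X T \<and> a \<in> T \<and> T \<subseteq> carrier G - K" by blast
  qed
  then have "closedin X K" using K.subset top by (simp add: closedin_def)
  then have "K = {} \<or> K = topspace X" using conn K(2) unfolding connected_space_clopen_in by blast
  then show ?thesis using K.one_closed top by (metis empty_iff)
qed

text \<open>\<open>F x\<close> is the \<open>2 ^ k\<close>-th power of the value of \<eta> at
  \<open>x / 2 ^ k\<close>, for any \<open>k\<close> that brings the argument into the ball;
  additivity of \<eta> makes this independent of \<open>k\<close>. The image is an open subgroup,
  hence the whole group by connectedness.\<close>

lemma vector_cover_extend_local:
  assumes comm: "comm_group A" and tg: "topological_group A X" and conn: "connected_space X"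
    and \<sigma>: "\<sigma> > 0" and cl: "\<And>x. \<lbrakk>x \<in> vecs n; norm1 n x < \<sigma>\<rbrakk> \<Longrightarrow> \<eta> x \<in> carrier A"
    and add: "\<And>x y. \<lbrakk>x \<in> vecs n; y \<in> vecs n; norm1 n x < \<sigma>; norm1 n y < \<sigma>\<rbrakk> \<Longrightarrow> \<eta> (x + y) = \<eta> x \<otimes>\<^bsub>A\<^esub> \<eta> y"
    and cont: "\<And>W. openin X W \<Longrightarrow> openin (Euclidean_space n) {x \<in> vecs n. norm1 n x < \<sigma> \<and> \<eta> x \<in> W}"
    and opn: "\<And>V. \<lbrakk>openin (Euclidean_space n) V; \<forall>x\<in>V. norm1 n x < \<sigma>\<rbrakk> \<Longrightarrow> openin X (\<eta> ` V)"
  shows "\<exists>F. vector_cover n A X F \<and> (\<forall>x\<in>vecs n. norm1 n x < \<sigma> \<longrightarrow> F x = \<eta> x)"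
proof -
  interpret comm_group A by (rule comm)
  have top: "topspace X = carrier A" using tg by (simp add: topological_group_def)
  define H where "H k x = \<eta> ((1 / 2 ^ k) *\<^sub>R x) [^]\<^bsub>A\<^esub> (2 ^ k :: nat)" for k x
  have small: "norm1 n ((1 / 2 ^ k) *\<^sub>R x) < \<sigma>" if "norm1 n x < 2 ^ k * \<sigma>" for k x
    using that by (simp add: field_simps)
  have Hcl: "H k x \<in> carrier A" if "x \<in> vecs n" "norm1 n x < 2 ^ k * \<sigma>" for k x
    unfolding H_def by (intro nat_pow_closed cl small that(2)) (simp add: that(1))
  have Hadd: "H k (x + y) = H k x \<otimes>\<^bsub>A\<^esub> H k y"
    if "x \<in> vecs n" "y \<in> vecs n" "norm1 n x < 2 ^ k * \<sigma>" "norm1 n y < 2 ^ k * \<sigma>" for k x y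
  proof -
    have "\<eta> ((1 / 2 ^ k) *\<^sub>R x + (1 / 2 ^ k) *\<^sub>R y) = \<eta> ((1 / 2 ^ k) *\<^sub>R x) \<otimes>\<^bsub>A\<^esub> \<eta> ((1 / 2 ^ k) *\<^sub>R y)"
      by (intro add small that) (simp_all add: that)
    then show ?thesis unfolding H_def scaleR_right_distrib
      using cl[OF _ small[OF that(3)]] cl[OF _ small[OF that(4)]] that(1,2) by (simp add: nat_pow_distrib)
  qed
  have Hsuc: "H (Suc k) x = H k x" if x: "x \<in> vecs n" "norm1 n x < 2 ^ k * \<sigma>" for k x
  proof -
    define y where "y = (1 / 2 ^ Suc k) *\<^sub>R x"
    have "2 ^ Suc k * \<sigma> = 2 ^ k * \<sigma> + 2 ^ k * \<sigma>" "0 < 2 ^ k * \<sigma>" using \<sigma> by simp_all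
    then have "norm1 n x < 2 ^ Suc k * \<sigma>" using x(2) by linarith
    then have ns: "norm1 n y < \<sigma>" unfolding y_def by (rule small)
    have y: "y \<in> vecs n" using x(1) by (simp add: y_def)
    have "(1 / 2 ^ k) *\<^sub>R x = y + y" by (simp add: y_def flip: scaleR_2)
    then have "\<eta> ((1 / 2 ^ k) *\<^sub>R x) = \<eta> y \<otimes>\<^bsub>A\<^esub> \<eta> y" using add[OF y y ns ns] by simp
    also have "\<dots> = \<eta> y [^]\<^bsub>A\<^esub> (2 :: nat)" using cl[OF y ns] by (simp add: numeral_2_eq_2)
    finally have "H k x = \<eta> y [^]\<^bsub>A\<^esub> (2 * 2 ^ k :: nat)"
      using cl[OF y ns] by (simp add: H_def nat_pow_pow)
    then show ?thesis by (simp add: H_def y_def)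
  qed
  have Hmono: "H (k + j) x = H k x" if x: "x \<in> vecs n" "norm1 n x < 2 ^ k * \<sigma>" for k j x
  proof (induction j)
    case (Suc j)
    have "(2::real) ^ k \<le> 2 ^ (k + j)" by (intro power_increasing) simp_all
    then have "norm1 n x < 2 ^ (k + j) * \<sigma>" using x(2) \<sigma> by (smt (verit) mult_right_mono)
    then show ?case using Hsuc[OF x(1)] Suc.IH by simp
  qed simp
  have ex: "\<exists>k. norm1 n x < 2 ^ k * \<sigma>" for x
  proof -
    obtain k where "norm1 n x / \<sigma> < 2 ^ k" using real_arch_pow[of 2 "norm1 n x / \<sigma>"] by auto
    then show ?thesis using \<sigma> by (auto simp: field_simps)
  qed
  define F where "F x = H (SOME k. norm1 n x < 2 ^ k * \<sigma>) x" for x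
  have FH: "F x = H k x" if x: "x \<in> vecs n" "norm1 n x < 2 ^ k * \<sigma>" for k x
  proof -
    define l where "l = (SOME k. norm1 n x < 2 ^ k * \<sigma>)"
    have l: "norm1 n x < 2 ^ l * \<sigma>" unfolding l_def by (rule someI_ex[OF ex])
    have "H l x = H (l + k) x" by (rule Hmono[OF x(1) l, symmetric])
    also have "\<dots> = H k x" using Hmono[OF x, of l] by (simp add: add.commute)
    finally show ?thesis by (simp add: F_def l_def)
  qed
  have F\<eta>: "F x = \<eta> x" if "x \<in> vecs n" "norm1 n x < \<sigma>" for x
    using FH[of x 0] that cl[OF that] by (simp add: H_def)
  have Fcl: "F x \<in> carrier A" if x: "x \<in> vecs n" for x
  proof -
    obtain k where k: "norm1 n x < 2 ^ k * \<sigma>" using ex by blast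
    show ?thesis using Hcl[OF x k] FH[OF x k] by simp
  qed
  have Fadd: "F (x + y) = F x \<otimes>\<^bsub>A\<^esub> F y" if x: "x \<in> vecs n" and y: "y \<in> vecs n" for x y
  proof -
    obtain k where "norm1 n x < 2 ^ k * \<sigma>" using ex by blast
    \<comment> \<open>A single exponent that works for \<open>x\<close>, \<open>y\<close> and
      \<open>x + y\<close>.\<close>
    obtain l where l: "norm1 n (\<lambda>i. \<bar>x i\<bar> + \<bar>y i\<bar>) < 2 ^ l * \<sigma>" using ex by blast
    have s: "norm1 n (\<lambda>i. \<bar>x i\<bar> + \<bar>y i\<bar>) = norm1 n x + norm1 n y" by (simp add: norm1_def sum.distrib)
    have "norm1 n x < 2 ^ l * \<sigma>" "norm1 n y < 2 ^ l * \<sigma>" "norm1 n (x + y) < 2 ^ l * \<sigma>"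
      using l norm1_nonneg[of n x] norm1_nonneg[of n y] norm1_triangle[of n x y] unfolding s by linarith+
    then show ?thesis using Hadd[OF x y] FH x y by simp
  qed
  have Fdiff: "F y = F x \<otimes>\<^bsub>A\<^esub> \<eta> (y - x)" if "x \<in> vecs n" "y \<in> vecs n" "norm1 n (y - x) < \<sigma>" for x y
  proof -
    have "F (x + (y - x)) = F x \<otimes>\<^bsub>A\<^esub> F (y - x)" using that by (intro Fadd) simp_all
    moreover have "F (y - x) = \<eta> (y - x)" using that by (intro F\<eta>) simp_all
    ultimately show ?thesis by simp
  qed
  have \<eta>0: "\<eta> 0 = \<one>\<^bsub>A\<^esub>"
  proof -
    have z: "\<eta> 0 \<in> carrier A" using \<sigma> by (intro cl) simp_all
    have "\<eta> 0 \<otimes>\<^bsub>A\<^esub> \<eta> 0 = \<eta> 0" using add[of 0 0] \<sigma> by simp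
    then show ?thesis using l_cancel_one[OF z z] by simp
  qed
  have Fcont: "continuous_map (Euclidean_space n) X F"
    unfolding continuous_map_def topspace_Euclidean_vecs top
  proof (intro conjI allI impI)
    show "F \<in> vecs n \<rightarrow> carrier A" using Fcl by blast
    fix W assume W: "openin X W"
    show "openin (Euclidean_space n) {x \<in> vecs n. F x \<in> W}"
      unfolding openin_Euclidean_norm1
    proof (intro conjI ballI)
      fix x assume x: "x \<in> {x \<in> vecs n. F x \<in> W}"
      define W' where "W' = {g \<in> carrier A. F x \<otimes>\<^bsub>A\<^esub> g \<in> W}"
      have "openin X W'" unfolding W'_def by (intro openin_left_translation[OF tg] W Fcl) (use x in simp)
      note O = cont[OF this]
      have "0 \<in> {x \<in> vecs n. norm1 n x < \<sigma> \<and> \<eta> x \<in> W'}" using x \<sigma> Fcl[of x] by (simp add: W'_def \<eta>0)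
      from openin_Euclidean_norm1D[OF O this] obtain d where d: "d > 0"
        "\<And>y. \<lbrakk>y \<in> vecs n; norm1 n (y - 0) < d\<rbrakk> \<Longrightarrow> y \<in> {x \<in> vecs n. norm1 n x < \<sigma> \<and> \<eta> x \<in> W'}" by blast
      have "y \<in> {x \<in> vecs n. F x \<in> W}" if y: "y \<in> vecs n" "norm1 n (y - x) < d" for y
        using d(2)[of "y - x"] y x Fdiff[of x y] by (simp add: W'_def)
      then show "\<exists>d>0. \<forall>y\<in>vecs n. norm1 n (y - x) < d \<longrightarrow> y \<in> {x \<in> vecs n. F x \<in> W}" using d(1) by blast
    qed simp
  qed
  have Fopen: "open_map (Euclidean_space n) X F"
    unfolding open_map_def
  proof (intro allI impI)
    fix V assume V: "openin (Euclidean_space n) V"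
    have Vv: "V \<subseteq> vecs n" using openin_subset[OF V] by simp
    show "openin X (F ` V)"
      unfolding openin_subopen[of _ "F ` V"]
    proof
      fix g assume "g \<in> F ` V"
      then obtain x where x: "x \<in> V" "g = F x" by blast
      obtain d where d: "d > 0" "\<And>y. \<lbrakk>y \<in> vecs n; norm1 n (y - x) < d\<rbrakk> \<Longrightarrow> y \<in> V"
        using openin_Euclidean_norm1D[OF V x(1)] by blast
      define B where "B = {y \<in> vecs n. norm1 n (y - 0) < min d \<sigma>}"
      have "openin X (\<eta> ` B)"
        unfolding B_def by (intro opn openin_norm1_ball) simp
      then have "openin X ((\<lambda>h. g \<otimes>\<^bsub>A\<^esub> h) ` \<eta> ` B)"
        using x Vv Fcl by (intro openin_left_translation[OF tg]) auto
      moreover have "g \<in> (\<lambda>h. g \<otimes>\<^bsub>A\<^esub> h) ` \<eta> ` B"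
      proof -
        have "0 \<in> B" using d(1) \<sigma> by (simp add: B_def)
        moreover have "g = g \<otimes>\<^bsub>A\<^esub> \<eta> 0" using \<eta>0 x Vv Fcl by auto
        ultimately show ?thesis by blast
      qed
      moreover have "(\<lambda>h. g \<otimes>\<^bsub>A\<^esub> h) ` \<eta> ` B \<subseteq> F ` V"
      proof clarify
        fix z assume z: "z \<in> B"
        have "x + z \<in> V" using d(2)[of "x + z"] z x Vv by (auto simp: B_def)
        moreover have "F (x + z) = g \<otimes>\<^bsub>A\<^esub> \<eta> z" using Fdiff[of x "x + z"] z x Vv by (auto simp: B_def)
        ultimately show "g \<otimes>\<^bsub>A\<^esub> \<eta> z \<in> F ` V" by (metis imageI)
      qed
      ultimately show "\<exists>T. openin X T \<and> g \<in> T \<and> T \<subseteq> F ` V" by blast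
    qed
  qed
  have "subgroup (F ` vecs n) A"
  proof (rule subgroupI)
    show "F ` vecs n \<subseteq> carrier A" using Fcl by blast
    show "F ` vecs n \<noteq> {}" using vecs_closed(1) by blast
    fix a b assume "a \<in> F ` vecs n" "b \<in> F ` vecs n"
    then obtain x y where x: "x \<in> vecs n" "a = F x" and y: "y \<in> vecs n" "b = F y" by blast
    have "F (x + y) = a \<otimes>\<^bsub>A\<^esub> b" using Fadd x y by simp
    then show "a \<otimes>\<^bsub>A\<^esub> b \<in> F ` vecs n" using x y by (metis imageI vecs_closed(2))
    have "F (- x) \<otimes>\<^bsub>A\<^esub> a = F 0" using Fadd[of "- x" x] x by simp
    also have "F 0 = \<one>\<^bsub>A\<^esub>" using F\<eta>[of 0] \<sigma> \<eta>0 by simp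
    finally have "inv\<^bsub>A\<^esub> a = F (- x)" using x Fcl by (intro inv_equality) simp_all
    then show "inv\<^bsub>A\<^esub> a \<in> F ` vecs n" using x by simp
  qed
  moreover have "openin X (F ` vecs n)"
    using Fopen openin_topspace[of "Euclidean_space n"] unfolding open_map_def topspace_Euclidean_vecs by blast
  ultimately have "F ` vecs n = carrier A" by (rule open_subgroup_connected[OF tg conn])
  then have "vector_cover n A X F"
    using tg Fcont Fopen Fadd by (intro vector_cover.intro)
  then show ?thesis using F\<eta> by blast
qed

lemma lie_structure_vector_cover:
  assumes lie: "lie_structure n A X \<A>" and comm: "comm_group A" and conn: "connected_space X"
  obtains F \<sigma> where "vector_cover n A X F" "\<sigma> > 0"
    "\<And>x. \<lbrakk>x \<in> vecs n; norm1 n x < \<sigma>; F x = \<one>\<^bsub>A\<^esub>\<rbrakk> \<Longrightarrow> x = 0"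
proof -
  obtain p \<mu> \<Omega> r C where "local_product n A X p \<mu> \<Omega> r C"
    using lie_structure_local_product[OF lie comm] by (elim exE)
  then interpret L: local_product n A X p \<mu> \<Omega> r C .
  obtain \<sigma> \<eta> where \<sigma>: "\<sigma> > 0" and cl: "\<forall>x\<in>vecs n. norm1 n x < \<sigma> \<longrightarrow> \<eta> x \<in> carrier A"
    and add: "\<forall>x\<in>vecs n. \<forall>y\<in>vecs n. norm1 n x < \<sigma> \<and> norm1 n y < \<sigma> \<longrightarrow> \<eta> (x + y) = \<eta> x \<otimes>\<^bsub>A\<^esub> \<eta> y"
    and cont: "\<forall>W. openin X W \<longrightarrow> openin (Euclidean_space n) {x \<in> vecs n. norm1 n x < \<sigma> \<and> \<eta> x \<in> W}"
    and opn: "\<forall>V. openin (Euclidean_space n) V \<and> (\<forall>x\<in>V. norm1 n x < \<sigma>) \<longrightarrow> openin X (\<eta> ` V)"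
    and inj: "\<forall>x\<in>vecs n. \<forall>y\<in>vecs n. norm1 n x < \<sigma> \<and> norm1 n y < \<sigma> \<and> \<eta> x = \<eta> y \<longrightarrow> x = y"
    using L.local_exponential by (elim exE conjE)
  have "\<exists>F. vector_cover n A X F \<and> (\<forall>x\<in>vecs n. norm1 n x < \<sigma> \<longrightarrow> F x = \<eta> x)"
    by (rule vector_cover_extend_local[OF comm L.topological_group conn \<sigma>])
      (use cl add cont opn in simp_all)
  then obtain F where F: "vector_cover n A X F" "\<forall>x\<in>vecs n. norm1 n x < \<sigma> \<longrightarrow> F x = \<eta> x" by blast
  show ?thesis
  proof (rule that[OF F(1) \<sigma>])
    fix x assume x: "x \<in> vecs n" "norm1 n x < \<sigma>" "F x = \<one>\<^bsub>A\<^esub>"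
    have "F 0 = \<one>\<^bsub>A\<^esub>" by (rule vector_cover.zero[OF F(1)])
    then have "\<eta> x = \<eta> 0" using x F(2) \<sigma> by simp
    then show "x = 0" using inj x \<sigma> by simp
  qed
qed

section \<open>Uniqueness of the dimension\<close>

lemma smooth_atlas_dim_le:
  assumes "smooth_atlas n X \<A>" "smooth_atlas m X \<B>" and x: "x \<in> topspace X"
  shows "m \<le> n"
proof (rule ccontr)
  assume "\<not> m \<le> n"
  then have nm: "n < m" by simp
  have "x \<in> (\<Union>(U, \<phi>)\<in>\<A>. U)" "x \<in> (\<Union>(V, \<psi>)\<in>\<B>. V)"
    using assms(1,2) x by (simp_all add: smooth_atlas_def)
  then obtain U \<phi> V \<psi> where U: "(U, \<phi>) \<in> \<A>" "x \<in> U" and V: "(V, \<psi>) \<in> \<B>" "x \<in> V" by auto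
  note cU = smooth_atlas_chart[OF assms(1) U(1)] and cV = smooth_atlas_chart[OF assms(2) V(1)]
  define O' where "O' = {y \<in> \<psi> ` V. inv_into V \<psi> y \<in> U}"
  have tV: "topspace (subtopology (Euclidean_space m) (\<psi> ` V)) = \<psi> ` V"
    using openin_subset[OF cV(2)] by auto
  have O1: "openin (Euclidean_space m) O'"
    using openin_trans_full[OF openin_continuous_map_preimage[OF cV(5) cU(1)] cV(2)] unfolding tV O'_def .
  have "\<psi> x \<in> O'" using U(2) V(2) cV(3) by (simp add: O'_def)
  have O2: "O' \<subseteq> \<psi> ` V" by (auto simp: O'_def)
  define f where "f = \<phi> \<circ> inv_into V \<psi>"
  have "continuous_map (subtopology (Euclidean_space m) O') (subtopology X U) (inv_into V \<psi>)"
    unfolding continuous_map_in_subtopology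
    using continuous_map_from_subtopology_mono[OF cV(5) O2] by (auto simp: O'_def)
  from continuous_map_compose[OF this cU(4)]
  have cf: "continuous_map (subtopology (Euclidean_space m) O') (Euclidean_space n) f" unfolding f_def .
  \<comment> \<open>Read as a map into the larger space \<open>Euclidean_space m\<close>, the
    coordinate change falls under invariance of domain, although its image lies in
    \<open>vecs n\<close>.\<close>
  then have cf': "continuous_map (subtopology (Euclidean_space m) O') (Euclidean_space m) f"
    using nm unfolding Euclidean_space_def[of n] Euclidean_space_def[of m]
      continuous_map_in_subtopology[of _ "powertop_real UNIV"]
    by (elim conjE) (intro conjI; (assumption | force simp: Pi_iff))
  have "inj_on f O'"
  proof (rule inj_onI)
    fix y z assume yz: "y \<in> O'" "z \<in> O'" "f y = f z"
    then have "inv_into V \<psi> y = inv_into V \<psi> z" using cU(3) by (auto simp: f_def O'_def dest: inj_onD)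
    then show "y = z" using yz O2 by (metis f_inv_into_f subsetD)
  qed
  from invariance_of_domain_Euclidean_space[OF O1 cf' this]
  have fo: "openin (Euclidean_space m) (f ` O')" .
  have fv: "f ` O' \<subseteq> vecs n"
    using continuous_map_image_subset_topspace[OF cf] openin_subset[OF O1] by (simp add: Int_absorb1)
  define y where "y = f (\<psi> x)"
  have y: "y \<in> f ` O'" using \<open>\<psi> x \<in> O'\<close> by (simp add: y_def)
  from openin_Euclidean_norm1D[OF fo y] obtain d where d: "d > 0"
    "\<And>z. \<lbrakk>z \<in> vecs m; norm1 m (z - y) < d\<rbrakk> \<Longrightarrow> z \<in> f ` O'" by blast
  \<comment> \<open>A small step along coordinate \<open>n\<close> stays in the open image but
    leaves \<open>vecs n\<close>.\<close>
  let ?z = "y + (d / 2) *\<^sub>R axis_vec n"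
  have yn: "y n = 0" using y fv by (auto simp: vecs_def)
  have "?z \<in> f ` O'"
    using d(1) y openin_subset[OF fo] nm by (intro d(2)) auto
  then have "?z \<in> vecs n" using fv by blast
  then have "?z n = 0" by (simp add: vecs_def)
  then show False using yn d(1) by (simp add: axis_vec_def)
qed

lemma lie_dim_eq:
  assumes "lie_structure n G X \<A>"
  shows "lie_dim G X = n"
proof -
  have uniq: "m = n" if "lie_structure m G X \<B>" for m \<B>
  proof -
    have at: "smooth_atlas n X \<A>" "smooth_atlas m X \<B>" and tg: "topological_group G X"
      using assms that by (simp_all add: lie_structure_def)
    then have "\<one>\<^bsub>G\<^esub> \<in> topspace X"
      by (simp add: topological_group_def group.is_monoid monoid.one_closed)
    then show ?thesis using smooth_atlas_dim_le at by (metis le_antisym)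
  qed
  show ?thesis unfolding lie_dim_def
    by (rule the_equality) (use assms uniq in blast)+
qed

subsection \<open>Charts of quotients of vector groups\<close>

definition locally_affine :: "nat \<Rightarrow> (nat \<Rightarrow> real) set \<Rightarrow> ((nat \<Rightarrow> real) \<Rightarrow> real) \<Rightarrow> bool" where
  "locally_affine m S u \<longleftrightarrow> (\<forall>x\<in>S. \<exists>e>0. \<exists>b a. \<forall>y\<in>vecs m. norm1 m (y - x) < e \<longrightarrow> u y = b + (\<Sum>k<m. a k * y k))"

lemma affine_partial_deriv:
  assumes x: "x \<in> vecs m" and e: "e > 0" and i: "i < m"
    and u: "\<And>y. \<lbrakk>y \<in> vecs m; norm1 m (y - x) < e\<rbrakk> \<Longrightarrow> u y = b + (\<Sum>k<m. a k * y k)"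
  shows "((\<lambda>t. u (x(i := t))) has_field_derivative a i) (at (x i))"
proof (rule has_field_derivative_transform_within_open)
  show "((\<lambda>t. b + (\<Sum>k<m. a k * x k) + a i * (t - x i)) has_field_derivative a i) (at (x i))"
    by (auto intro!: derivative_eq_intros)
  show "open {x i - e<..<x i + e}" "x i \<in> {x i - e<..<x i + e}" using e by simp_all
  fix t assume t: "t \<in> {x i - e<..<x i + e}"
  define y where "y = x + (t - x i) *\<^sub>R axis_vec i"
  have y: "x(i := t) = y" by (auto simp: y_def axis_vec_def fun_eq_iff)
  have "u y = b + (\<Sum>k<m. a k * y k)"
  proof (rule u)
    show "y \<in> vecs m" using x i by (simp add: y_def)
    show "norm1 m (y - x) < e" using t i by (auto simp: y_def abs_less_iff)
  qed
  moreover have "(\<Sum>k<m. a k * y k) = (\<Sum>k<m. a k * x k) + (\<Sum>k<m. if k = i then a i * (t - x i) else 0)"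
    unfolding sum.distrib[symmetric] by (intro sum.cong) (auto simp: y_def axis_vec_def algebra_simps)
  ultimately show "b + (\<Sum>k<m. a k * x k) + a i * (t - x i) = u (x(i := t))"
    using i by (simp add: y)
qed

text \<open>Partial derivatives of a locally affine function are locally constant, hence again
  locally affine, so induction gives all orders. The group operations of a quotient look like this
  in the charts below.\<close>

lemma locally_affine_Ck_on:
  assumes "openin (Euclidean_space m) S" "locally_affine m S u"
  shows "Ck_on k m S u"
  using assms
proof (induction k arbitrary: u)
  have cont: "continuous_map (subtopology (Euclidean_space m) S) euclideanreal u"
    if S: "openin (Euclidean_space m) S" and u: "locally_affine m S u" for u
    unfolding continuous_map_def
  proof (intro conjI allI impI)
    fix T :: "real set" assume T: "openin euclideanreal T"
    have "openin (Euclidean_space m) {x \<in> S. u x \<in> T}"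
      unfolding openin_subopen[of _ "{x \<in> S. u x \<in> T}"]
    proof
      fix x assume x: "x \<in> {x \<in> S. u x \<in> T}"
      then obtain e b a where e: "e > 0"
        "\<forall>y\<in>vecs m. norm1 m (y - x) < e \<longrightarrow> u y = b + (\<Sum>k<m. a k * y k)"
        using u unfolding locally_affine_def by blast
      have xv: "x \<in> vecs m" using x openin_subset[OF S] by auto
      have "continuous_map (Euclidean_space m) euclideanreal (\<lambda>y. b + (\<Sum>k<m. a k * y k))"
        by (intro continuous_map_add continuous_map_sum continuous_map_real_mult
            continuous_map_Euclidean_component continuous_map_const[THEN iffD2]) auto
      from openin_continuous_map_preimage[OF this T]
      have "openin (Euclidean_space m) {y \<in> vecs m. b + (\<Sum>k<m. a k * y k) \<in> T}" by simp
      from openin_Int[OF openin_Int[OF this openin_norm1_ball[of m x e]] S]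
      show "\<exists>V. openin (Euclidean_space m) V \<and> x \<in> V \<and> V \<subseteq> {x \<in> S. u x \<in> T}"
        using e x xv by (intro exI[of _ "{y \<in> vecs m. b + (\<Sum>k<m. a k * y k) \<in> T} \<inter> {y \<in> vecs m. norm1 m (y - x) < e} \<inter> S"] conjI)
          auto
    qed
    then show "openin (subtopology (Euclidean_space m) S)
        {x \<in> topspace (subtopology (Euclidean_space m) S). u x \<in> T}"
      using openin_subset[OF S] S by (simp add: openin_open_subtopology Int_absorb1)
  qed simp
  {
    case 0
    then show ?case using cont by simp
  next
    case (Suc k)
    note S = Suc.prems(1)
    have aff: "(\<lambda>t. u (x(i := t))) field_differentiable at (x i) \<and>
        (\<exists>e>0. \<exists>b. \<forall>y\<in>vecs m. norm1 m (y - x) < e \<longrightarrow> partial_deriv i u y = b)"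
      if i: "i < m" and x: "x \<in> S" for i x
    proof -
      have xv: "x \<in> vecs m" using x openin_subset[OF S] by auto
      obtain e b a where e: "e > 0"
        "\<forall>y\<in>vecs m. norm1 m (y - x) < e \<longrightarrow> u y = b + (\<Sum>k<m. a k * y k)"
        using Suc.prems(2) x unfolding locally_affine_def by blast
      have der: "((\<lambda>t. u (y(i := t))) has_field_derivative a i) (at (y i))"
        if y: "y \<in> vecs m" "norm1 m (y - x) < e" for y
      proof (rule affine_partial_deriv[OF y(1) _ i])
        show "0 < e - norm1 m (y - x)" using y by simp
        show "u z = b + (\<Sum>k<m. a k * z k)" if "z \<in> vecs m" "norm1 m (z - y) < e - norm1 m (y - x)" for z
          using e(2) that norm1_diff_triangle[of m z x y] by simp
      qed
      have "(\<lambda>t. u (x(i := t))) field_differentiable at (x i)"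
        using der[OF xv] e(1) by (auto simp: field_differentiable_def)
      moreover have "\<forall>y\<in>vecs m. norm1 m (y - x) < e \<longrightarrow> partial_deriv i u y = a i"
        unfolding partial_deriv_def using DERIV_imp_deriv[OF der] by blast
      ultimately show ?thesis using e(1) by blast
    qed
    have "locally_affine m S (partial_deriv i u)" if i: "i < m" for i
      unfolding locally_affine_def
    proof
      fix x assume "x \<in> S"
      then obtain e b where "e > 0" "\<forall>y\<in>vecs m. norm1 m (y - x) < e \<longrightarrow> partial_deriv i u y = b"
        using aff[OF i] by blast
      then show "\<exists>e>0. \<exists>b a. \<forall>y\<in>vecs m. norm1 m (y - x) < e \<longrightarrow> partial_deriv i u y = b + (\<Sum>k<m. a k * y k)"
        by (intro exI[of _ e] conjI exI[of _ b] exI[of _ "\<lambda>_. 0"]) simp_all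
    qed
    then have "\<forall>i<m. Ck_on k m S (partial_deriv i u)" using Suc.IH[OF S] by blast
    moreover have "\<forall>i<m. \<forall>x\<in>S. (\<lambda>t. u (x(i := t))) field_differentiable at (x i)" using aff by blast
    ultimately show ?case using cont[OF Suc.prems] by simp
  }
qed

lemma join_exhaust:
  assumes "z \<in> vecs (n + m)"
  obtains x y where "x \<in> vecs n" "y \<in> vecs m" "z = join n x y"
  by (rule that[of "\<lambda>i. if i < n then z i else 0" "\<lambda>i. z (n + i)"])
    (use assms in \<open>auto simp: join_def vecs_def fun_eq_iff\<close>)

text \<open>The dimension of the torus is defined through charts, so an atlas has to be exhibited. A
  discrete kernel makes \<open>F\<close> injective on small balls, and the local inverses serve as
  charts.\<close>

locale discrete_cover = vector_cover +
  fixes \<sigma> :: real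
  assumes radius: "\<sigma> > 0" and discrete: "\<And>x. \<lbrakk>x \<in> vecs n; norm1 n x < \<sigma>; F x = \<one>\<^bsub>G\<^esub>\<rbrakk> \<Longrightarrow> x = 0"
begin

text \<open>With radius \<open>\<sigma> / 2\<close> two points of the ball differ by less than
  \<sigma>, so \<open>F\<close> is injective on it.\<close>

definition D :: "(nat \<Rightarrow> real) \<Rightarrow> (nat \<Rightarrow> real) set" where
  "D v = {x \<in> vecs n. norm1 n (x - v) < \<sigma> / 2}"

definition chart :: "(nat \<Rightarrow> real) \<Rightarrow> 'a \<Rightarrow> nat \<Rightarrow> real" where
  "chart v = inv_into (D v) F"

definition atlas :: "'a chart set" where
  "atlas = {(F ` D v, chart v) | v. v \<in> vecs n}"

lemma D_subset: "D v \<subseteq> vecs n" and D_open: "openin (Euclidean_space n) (D v)"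
  unfolding D_def by (blast, rule openin_norm1_ball)

lemma D_in_vecs: "x \<in> D v \<Longrightarrow> x \<in> vecs n"
  by (simp add: D_def)

lemma D_center: "v \<in> vecs n \<Longrightarrow> v \<in> D v"
  using radius by (simp add: D_def)

lemma F_inj: "inj_on F (D v)"
proof (rule inj_onI)
  fix x y assume "x \<in> D v" "y \<in> D v" "F x = F y"
  then have v: "x \<in> vecs n" "y \<in> vecs n" "x - y \<in> ker" and "norm1 n (x - y) < \<sigma>"
    using eq_iff_ker[of x y] norm1_diff_triangle[of n x y v] norm1_minus_commute[of n v y]
    by (auto simp: D_def)
  then have "x - y = 0" by (intro discrete) (simp_all add: ker_def)
  then show "x = y" by simp
qed

lemma chart_F [simp]: "x \<in> D v \<Longrightarrow> chart v (F x) = x"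
  by (simp add: chart_def F_inj)

lemma chart_in_D: "y \<in> F ` D v \<Longrightarrow> chart v y \<in> D v" and F_chart: "y \<in> F ` D v \<Longrightarrow> F (chart v y) = y"
  by (simp_all add: chart_def inv_into_into f_inv_into_f)

lemma chart_inj: "inj_on (chart v) (F ` D v)"
  by (metis F_chart inj_onI)

lemma inv_chart: "z \<in> D v \<Longrightarrow> inv_into (F ` D v) (chart v) z = F z"
  by (intro inv_into_f_eq chart_inj) auto

lemma chart_image: "chart v ` {x \<in> F ` D v. P x} = {z \<in> D v. P (F z)}"
proof (intro equalityI subsetI)
  fix z assume "z \<in> {z \<in> D v. P (F z)}"
  then show "z \<in> chart v ` {x \<in> F ` D v. P x}" by (intro image_eqI[of _ _ "F z"]) auto
qed auto

lemma chart_domain_open: "openin Y (F ` D v)"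
  using open_map D_open by (simp add: open_map_def)

lemma chart_homeomorphic:
  "homeomorphic_map (subtopology Y (F ` D v)) (subtopology (Euclidean_space n) (D v)) (chart v)"
proof -
  have top1: "topspace (subtopology Y (F ` D v)) = F ` D v"
    using openin_subset[OF chart_domain_open] by auto
  have top2: "topspace (subtopology (Euclidean_space n) (D v)) = D v"
    using D_subset by auto
  have "continuous_map (subtopology Y (F ` D v)) (Euclidean_space n) (chart v)"
    unfolding continuous_map_def top1
  proof (intro conjI allI impI)
    show "chart v \<in> F ` D v \<rightarrow> topspace (Euclidean_space n)" using D_in_vecs by auto
    fix V assume V: "openin (Euclidean_space n) V"
    have "{x \<in> F ` D v. chart v x \<in> V} = F ` (D v \<inter> V)" by (auto simp: image_iff)
    moreover have "openin Y (F ` (D v \<inter> V))"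
      using open_map openin_Int[OF D_open V] by (simp add: open_map_def)
    ultimately show "openin (subtopology Y (F ` D v)) {x \<in> F ` D v. chart v x \<in> V}"
      by (auto simp: openin_open_subtopology[OF chart_domain_open])
  qed
  moreover have "continuous_map (subtopology (Euclidean_space n) (D v)) (subtopology Y (F ` D v)) F"
    unfolding continuous_map_in_subtopology
    using continuous_map_from_subtopology[OF continuous] D_subset by auto
  ultimately have "homeomorphic_maps (subtopology Y (F ` D v)) (subtopology (Euclidean_space n) (D v)) (chart v) F"
    unfolding homeomorphic_maps_def top1 top2 continuous_map_in_subtopology
    using D_subset by auto
  then show ?thesis by (rule homeomorphic_maps_map[THEN iffD1, THEN conjunct1])
qed

text \<open>In charts the maps of interest lift to linear maps \<open>lft\<close>, so they agree locally with
  translates of \<open>lft\<close> by elements of the kernel.\<close>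

lemma chart_smooth_on:
  assumes D': "openin (Euclidean_space m) D'" and lft: "\<And>z. z \<in> vecs m \<Longrightarrow> lft z \<in> vecs n"
    and lip: "\<And>z z'. \<lbrakk>z \<in> vecs m; z' \<in> vecs m\<rbrakk> \<Longrightarrow> norm1 n (lft z - lft z') \<le> norm1 m (z - z')"
    and lin: "\<And>z j. \<lbrakk>z \<in> vecs m; j < n\<rbrakk> \<Longrightarrow> lft z j = (\<Sum>i<m. L j i * z i)"
    and h: "\<And>z. z \<in> D' \<Longrightarrow> h z = F (lft z)"
  shows "smooth_on m n {z \<in> D'. h z \<in> F ` D w} (chart w \<circ> h)"
proof -
  define S where "S = {z \<in> D'. h z \<in> F ` D w}"
  have D'v: "D' \<subseteq> vecs m" using openin_subset[OF D'] by simp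
  have loc: "\<exists>e>0. \<exists>t\<in>vecs n. \<forall>z\<in>vecs m. norm1 m (z - z0) < e \<longrightarrow> z \<in> S \<and> chart w (h z) = lft z + t"
    if z0: "z0 \<in> S" for z0
  proof -
    have z0': "z0 \<in> D'" "z0 \<in> vecs m" "h z0 \<in> F ` D w" "h z0 = F (lft z0)"
      using z0 D'v h by (auto simp: S_def)
    define y where "y = chart w (h z0)"
    have y: "y \<in> D w" "F y = F (lft z0)" "y \<in> vecs n"
      using chart_in_D[OF z0'(3)] F_chart[OF z0'(3)] z0'(4) D_subset by (auto simp: y_def)
    \<comment> \<open>A kernel element: translating the lift by it does not change the value of
      \<open>F\<close>, and near \<open>z0\<close> the translate stays in \<open>D w\<close>, so it
      is the chart value.\<close>
    define t where "t = y - lft z0"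
    have t: "t \<in> vecs n" "F t = \<one>\<^bsub>G\<^esub>"
      using eq_iff_ker[OF y(3) lft[OF z0'(2)]] y(2) by (simp_all add: t_def ker_def)
    obtain e1 where e1: "e1 > 0" "\<And>z. \<lbrakk>z \<in> vecs m; norm1 m (z - z0) < e1\<rbrakk> \<Longrightarrow> z \<in> D'"
      using openin_Euclidean_norm1D[OF D' z0'(1)] by blast
    obtain e2 where e2: "e2 > 0" "\<And>z. \<lbrakk>z \<in> vecs n; norm1 n (z - y) < e2\<rbrakk> \<Longrightarrow> z \<in> D w"
      using openin_Euclidean_norm1D[OF D_open y(1)] by blast
    have "z \<in> S \<and> chart w (h z) = lft z + t" if z: "z \<in> vecs m" "norm1 m (z - z0) < min e1 e2" for z
    proof -
      have zD: "z \<in> D'" using z by (intro e1(2)) simp_all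
      have "lft z + t - y = lft z - lft z0" by (simp add: t_def)
      then have "norm1 n (lft z + t - y) < e2" using lip[OF z(1) z0'(2)] z(2) by (simp only:)
      then have lt: "lft z + t \<in> D w" using lft[OF z(1)] t(1) by (intro e2(2)) simp_all
      have "F (lft z + t) = F (lft z) \<otimes>\<^bsub>G\<^esub> \<one>\<^bsub>G\<^esub>" using add[OF lft[OF z(1)] t(1)] t(2) by simp
      also have "\<dots> = h z"
        using h[OF zD] closed[OF lft[OF z(1)]] group.is_monoid[OF group] by (simp add: monoid.r_one)
      finally have "F (lft z + t) = h z" .
      then show ?thesis using zD lt chart_F[OF lt] by (auto simp: S_def intro: rev_image_eqI)
    qed
    then show ?thesis using t(1) e1(1) e2(1) by (intro exI[of _ "min e1 e2"] conjI bexI[of _ t]) simp_all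
  qed
  have S: "openin (Euclidean_space m) S"
    unfolding openin_Euclidean_norm1
  proof (intro conjI ballI)
    show "S \<subseteq> vecs m" using D'v by (auto simp: S_def)
    fix z0 assume "z0 \<in> S"
    from loc[OF this] show "\<exists>e>0. \<forall>z\<in>vecs m. norm1 m (z - z0) < e \<longrightarrow> z \<in> S" by blast
  qed
  have "locally_affine m S (\<lambda>z. chart w (h z) j)" if j: "j < n" for j
    unfolding locally_affine_def
  proof
    fix z0 assume "z0 \<in> S"
    from loc[OF this] obtain e t where e: "e > 0"
      "\<forall>z\<in>vecs m. norm1 m (z - z0) < e \<longrightarrow> z \<in> S \<and> chart w (h z) = lft z + t" by blast
    have "chart w (h z) j = t j + (\<Sum>k<m. L j k * z k)" if "z \<in> vecs m" "norm1 m (z - z0) < e" for z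
      using e(2) that lin[OF that(1) j] by simp
    then show "\<exists>e>0. \<exists>b a. \<forall>y\<in>vecs m. norm1 m (y - z0) < e \<longrightarrow> chart w (h y) j = b + (\<Sum>k<m. a k * y k)"
      using e(1) by (intro exI[of _ e] conjI exI[of _ "t j"] exI[of _ "L j"]) simp_all
  qed
  then have "Ck_on k m S (\<lambda>z. chart w (h z) j)" if "j < n" for j k
    using locally_affine_Ck_on[OF S] that by blast
  moreover have "chart w (h z) \<in> vecs n" if "z \<in> S" for z
    using chart_in_D[of "h z" w] D_subset that by (auto simp: S_def)
  ultimately have "smooth_on m n S (chart w \<circ> h)" using S by (auto simp: smooth_on_def)
  then show ?thesis unfolding S_def .
qed

lemma smooth_atlas_atlas: "smooth_atlas n Y atlas"
  unfolding smooth_atlas_def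
proof (intro conjI)
  show "(\<Union>(U, \<phi>)\<in>atlas. U) = topspace Y"
  proof
    show "(\<Union>(U, \<phi>)\<in>atlas. U) \<subseteq> topspace Y"
      unfolding atlas_def using closed D_subset topspace_eq by auto
    show "topspace Y \<subseteq> (\<Union>(U, \<phi>)\<in>atlas. U)"
    proof
      fix y assume "y \<in> topspace Y"
      then obtain v where v: "v \<in> vecs n" "y = F v" using surjective topspace_eq by auto
      then have "(F ` D v, chart v) \<in> atlas" "y \<in> F ` D v" using D_center by (auto simp: atlas_def)
      then show "y \<in> (\<Union>(U, \<phi>)\<in>atlas. U)" by blast
    qed
  qed
  have im: "chart v ` F ` D v = D v" for v using chart_image[of v "\<lambda>_. True"] by simp
  show "\<forall>(U, \<phi>)\<in>atlas. openin Y U \<and> openin (Euclidean_space n) (\<phi> ` U) \<and>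
        homeomorphic_map (subtopology Y U) (subtopology (Euclidean_space n) (\<phi> ` U)) \<phi>"
    unfolding atlas_def using chart_domain_open D_open chart_homeomorphic by (auto simp: im)
  show "smooth_map n atlas n atlas (\<lambda>x. x)"
    unfolding smooth_map_def
  proof (intro ballI, clarify)
    fix U \<phi> V \<psi> assume "(U, \<phi>) \<in> atlas" "(V, \<psi>) \<in> atlas"
    then obtain v w where eq: "U = F ` D v" "\<phi> = chart v" "V = F ` D w" "\<psi> = chart w"
      by (auto simp: atlas_def)
    have "smooth_on n n {z \<in> D v. (inv_into (F ` D v) (chart v)) z \<in> F ` D w} (chart w \<circ> inv_into (F ` D v) (chart v))"
    proof (rule chart_smooth_on[OF D_open, where lft = "\<lambda>z. z" and L = axis_vec])
      show "z j = (\<Sum>i<n. axis_vec j i * z i)" if "z \<in> vecs n" "j < n" for z j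
      proof -
        have "(\<Sum>i<n. axis_vec j i * z i) = (\<Sum>i<n. if i = j then z i else 0)"
          by (intro sum.cong) (auto simp: axis_vec_def)
        then show ?thesis using that by simp
      qed
    qed (simp_all add: inv_chart)
    moreover have "{z \<in> D v. (inv_into (F ` D v) (chart v)) z \<in> F ` D w} = chart v ` {x \<in> F ` D v. x \<in> F ` D w}"
      unfolding chart_image by (auto simp: inv_chart)
    ultimately show "smooth_on n n (\<phi> ` {x \<in> U. x \<in> V}) (\<psi> \<circ> (\<lambda>x. x) \<circ> inv_into U \<phi>)"
      by (simp add: eq o_def)
  qed
qed

lemma smooth_inverse: "smooth_map n atlas n atlas (\<lambda>x. inv\<^bsub>G\<^esub> x)"
  unfolding smooth_map_def
proof (intro ballI, clarify)
  fix U \<phi> V \<psi> assume "(U, \<phi>) \<in> atlas" "(V, \<psi>) \<in> atlas"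
  then obtain v w where eq: "U = F ` D v" "\<phi> = chart v" "V = F ` D w" "\<psi> = chart w"
    by (auto simp: atlas_def)
  let ?h = "\<lambda>z. inv\<^bsub>G\<^esub> (inv_into (F ` D v) (chart v) z)"
  have hF: "?h z = F (- z)" if "z \<in> D v" for z
    using inv_chart[OF that] minus[OF D_in_vecs[OF that]] by simp
  have "smooth_on n n {z \<in> D v. ?h z \<in> F ` D w} (chart w \<circ> ?h)"
  proof (rule chart_smooth_on[OF D_open _ _ _ hF, where L = "\<lambda>j. - axis_vec j"])
    show "(- z) j = (\<Sum>i<n. (- axis_vec j) i * z i)" if "z \<in> vecs n" "j < n" for z j
    proof -
      have "(\<Sum>i<n. (- axis_vec j) i * z i) = (\<Sum>i<n. if i = j then - z i else 0)"
        by (intro sum.cong) (auto simp: axis_vec_def)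
      then show ?thesis using that by simp
    qed
    show "norm1 n (- z - - z') \<le> norm1 n (z - z')" for z z'
      by (simp add: norm1_minus_commute)
  qed simp_all
  moreover have "{z \<in> D v. ?h z \<in> F ` D w} = chart v ` {x \<in> F ` D v. inv\<^bsub>G\<^esub> x \<in> F ` D w}"
    unfolding chart_image by (auto simp: inv_chart)
  ultimately show "smooth_on n n (\<phi> ` {x \<in> U. inv\<^bsub>G\<^esub> x \<in> V}) (\<psi> \<circ> (\<lambda>x. inv\<^bsub>G\<^esub> x) \<circ> inv_into U \<phi>)"
    by (simp add: eq o_def)
qed

lemma smooth_product: "smooth_map (n + n) (prod_atlas n atlas atlas) n atlas (\<lambda>(x, y). x \<otimes>\<^bsub>G\<^esub> y)"
  unfolding smooth_map_def
proof (intro ballI, clarify)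
  fix P \<Phi> V \<psi> assume "(P, \<Phi>) \<in> prod_atlas n atlas atlas" "(V, \<psi>) \<in> atlas"
  then obtain v v' w where P: "P = F ` D v \<times> F ` D v'"
    and \<Phi>: "\<Phi> = (\<lambda>(x, y) i. if i < n then chart v x i else chart v' y (i - n))"
    and eq: "V = F ` D w" "\<psi> = chart w"
    unfolding prod_atlas_def atlas_def by auto
  have \<Phi>j: "\<Phi> (x, y) = join n (chart v x) (chart v' y)" for x y
    by (auto simp: \<Phi> join_def)
  define D' where "D' = {join n a b | a b. a \<in> D v \<and> b \<in> D v'}"
  let ?f = "\<lambda>(x, y). x \<otimes>\<^bsub>G\<^esub> y"
  define h where "h = ?f \<circ> inv_into P \<Phi>"
  \<comment> \<open>Multiplication lifts to the sum of the two halves of a joined vector.\<close>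
  define lft where "lft z i = (if i < n then z i + z (n + i) else 0 :: real)" for z i
  have lftj: "lft (join n a b) = a + b" if "a \<in> vecs n" "b \<in> vecs n" for a b
    using that by (auto simp: lft_def join_def vecs_def fun_eq_iff)
  have inj: "inj_on \<Phi> P"
  proof (rule inj_onI, clarify)
    fix x y x' y' assume xy: "(x, y) \<in> P" "(x', y') \<in> P" "\<Phi> (x, y) = \<Phi> (x', y')"
    then have m: "x \<in> F ` D v" "y \<in> F ` D v'" "x' \<in> F ` D v" "y' \<in> F ` D v'" by (simp_all add: P)
    have "chart v x = chart v x'" "chart v' y = chart v' y'"
      using join_inject[OF xy(3)[unfolded \<Phi>j]] m chart_in_D D_subset by blast+
    then show "x = x' \<and> y = y'" using F_chart m by metis
  qed
  have inv: "inv_into P \<Phi> (join n a b) = (F a, F b)" if "a \<in> D v" "b \<in> D v'" for a b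
    using that by (intro inv_into_f_eq inj) (simp_all add: P \<Phi>j)
  have hF: "h z = F (lft z)" if "z \<in> D'" for z
  proof -
    obtain a b where ab: "a \<in> D v" "b \<in> D v'" "z = join n a b" using \<open>z \<in> D'\<close> by (auto simp: D'_def)
    then have "a \<in> vecs n" "b \<in> vecs n" using D_subset by blast+
    then show ?thesis using add[of a b] ab inv lftj by (simp add: h_def)
  qed
  have D': "openin (Euclidean_space (n + n)) D'"
    unfolding openin_Euclidean_norm1
  proof (intro conjI ballI)
    show "D' \<subseteq> vecs (n + n)" by (auto simp: D'_def intro!: join_in_vecs dest: D_in_vecs)
    fix z assume "z \<in> D'"
    then obtain a b where ab: "a \<in> D v" "b \<in> D v'" "z = join n a b" by (auto simp: D'_def)
    obtain e1 where e1: "e1 > 0" "\<And>x. \<lbrakk>x \<in> vecs n; norm1 n (x - a) < e1\<rbrakk> \<Longrightarrow> x \<in> D v"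
      using openin_Euclidean_norm1D[OF D_open ab(1)] by blast
    obtain e2 where e2: "e2 > 0" "\<And>x. \<lbrakk>x \<in> vecs n; norm1 n (x - b) < e2\<rbrakk> \<Longrightarrow> x \<in> D v'"
      using openin_Euclidean_norm1D[OF D_open ab(2)] by blast
    have "y \<in> D'" if y: "y \<in> vecs (n + n)" "norm1 (n + n) (y - z) < min e1 e2" for y
    proof -
      obtain p q where pq: "p \<in> vecs n" "q \<in> vecs n" "y = join n p q" using join_exhaust[OF y(1)] .
      have "norm1 n (p - a) + norm1 n (q - b) < min e1 e2"
        using y(2) unfolding pq(3) ab(3) join_diff norm1_join .
      then have "p \<in> D v" "q \<in> D v'"
        using norm1_nonneg[of n "p - a"] norm1_nonneg[of n "q - b"] e1(2)[OF pq(1)] e2(2)[OF pq(2)] by linarith+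
      then show ?thesis using pq(3) by (auto simp: D'_def)
    qed
    then show "\<exists>e>0. \<forall>y\<in>vecs (n + n). norm1 (n + n) (y - z) < e \<longrightarrow> y \<in> D'"
      using e1(1) e2(1) by (intro exI[of _ "min e1 e2"]) simp
  qed
  have "smooth_on (n + n) n {z \<in> D'. h z \<in> F ` D w} (chart w \<circ> h)"
  proof (rule chart_smooth_on[OF D' _ _ _ hF, where L = "\<lambda>j i. if i = j \<or> i = n + j then 1 else 0"])
    show "lft z \<in> vecs n" for z by (simp add: lft_def vecs_def)
    show "norm1 n (lft z - lft z') \<le> norm1 (n + n) (z - z')" for z z'
      unfolding norm1_def sum_lessThan_add sum.distrib[symmetric]
      by (intro sum_mono) (auto simp: lft_def)
    show "lft z j = (\<Sum>i<n + n. (if i = j \<or> i = n + j then 1 else 0) * z i)" if "j < n" for z j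
    proof -
      have "(\<Sum>i<n. (if i = j \<or> i = n + j then 1 else 0) * z i) = (\<Sum>i<n. if i = j then z i else 0)"
        by (intro sum.cong) auto
      moreover have "(\<Sum>i<n. (if n + i = j \<or> n + i = n + j then 1 else 0) * z (n + i)) = (\<Sum>i<n. if i = j then z (n + i) else 0)"
        using that by (intro sum.cong) auto
      ultimately show ?thesis using that by (simp add: sum_lessThan_add lft_def)
    qed
  qed
  moreover have "{z \<in> D'. h z \<in> F ` D w} = \<Phi> ` {q \<in> P. ?f q \<in> V}"
  proof (intro equalityI subsetI)
    fix z assume "z \<in> {z \<in> D'. h z \<in> F ` D w}"
    then obtain a b where ab: "a \<in> D v" "b \<in> D v'" "z = join n a b" "h z \<in> F ` D w" by (auto simp: D'_def)
    then have "z = \<Phi> (F a, F b)" "(F a, F b) \<in> P" "?f (F a, F b) \<in> V"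
      using inv by (simp_all add: \<Phi>j P eq h_def)
    then show "z \<in> \<Phi> ` {q \<in> P. ?f q \<in> V}" by blast
  next
    fix z assume "z \<in> \<Phi> ` {q \<in> P. ?f q \<in> V}"
    then obtain a b where ab: "a \<in> D v" "b \<in> D v'" "z = \<Phi> (F a, F b)" "?f (F a, F b) \<in> V" by (auto simp: P)
    then have "z = join n a b" by (simp add: \<Phi>j)
    then show "z \<in> {z \<in> D'. h z \<in> F ` D w}" using ab inv by (auto simp: D'_def h_def eq)
  qed
  ultimately show "smooth_on (n + n) n (\<Phi> ` {q \<in> P. ?f q \<in> V}) (\<psi> \<circ> ?f \<circ> inv_into P \<Phi>)"
    by (simp add: eq h_def o_assoc)
qed

lemma lie_structure_atlas:
  assumes "Hausdorff_space Y" "second_countable Y"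
  shows "lie_structure n G Y atlas"
  unfolding lie_structure_def
  using assms topological_group smooth_atlas_atlas smooth_product smooth_inverse by simp

end

subsection \<open>The maximal torus\<close>

lemma coordinates_independent:
  assumes "coordinates n B c"
  shows "independent B"
  unfolding dependent_finite[OF coordinatesD(1)[OF assms]]
proof safe
  fix u v assume 0: "(\<Sum>v\<in>B. u v *\<^sub>R v) = 0" and v: "v \<in> B" "u v \<noteq> 0"
  have "u v = c v (\<Sum>v\<in>B. u v *\<^sub>R v)" using coordinates_sum[OF assms subset_refl v(1), of u] v(1) by simp
  also have "\<dots> = 0" unfolding 0 using coordinatesD(4)[OF assms v(1)] by (rule linear_0)
  finally show False using v(2) by simp
qed

lemma lipschitz_continuous_map:
  assumes f: "\<And>x. x \<in> vecs m \<Longrightarrow> f x \<in> vecs n" and K: "K > 0"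
    and lip: "\<And>x y. \<lbrakk>x \<in> vecs m; y \<in> vecs m\<rbrakk> \<Longrightarrow> norm1 n (f x - f y) \<le> K * norm1 m (x - y)"
  shows "continuous_map (Euclidean_space m) (Euclidean_space n) f"
  unfolding continuous_map_def topspace_Euclidean_vecs
proof (intro conjI allI impI)
  show "f \<in> vecs m \<rightarrow> vecs n" using f by blast
  fix V assume V: "openin (Euclidean_space n) V"
  show "openin (Euclidean_space m) {x \<in> vecs m. f x \<in> V}"
    unfolding openin_Euclidean_norm1
  proof (intro conjI ballI)
    fix x assume x: "x \<in> {x \<in> vecs m. f x \<in> V}"
    then have "f x \<in> V" by simp
    from openin_Euclidean_norm1D[OF V this] obtain e where e: "e > 0"
      "\<And>y. \<lbrakk>y \<in> vecs n; norm1 n (y - f x) < e\<rbrakk> \<Longrightarrow> y \<in> V" by blast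
    have "y \<in> {x \<in> vecs m. f x \<in> V}" if y: "y \<in> vecs m" "norm1 m (y - x) < e / K" for y
    proof -
      have "K * norm1 m (y - x) < e" using y(2) K by (simp add: field_simps)
      moreover have "norm1 n (f y - f x) \<le> K * norm1 m (y - x)" using y x by (intro lip) simp_all
      ultimately have "norm1 n (f y - f x) < e" by linarith
      then show ?thesis using e(2)[OF f[OF y(1)]] y(1) by simp
    qed
    then show "\<exists>e>0. \<forall>y\<in>vecs m. norm1 m (y - x) < e \<longrightarrow> y \<in> {x \<in> vecs m. f x \<in> V}"
      using e(1) K by (intro exI[of _ "e / K"]) simp
  qed simp
qed

definition sup_ball :: "nat \<Rightarrow> real \<Rightarrow> (nat \<Rightarrow> real) set" where
  "sup_ball n R = {x \<in> vecs n. \<forall>i<n. \<bar>x i\<bar> \<le> R}"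

lemma compactin_sup_ball: "compactin (Euclidean_space n) (sup_ball n R)"
proof (cases "R \<ge> 0")
  case True
  have "compactin (powertop_real UNIV) (\<Pi>\<^sub>E i\<in>UNIV. if i < n then {-R..R} else {0})"
    unfolding compactin_PiE by simp
  moreover have "(\<Pi>\<^sub>E i\<in>UNIV. if i < n then {-R..R} else {0}) = sup_ball n R"
  proof (intro equalityI subsetI)
    fix x assume x: "x \<in> (\<Pi>\<^sub>E i\<in>UNIV. if i < n then {-R..R} else {0})"
    then have h: "x i \<in> (if i < n then {-R..R} else {0})" for i by (auto simp: PiE_iff)
    show "x \<in> sup_ball n R" unfolding sup_ball_def vecs_def
    proof (safe)
      fix i show "n \<le> i \<Longrightarrow> x i = 0" using h[of i] by simp
      show "i < n \<Longrightarrow> \<bar>x i\<bar> \<le> R" using h[of i] by (auto simp: abs_le_iff)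
    qed
  next
    fix x assume "x \<in> sup_ball n R"
    then show "x \<in> (\<Pi>\<^sub>E i\<in>UNIV. if i < n then {-R..R} else {0})"
      by (auto simp: sup_ball_def vecs_def PiE_iff abs_le_iff minus_le_iff)
  qed
  ultimately show ?thesis
    unfolding Euclidean_space_def compactin_subtopology by (auto simp: sup_ball_def vecs_def)
next
  case False
  show ?thesis
  proof (cases "n = 0")
    case True
    then have "sup_ball n R \<subseteq> {0}" by (auto simp: sup_ball_def vecs_def fun_eq_iff)
    then have "finite (sup_ball n R)" by (rule finite_subset) simp
    then show ?thesis by (intro finite_imp_compactin) (auto simp: sup_ball_def)
  next
    case n: False
    then have "sup_ball n R = {}" using False by (auto simp: sup_ball_def not_le intro!: exI[of _ 0])
    then show ?thesis by simp
  qed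
qed

lemma closedin_coordinate_kernel:
  assumes "finite B" "\<And>b. b \<in> B \<Longrightarrow> linear (c b :: (nat \<Rightarrow> real) \<Rightarrow> real)"
  shows "closedin (Euclidean_space n) {x \<in> vecs n. \<forall>b\<in>B. c b x = 0}"
proof (cases "B = {}")
  case True
  then show ?thesis using closedin_topspace[of "Euclidean_space n"] by simp
next
  case False
  have "closedin (Euclidean_space n) {x \<in> vecs n. c b x = 0}" if "b \<in> B" for b
    using closedin_continuous_map_preimage[OF continuous_map_linear[OF assms(2)[OF that], of n], of "{0}"] by simp
  then have "closedin (Euclidean_space n) (\<Inter>b\<in>B. {x \<in> vecs n. c b x = 0})"
    using False by (intro closedin_Inter) auto
  moreover have "(\<Inter>b\<in>B. {x \<in> vecs n. c b x = 0}) = {x \<in> vecs n. \<forall>b\<in>B. c b x = 0}"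
    using False by auto
  ultimately show ?thesis by simp
qed

lemma topological_group_subgroup:
  assumes tg: "topological_group G X" and T: "subgroup T G"
  shows "topological_group (G\<lparr>carrier := T\<rparr>) (subtopology X T)"
proof -
  interpret group G using tg by (simp add: topological_group_def)
  have top: "topspace X = carrier G" using tg by (simp add: topological_group_def)
  have TG: "T \<subseteq> carrier G" using T by (rule subgroup.subset)
  have "continuous_map (prod_topology (subtopology X T) (subtopology X T)) X (\<lambda>(x, y). x \<otimes>\<^bsub>G\<^esub> y)"
    unfolding prod_topology_subtopology(1) prod_topology_subtopology(2)
    using tg by (intro continuous_map_from_subtopology) (simp add: topological_group_def)
  moreover have "continuous_map (subtopology X T) X (\<lambda>x. inv\<^bsub>G\<^esub> x)"
    using tg by (intro continuous_map_from_subtopology) (simp add: topological_group_def)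
  then have "continuous_map (subtopology X T) X (\<lambda>x. inv\<^bsub>G\<lparr>carrier := T\<rparr>\<^esub> x)"
    by (rule continuous_map_eq) (simp add: m_inv_consistent[OF T])
  moreover have "inv\<^bsub>G\<lparr>carrier := T\<rparr>\<^esub> x \<in> T" if "x \<in> T" for x
    using that m_inv_consistent[OF T that] subgroup.m_inv_closed[OF T that] by simp
  ultimately show ?thesis
    unfolding topological_group_def continuous_map_in_subtopology
    using subgroup_imp_group[OF T] top TG subgroup.m_closed[OF T] by auto
qed

context discrete_cover
begin

text \<open>A line in the kernel would contain arbitrarily short nonzero vectors, so the subspace
  part of the adapted basis is empty.\<close>

lemma kernel_basis:
  assumes "Hausdorff_space Y"
  obtains BG BS c and k :: nat where "coordinates n (BG \<union> BS) c" "BG \<inter> BS = {}" "BG \<subseteq> ker" "k > 0"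
    "\<And>v b. \<lbrakk>v \<in> ker; b \<in> BS\<rbrakk> \<Longrightarrow> c b v = 0" "\<And>v b. \<lbrakk>v \<in> ker; b \<in> BG\<rbrakk> \<Longrightarrow> real k * c b v \<in> \<int>"
proof -
  have "additive_subgroup {0 :: nat \<Rightarrow> real}" "{0} \<subseteq> ker"
    using additive_subgroup_simps(1)[OF additive_subgroup_ker] by (simp_all add: additive_subgroup_def)
  from closed_subgroup_basis[OF additive_subgroup_ker ker_subset seq_closed_ker[OF assms] this]
  obtain BW BG BS Q c and k :: nat where
    co: "coordinates n (BW \<union> BG \<union> BS) c" and dis: "BW \<inter> BG = {}" "(BW \<union> BG) \<inter> BS = {}"
    and BW: "\<And>b t. b \<in> BW \<Longrightarrow> t *\<^sub>R b \<in> ker" and BG: "BG \<subseteq> ker" and k: "k > 0"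
    and cS: "\<And>v b. \<lbrakk>v \<in> ker; b \<in> BS\<rbrakk> \<Longrightarrow> c b v = 0"
    and cG: "\<And>v b. \<lbrakk>v \<in> ker; b \<in> BG\<rbrakk> \<Longrightarrow> real k * c b v \<in> \<int>"
    by (metis (no_types, lifting))
  have "BW = {}"
  proof (rule ccontr)
    assume "BW \<noteq> {}"
    then obtain b where b: "b \<in> BW" by blast
    then have bB: "b \<in> BW \<union> BG \<union> BS" by blast
    define t where "t = \<sigma> / (2 * (1 + norm1 n b))"
    have np: "1 + norm1 n b > 0" by (simp add: add_pos_nonneg)
    have t: "t > 0" using np radius by (simp add: t_def)
    have "norm1 n (t *\<^sub>R b) = t * norm1 n b" using t by simp
    also have "\<dots> \<le> t * (1 + norm1 n b)" using t by (intro mult_left_mono) auto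
    also have "\<dots> = \<sigma> / 2" using np by (simp add: t_def field_simps)
    also have "\<dots> < \<sigma>" using radius by simp
    finally have "norm1 n (t *\<^sub>R b) < \<sigma>" .
    then have "t *\<^sub>R b = 0" using BW[OF b, of t] by (intro discrete) (simp_all add: ker_def)
    then have "b = 0" using t by simp
    then have "c b b = 0" using coordinatesD(4)[OF co bB] by (simp add: linear_0)
    then show False using coordinatesD(5)[OF co bB bB] by simp
  qed
  then have un: "BW \<union> BG \<union> BS = BG \<union> BS" and dis': "BG \<inter> BS = {}" using dis by auto
  show ?thesis by (rule that[OF co[unfolded un] dis' BG k cS cG])
qed

end

text \<open>\<open>BG\<close> and the kernel span the same subspace, and \<open>BS\<close> spans a
  complement, so \<open>card BG\<close> and \<open>card BS\<close> are the numbers \<open>b\<close>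
  and \<open>a\<close> of the overview.\<close>

locale kernel_coordinates = discrete_cover +
  fixes BG BS :: "(nat \<Rightarrow> real) set" and c :: "(nat \<Rightarrow> real) \<Rightarrow> (nat \<Rightarrow> real) \<Rightarrow> real" and k :: nat
  assumes comm: "comm_group G"
    and co: "coordinates n (BG \<union> BS) c" and BGS: "BG \<inter> BS = {}" and BG: "BG \<subseteq> ker" and k: "k > 0"
    and kerS: "\<And>v b. \<lbrakk>v \<in> ker; b \<in> BS\<rbrakk> \<Longrightarrow> c b v = 0"
    and kerG: "\<And>v b. \<lbrakk>v \<in> ker; b \<in> BG\<rbrakk> \<Longrightarrow> real k * c b v \<in> \<int>"
begin

lemma fin: "finite BG" "finite BS"
  using coordinatesD(1)[OF co] by auto

lemma card_sum: "card BG + card BS = n"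
  using coordinatesD(2)[OF co] card_Un_disjoint[OF fin BGS] by simp

lemma linear_c: "b \<in> BG \<union> BS \<Longrightarrow> linear (c b)"
  by (rule coordinatesD(4)[OF co])

lemma basis_in_vecs: "b \<in> BG \<union> BS \<Longrightarrow> b \<in> vecs n"
  using coordinatesD(3)[OF co] by blast

section \<open>The torus covered by the span of the kernel\<close>

definition torus_lift :: "(nat \<Rightarrow> real) set" where
  "torus_lift = {x \<in> vecs n. \<forall>b\<in>BS. c b x = 0}"

definition torus :: "'a set" where
  "torus = F ` torus_lift"

lemma ker_torus_lift: "ker \<subseteq> torus_lift"
  using kerS ker_subset by (auto simp: torus_lift_def)

lemma torus_lift_preimage:
  assumes "x \<in> vecs n" "F x \<in> torus"
  shows "x \<in> torus_lift"
proof -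
  obtain y where y: "y \<in> torus_lift" "F x = F y" using assms(2) by (auto simp: torus_def)
  then have yv: "y \<in> vecs n" by (simp add: torus_lift_def)
  have "x - y \<in> ker" using eq_iff_ker[OF assms(1) yv] y(2) by simp
  then have "c b (x - y) = 0" if "b \<in> BS" for b using kerS that by blast
  then show ?thesis using y(1) assms(1) linear_c by (simp add: torus_lift_def linear_diff)
qed

lemma torus_lift_expansion:
  assumes "x \<in> torus_lift"
  shows "x = (\<Sum>b\<in>BG. c b x *\<^sub>R b)"
proof -
  have "x \<in> vecs n" using assms by (simp add: torus_lift_def)
  then have "x = (\<Sum>b\<in>BG \<union> BS. c b x *\<^sub>R b)" by (rule coordinatesD(6)[OF co])
  also have "\<dots> = (\<Sum>b\<in>BG. c b x *\<^sub>R b)"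
    using assms fin by (intro sum.mono_neutral_right) (auto simp: torus_lift_def)
  finally show ?thesis .
qed

lemma sum_in_torus_lift: "(\<Sum>b\<in>BG. t b *\<^sub>R b) \<in> torus_lift"
proof -
  have "(\<Sum>b\<in>BG. t b *\<^sub>R b) \<in> vecs n"
    using basis_in_vecs by (intro subspace_sum[OF subspace_vecs] subspace_scale[OF subspace_vecs]) auto
  moreover have "c d (\<Sum>b\<in>BG. t b *\<^sub>R b) = 0" if "d \<in> BS" for d
    using coordinates_sum[OF co, of BG d t] that BGS by auto
  ultimately show ?thesis by (simp add: torus_lift_def)
qed

lemma subgroup_torus: "subgroup torus G"
proof (rule group.subgroupI[OF group])
  show "torus \<subseteq> carrier G" using closed by (auto simp: torus_def torus_lift_def)
  have "0 \<in> torus_lift" using sum_in_torus_lift[of "\<lambda>_. 0"] by simp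
  then show "torus \<noteq> {}" by (auto simp: torus_def)
  fix a b assume "a \<in> torus" "b \<in> torus"
  then obtain x y where x: "x \<in> torus_lift" "a = F x" and y: "y \<in> torus_lift" "b = F y"
    by (auto simp: torus_def)
  have xy: "x \<in> vecs n" "y \<in> vecs n" using x y by (simp_all add: torus_lift_def)
  have "- x \<in> torus_lift" "x + y \<in> torus_lift"
    using x(1) y(1) linear_c by (simp_all add: torus_lift_def linear_neg linear_add)
  then have "F (- x) \<in> torus" "F (x + y) \<in> torus" by (simp_all add: torus_def)
  then show "inv\<^bsub>G\<^esub> a \<in> torus" "a \<otimes>\<^bsub>G\<^esub> b \<in> torus"
    using minus[OF xy(1)] add[OF xy] x(2) y(2) by simp_all
qed

text \<open>As \<open>BG\<close> lies in the kernel, coordinates can be reduced to their fractional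
  parts, so a closed bounded part of \<open>torus_lift\<close> already covers the torus.\<close>

lemma compactin_torus: "compactin Y torus"
proof -
  define R where "R = (\<Sum>b\<in>BG. norm1 n b)"
  have "torus \<subseteq> F ` (torus_lift \<inter> sup_ball n R)"
  proof
    fix a assume "a \<in> torus"
    then obtain x where x: "x \<in> torus_lift" "a = F x" by (auto simp: torus_def)
    define y where "y = (\<Sum>b\<in>BG. frac (c b x) *\<^sub>R b)"
    have y: "y \<in> torus_lift" unfolding y_def by (rule sum_in_torus_lift)
    have v: "x \<in> vecs n" "y \<in> vecs n" using x(1) y by (simp_all add: torus_lift_def)
    have "y \<in> sup_ball n R"
      unfolding sup_ball_def
    proof (safe intro!: v(2))
      fix i assume i: "i < n"
      have "\<bar>y i\<bar> \<le> (\<Sum>b\<in>BG. \<bar>frac (c b x) * b i\<bar>)" by (simp add: y_def sum_abs)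
      also have "\<dots> \<le> (\<Sum>b\<in>BG. 1 * norm1 n b)"
        unfolding abs_mult using component_le_norm1[OF i]
        by (intro sum_mono mult_mono) (auto simp: abs_le_iff frac_ge_0 less_imp_le[OF frac_lt_1] intro: order.trans[of "- 1" 0])
      finally show "\<bar>y i\<bar> \<le> R" by (simp add: R_def)
    qed
    moreover have "x - y \<in> ker"
    proof -
      have "x - y = (\<Sum>b\<in>BG. c b x *\<^sub>R b) - y" using torus_lift_expansion[OF x(1)] by argo
      also have "\<dots> = (\<Sum>b\<in>BG. of_int \<lfloor>c b x\<rfloor> *\<^sub>R b)"
        by (simp add: y_def frac_def scaleR_diff_left flip: sum_subtractf)
      also have "\<dots> \<in> ker"
        using BG by (intro additive_subgroup_sum additive_subgroup_int additive_subgroup_ker) auto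
      finally show ?thesis .
    qed
    ultimately show "a \<in> F ` (torus_lift \<inter> sup_ball n R)"
      using eq_iff_ker[OF v] x(2) y by blast
  qed
  then have eq: "torus = F ` (torus_lift \<inter> sup_ball n R)" by (auto simp: torus_def)
  have "closedin (Euclidean_space n) torus_lift"
    unfolding torus_lift_def using fin linear_c by (intro closedin_coordinate_kernel) auto
  from image_compactin[OF closed_Int_compactin[OF this compactin_sup_ball] continuous]
  show ?thesis unfolding eq .
qed

text \<open>A coordinate in \<open>BS\<close> induces a homomorphism to the reals, which is bounded on compact
  subgroups and hence vanishes there.\<close>

lemma compact_subgroup_in_torus:
  assumes K: "subgroup K G" "compactin Y K"
  shows "K \<subseteq> torus"
proof
  fix a assume a: "a \<in> K"
  then obtain x where x: "x \<in> vecs n" "a = F x"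
    using subgroup.subset[OF K(1)] surjective by blast
  have "c b x = 0" if b: "b \<in> BS" for b
  proof (rule ccontr)
    assume nz: "c b x \<noteq> 0"
    have lin: "linear (c b)" using linear_c b by blast
    \<comment> \<open>An open exhaustion of the group by the size of the coordinate, which is well
      defined on the group because \<open>c b\<close> vanishes on the kernel.\<close>
    define U where "U m = F ` {y \<in> vecs n. c b y \<in> {- real m<..<real m}}" for m :: nat
    have Uopen: "openin Y (U m)" for m
    proof -
      have "openin (Euclidean_space n) {y \<in> vecs n. c b y \<in> {- real m<..<real m}}"
        using openin_continuous_map_preimage[OF continuous_map_linear[OF lin, of n], of "{- real m<..<real m}"] by simp
      then show ?thesis using open_map by (simp add: open_map_def U_def)
    qed
    have cover: "K \<subseteq> \<Union> (range U)"
    proof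
      fix y assume "y \<in> K"
      then obtain z where z: "z \<in> vecs n" "y = F z" using subgroup.subset[OF K(1)] surjective by blast
      obtain m :: nat where "\<bar>c b z\<bar> < real m" using reals_Archimedean2 by blast
      then have "y \<in> U m" using z by (auto simp: U_def abs_less_iff)
      then show "y \<in> \<Union> (range U)" by blast
    qed
    have "\<exists>\<F>. finite \<F> \<and> \<F> \<subseteq> range U \<and> K \<subseteq> \<Union> \<F>"
      by (rule compactinD[OF K(2) _ cover]) (use Uopen in auto)
    then obtain M where M: "finite M" "K \<subseteq> (\<Union>m\<in>M. U m)"
      by (metis finite_subset_image)
    obtain m where m: "\<forall>i\<in>M. i \<le> m" using M(1) finite_nat_set_iff_bounded_le by blast
    have KU: "K \<subseteq> U m"
    proof
      fix y assume "y \<in> K"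
      then obtain i where "i \<in> M" "y \<in> U i" using M(2) by blast
      moreover have "real i \<le> real m" using m \<open>i \<in> M\<close> by simp
      ultimately show "y \<in> U m" by (force simp: U_def)
    qed
    \<comment> \<open>All multiples of \<open>x\<close> stay in \<open>K\<close>, but the coordinate
      of this one exceeds the bound \<open>m\<close>.\<close>
    obtain j :: nat where j: "real m / \<bar>c b x\<bar> < real j" using reals_Archimedean2 by blast
    have "F (real i *\<^sub>R x) \<in> K" for i
    proof (induction i)
      case 0
      show ?case using zero subgroup.one_closed[OF K(1)] by (simp only: of_nat_0 scaleR_zero_left)
    next
      case (Suc i)
      have "F (x + real i *\<^sub>R x) = a \<otimes>\<^bsub>G\<^esub> F (real i *\<^sub>R x)" using add x by simp
      also have "\<dots> \<in> K" using a Suc by (intro subgroup.m_closed[OF K(1)])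
      finally have "F (x + real i *\<^sub>R x) \<in> K" .
      moreover have "real (Suc i) *\<^sub>R x = x + real i *\<^sub>R x" by (simp add: scaleR_left_distrib)
      ultimately show ?case by (simp only:)
    qed
    from subsetD[OF KU this[of j]] obtain y where y: "y \<in> vecs n" "\<bar>c b y\<bar> < real m" "F (real j *\<^sub>R x) = F y"
      by (auto simp: U_def abs_less_iff)
    have "real j *\<^sub>R x - y \<in> ker" using eq_iff_ker[of "real j *\<^sub>R x" y] x y by simp
    then have "c b (real j *\<^sub>R x - y) = 0" using kerS b by blast
    then have "c b y = real j * c b x" using lin by (simp add: linear_diff linear_cmul)
    then have "real j * \<bar>c b x\<bar> < real m" using y(2) by (simp add: abs_mult)
    then show False using j nz by (simp add: field_simps)
  qed
  then show "a \<in> torus" using x by (auto simp: torus_def torus_lift_def)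
qed

lemma maximal_compact_subgroup_eq:
  assumes "maximal_compact_subgroup G Y T"
  shows "T = torus"
  using assms subgroup_torus compactin_torus compact_subgroup_in_torus[of T]
  unfolding maximal_compact_subgroup_def by blast

lemma compact_iff: "compact_space Y \<longleftrightarrow> BS = {}"
proof
  assume "compact_space Y"
  then have "compactin Y (carrier G)" by (simp add: compact_space_def topspace_eq)
  then have sub: "carrier G \<subseteq> torus"
    by (intro compact_subgroup_in_torus group.subgroup_self group)
  show "BS = {}"
  proof (rule ccontr)
    assume "BS \<noteq> {}"
    then obtain b where b: "b \<in> BS" by blast
    then have bv: "b \<in> vecs n" using basis_in_vecs by blast
    then have "b \<in> torus_lift" using sub closed torus_lift_preimage by blast
    then have "c b b = 0" using b by (simp add: torus_lift_def)
    then show False using coordinatesD(5)[OF co, of b b] b by simp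
  qed
next
  assume "BS = {}"
  then have "torus_lift = vecs n" unfolding torus_lift_def by simp
  then have "torus = carrier G" unfolding torus_def using surjective by (simp only:)
  then show "compact_space Y" using compactin_torus by (simp add: compact_space_def topspace_eq)
qed

text \<open>\<open>J\<close> parametrises \<open>torus_lift\<close> linearly by
  \<open>vecs m\<close>, and \<open>F \<circ> J\<close> is a discrete cover of the torus. The atlas
  of this cover determines the dimension.\<close>

lemma lie_dim_torus:
  assumes "Hausdorff_space Y" "second_countable Y"
  shows "lie_dim (G\<lparr>carrier := torus\<rparr>) (subtopology Y torus) = card BG"
proof -
  define m where "m = card BG"
  obtain g where g: "bij_betw g {..<m} BG"
    using ex_bij_betw_nat_finite[OF fin(1)] unfolding m_def lessThan_atLeast0 by blast
  have gB: "g i \<in> BG" if "i < m" for i using bij_betwE[OF g] that by simp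
  have ginj: "g i = g j \<longleftrightarrow> i = j" if "i < m" "j < m" for i j
    using g that by (auto simp: bij_betw_def inj_on_def)
  define J where "J x = (\<Sum>i<m. x i *\<^sub>R g i)" for x :: "nat \<Rightarrow> real"
  define Q where "Q x i = (if i < m then c (g i) x else 0)" for x i
  have Jb: "J x = (\<Sum>b\<in>BG. x (inv_into {..<m} g b) *\<^sub>R b)" for x
  proof -
    have "(\<Sum>b\<in>BG. x (inv_into {..<m} g b) *\<^sub>R b) = (\<Sum>i<m. x (inv_into {..<m} g (g i)) *\<^sub>R g i)"
      by (rule sum.reindex_bij_betw[OF g, symmetric])
    also have "\<dots> = J x"
      unfolding J_def using g by (intro sum.cong) (auto simp: bij_betw_def inv_into_f_f)
    finally show ?thesis by simp
  qed
  have JT: "J x \<in> torus_lift" for x unfolding Jb by (rule sum_in_torus_lift)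
  then have Jv: "J x \<in> vecs n" for x by (simp add: torus_lift_def)
  have QJ: "Q (J x) = x" if "x \<in> vecs m" for x
  proof
    fix i
    show "Q (J x) i = x i"
    proof (cases "i < m")
      case True
      have "c (g i) (J x) = (\<Sum>j<m. x j * c (g i) (g j))"
        unfolding J_def using linear_c[of "g i"] gB[OF True] by (simp add: linear_sum linear_cmul)
      also have "\<dots> = (\<Sum>j<m. if j = i then x j else 0)"
        using coordinatesD(5)[OF co, of "g i"] gB True ginj by (intro sum.cong) auto
      finally show ?thesis using True by (simp add: Q_def)
    next
      case False
      then show ?thesis using that by (simp add: Q_def vecs_def)
    qed
  qed
  have JQ: "J (Q x) = x" if "x \<in> torus_lift" for x
  proof -
    have "J (Q x) = (\<Sum>i<m. c (g i) x *\<^sub>R g i)" by (simp add: J_def Q_def)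
    also have "\<dots> = (\<Sum>b\<in>BG. c b x *\<^sub>R b)" by (rule sum.reindex_bij_betw[OF g])
    also have "\<dots> = x" using torus_lift_expansion[OF that] by (rule sym)
    finally show ?thesis .
  qed
  have Qv: "Q x \<in> vecs m" for x by (simp add: Q_def vecs_def)
  have Jdiff: "J x - J y = J (x - y)" for x y
    by (simp add: J_def scaleR_diff_left sum_subtractf)
  \<comment> \<open>A Lipschitz constant of \<open>J\<close>: vectors shorter than
    \<open>\<sigma> / R\<close> go into the ball where \<open>F\<close> has no kernel but 0. The
    summand 1 keeps it positive when \<open>m = 0\<close>.\<close>
  define R where "R = 1 + (\<Sum>i<m. norm1 n (g i))"
  have Rpos: "R > 0" unfolding R_def by (intro add_pos_nonneg sum_nonneg) simp_all
  have Jnorm: "norm1 n (J x) \<le> R * norm1 m x" for x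
  proof -
    have "norm1 n (\<Sum>i\<in>I. x i *\<^sub>R g i) \<le> (\<Sum>i\<in>I. norm1 n (x i *\<^sub>R g i))" for I
    proof (induction I rule: infinite_finite_induct)
      case (insert a I)
      show ?case
        unfolding sum.insert[OF insert.hyps]
        by (rule order.trans[OF norm1_triangle add_left_mono[OF insert.IH]])
    qed (simp_all add: norm1_def)
    then have "norm1 n (J x) \<le> (\<Sum>i<m. \<bar>x i\<bar> * norm1 n (g i))" by (simp add: J_def)
    also have "\<dots> \<le> (\<Sum>i<m. \<bar>x i\<bar> * R)"
    proof (intro sum_mono mult_left_mono)
      fix i assume i: "i \<in> {..<m}"
      have "norm1 n (g i) \<le> (\<Sum>i<m. norm1 n (g i))"
        by (rule member_le_sum[OF i, of "\<lambda>i. norm1 n (g i)"]) simp_all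
      then show "norm1 n (g i) \<le> R" by (simp add: R_def)
    qed simp
    also have "\<dots> = R * norm1 m x" by (simp add: norm1_def sum_distrib_left mult.commute)
    finally show ?thesis .
  qed
  have Jcont: "continuous_map (Euclidean_space m) (Euclidean_space n) J"
    using Jnorm Jv Rpos by (intro lipschitz_continuous_map[of m J n R]) (simp_all add: Jdiff)
  have Qopen: "openin (Euclidean_space n) {x \<in> vecs n. Q x \<in> V}" if V: "openin (Euclidean_space m) V" for V
  proof -
    have "continuous_map (Euclidean_space n) (Euclidean_space m) (\<lambda>x i. if i < m then c (g i) x else 0)"
      unfolding continuous_map_componentwise_Euclidean_space
      using gB linear_c by (auto intro: continuous_map_linear)
    then have "continuous_map (Euclidean_space n) (Euclidean_space m) Q" by (simp add: Q_def[abs_def])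
    from openin_continuous_map_preimage[OF this V] show ?thesis by simp
  qed
  define H where "H = G\<lparr>carrier := torus\<rparr>"
  define Z where "Z = subtopology Y torus"
  define E where "E = F \<circ> J"
  have tsub: "torus \<subseteq> topspace Y" using subgroup.subset[OF subgroup_torus] topspace_eq by simp
  have "vector_cover m H Z E"
  proof (rule vector_cover.intro)
    show "topological_group H Z"
      unfolding H_def Z_def by (rule topological_group_subgroup[OF topological_group subgroup_torus])
    show "continuous_map (Euclidean_space m) Z E"
      unfolding Z_def continuous_map_in_subtopology E_def
      using continuous_map_compose[OF Jcont continuous] JT by (auto simp: torus_def)
    show "open_map (Euclidean_space m) Z E"
      unfolding open_map_def
    proof (intro allI impI)
      fix V assume V: "openin (Euclidean_space m) V"
      have Vv: "V \<subseteq> vecs m" using openin_subset[OF V] by simp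
      have "openin Y (F ` {x \<in> vecs n. Q x \<in> V})" using open_map Qopen[OF V] by (simp add: open_map_def)
      \<comment> \<open>\<open>Q\<close> extends the inverse of \<open>J\<close> to all of
        \<open>vecs n\<close>, and every preimage of a torus point lies in
        \<open>torus_lift\<close>; so the image is the trace on the torus of an open set.\<close>
      moreover have "E ` V = torus \<inter> F ` {x \<in> vecs n. Q x \<in> V}"
      proof (intro equalityI subsetI)
        fix a assume "a \<in> E ` V"
        then obtain v where v: "v \<in> V" "a = F (J v)" by (auto simp: E_def)
        then have "J v \<in> {x \<in> vecs n. Q x \<in> V}" using QJ[of v] Vv Jv by auto
        then show "a \<in> torus \<inter> F ` {x \<in> vecs n. Q x \<in> V}" using v JT by (auto simp: torus_def)
      next
        fix a assume "a \<in> torus \<inter> F ` {x \<in> vecs n. Q x \<in> V}"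
        then obtain x where x: "x \<in> vecs n" "Q x \<in> V" "a = F x" "a \<in> torus" by auto
        then have "J (Q x) = x" by (intro JQ torus_lift_preimage) simp_all
        then show "a \<in> E ` V" using x by (intro image_eqI[of _ _ "Q x"]) (simp_all add: E_def)
      qed
      ultimately show "openin Z (E ` V)" unfolding Z_def openin_subtopology by blast
    qed
    show "E ` vecs m = carrier H"
    proof (intro equalityI subsetI)
      fix a assume "a \<in> E ` vecs m"
      then show "a \<in> carrier H" using JT by (auto simp: E_def H_def torus_def)
    next
      fix a assume "a \<in> carrier H"
      then obtain x where x: "x \<in> torus_lift" "a = F x" by (auto simp: H_def torus_def)
      then show "a \<in> E ` vecs m" using JQ Qv by (intro image_eqI[of _ _ "Q x"]) (simp_all add: E_def)
    qed
    show "E (x + y) = E x \<otimes>\<^bsub>H\<^esub> E y" if "x \<in> vecs m" "y \<in> vecs m" for x y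
    proof -
      have "J (x + y) = J x + J y" by (simp add: J_def scaleR_left_distrib sum.distrib)
      then show ?thesis using add[OF Jv Jv, of x y] by (simp add: E_def H_def)
    qed
  qed
  moreover have "\<sigma> / R > 0" using radius Rpos by simp
  moreover have "x = 0" if x: "x \<in> vecs m" "norm1 m x < \<sigma> / R" "E x = \<one>\<^bsub>H\<^esub>" for x
  proof -
    have "R * norm1 m x < \<sigma>" using x(2) Rpos by (simp add: field_simps)
    then have "J x = 0" using Jnorm[of x] x(3) Jv by (intro discrete) (simp_all add: E_def H_def)
    then have "x = Q 0" using QJ[OF x(1)] by simp
    then show ?thesis using gB linear_c by (auto simp: Q_def fun_eq_iff linear_0)
  qed
  ultimately interpret D: discrete_cover m H Z E "\<sigma> / R"
    by (intro discrete_cover.intro discrete_cover_axioms.intro)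
  have "Hausdorff_space Z" "second_countable Z"
    unfolding Z_def using assms by (simp_all add: Hausdorff_space_subtopology second_countable_subtopology)
  from lie_dim_eq[OF D.lie_structure_atlas[OF this]] show ?thesis
    unfolding H_def Z_def m_def .
qed

subsection \<open>The upper bound\<close>

text \<open>The basis adapted to a quotient takes another spanning set from the kernel; by exchange
  it has the size of \<open>BG\<close>, so the count is the same for all quotients.\<close>

lemma card_kernel_span:
  assumes "independent Q" "Q \<subseteq> ker" "ker \<subseteq> span Q"
  shows "card Q = card BG"
proof -
  have "ker \<subseteq> span BG"
  proof
    fix x assume "x \<in> ker"
    then have "x = (\<Sum>b\<in>BG. c b x *\<^sub>R b)" using ker_torus_lift torus_lift_expansion by blast
    also have "\<dots> \<in> span BG" by (intro span_sum span_scale span_base)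
    finally show "x \<in> span BG" .
  qed
  then have "Q \<subseteq> span BG" using assms(2) by blast
  from independent_span_bound[OF fin(1) assms(1) this] have Q: "finite Q" "card Q \<le> card BG" by simp_all
  have "independent BG" using coordinates_independent[OF co] by (rule independent_mono) blast
  moreover have "BG \<subseteq> span Q" using BG assms(3) by blast
  ultimately have "card BG \<le> card Q" using independent_span_bound[OF Q(1)] by blast
  then show ?thesis using Q(2) by simp
qed

text \<open>In a basis \<open>B\<close> adapted to both kernels, the given generators become a
  homomorphism that is injective with \<open>CS\<close> real and \<open>CG\<close> integral.
  Suitable lifts correspond to an extension with real coordinates \<open>S = B - Q\<close> and
  integral coordinates \<open>Q\<close>, and these sets have the sizes of \<open>BS\<close> and
  \<open>BG\<close>.\<close>

lemma gaschuetz_upper: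
  assumes N: "0 < N" "BS \<noteq> {} \<Longrightarrow> 2 * card BS + card BG \<le> N"
    and H: "topological_group H Z" "Hausdorff_space Z" and f: "open_epimorphism G Y H Z f"
  shows "gaschuetz N G Y H Z f"
proof -
  have fhom: "f \<in> hom G H" and fsurj: "f ` carrier G = carrier H" and fcont: "continuous_map Y Z f"
    and fopen: "open_map Y Z f" using f by (simp_all add: open_epimorphism_def)
  interpret K: vector_cover n H Z "f \<circ> F"
  proof
    show "continuous_map (Euclidean_space n) Z (f \<circ> F)" using continuous fcont by (rule continuous_map_compose)
    show "open_map (Euclidean_space n) Z (f \<circ> F)" using open_map fopen by (rule open_map_compose)
    show "(f \<circ> F) ` vecs n = carrier H" by (simp only: image_comp[symmetric] surjective fsurj)
    show "(f \<circ> F) (x + y) = (f \<circ> F) x \<otimes>\<^bsub>H\<^esub> (f \<circ> F) y" if "x \<in> vecs n" "y \<in> vecs n" for x y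
      using add[OF that] hom_mult[OF fhom closed closed] that by simp
  qed (rule H(1))
  have kerK: "ker \<subseteq> K.ker"
    using hom_one[OF fhom group K.group] by (auto simp: ker_def K.ker_def)
  show ?thesis
    unfolding gaschuetz_def
  proof (intro allI impI, elim conjE)
    fix h assume h: "h ` {..<N} \<subseteq> carrier H" and gen: "topologically_generates H Z (h ` {..<N})"
    have "\<forall>j\<in>{..<N}. \<exists>u. u \<in> vecs n \<and> (f \<circ> F) u = h j"
    proof
      fix j assume "j \<in> {..<N}"
      then have "h j \<in> (f \<circ> F) ` vecs n" using h K.surjective by auto
      then show "\<exists>u. u \<in> vecs n \<and> (f \<circ> F) u = h j" by auto
    qed
    from bchoice[OF this] obtain u where u: "\<forall>j\<in>{..<N}. u j \<in> vecs n \<and> (f \<circ> F) (u j) = h j" ..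
    have hu: "h ` {..<N} = (\<lambda>j. (f \<circ> F) (u j)) ` {..<N}" using u by (intro image_cong) simp_all
    obtain CW CG CS Q d and l :: nat where
      cd: "coordinates n (CW \<union> CG \<union> CS) d" and dis: "CW \<inter> CG = {}" "(CW \<union> CG) \<inter> CS = {}"
      and CW: "\<And>b t. b \<in> CW \<Longrightarrow> t *\<^sub>R b \<in> K.ker" and CG: "CG \<subseteq> K.ker" and l: "l > 0"
      and dS: "\<And>v b. \<lbrakk>v \<in> K.ker; b \<in> CS\<rbrakk> \<Longrightarrow> d b v = 0"
      and dG: "\<And>v b. \<lbrakk>v \<in> K.ker; b \<in> CG\<rbrakk> \<Longrightarrow> real l * d b v \<in> \<int>"
      and Q: "Q \<subseteq> CW \<union> CG" "Q \<subseteq> ker" "ker \<subseteq> span Q"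
      by (rule closed_subgroup_basis[OF K.additive_subgroup_ker K.ker_subset K.seq_closed_ker[OF H(2)]
            additive_subgroup_ker kerK]) (rule that)
    define B where "B = CW \<union> CG \<union> CS"
    note cB = cd[folded B_def]
    have finB: "finite B" and cardB: "card B = n" and Bv: "B \<subseteq> vecs n"
      and lin: "\<And>b. b \<in> B \<Longrightarrow> linear (d b)" by (fact coordinatesD[OF cB])+
    have finC: "finite CS" "finite CG" using finB by (simp_all add: B_def)
    define \<alpha> where "\<alpha> b j = d b (u j)" for b j
    have inj: "torus_injective CS CG N \<alpha>"
      unfolding torus_injective_def
    proof (intro allI impI, elim conjE)
      fix x :: "(nat \<Rightarrow> real) \<Rightarrow> real"
      assume xZ: "\<forall>b\<in>CG. x b \<in> \<int>" and sZ: "\<forall>j<N. (\<Sum>b\<in>CS \<union> CG. x b * \<alpha> b j) \<in> \<int>"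
      \<comment> \<open>The factor \<open>l\<close> clears the denominators of the kernel along
        \<open>CG\<close> and does not affect whether the coefficients vanish.\<close>
      define \<xi> where "\<xi> v = real l * (\<Sum>b\<in>CS \<union> CG. x b * d b v)" for v
      have linB: "linear (d b)" if "b \<in> CS \<union> CG" for b using lin that by (auto simp: B_def)
      have \<xi>: "linear \<xi>"
      proof
        show "\<xi> (v + w) = \<xi> v + \<xi> w" for v w
        proof -
          have "(\<Sum>b\<in>CS \<union> CG. x b * d b (v + w)) = (\<Sum>b\<in>CS \<union> CG. x b * d b v + x b * d b w)"
            using linB by (intro sum.cong) (simp_all add: linear_add distrib_left)
          then show ?thesis by (simp add: \<xi>_def sum.distrib distrib_left)
        qed
        show "\<xi> (t *\<^sub>R v) = t *\<^sub>R \<xi> v" for t v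
        proof -
          have "(\<Sum>b\<in>CS \<union> CG. x b * d b (t *\<^sub>R v)) = (\<Sum>b\<in>CS \<union> CG. t * (x b * d b v))"
            using linB by (intro sum.cong) (simp_all add: linear_cmul)
          then show ?thesis by (simp add: \<xi>_def flip: sum_distrib_left)
        qed
      qed
      have \<xi>ker: "\<xi> v \<in> \<int>" if v: "v \<in> K.ker" for v
      proof -
        have "\<xi> v = (\<Sum>b\<in>CS \<union> CG. x b * (real l * d b v))"
          by (simp add: \<xi>_def sum_distrib_left mult.left_commute)
        also have "\<dots> \<in> \<int>"
        proof (rule Ints_sum)
          fix b assume "b \<in> CS \<union> CG"
          then show "x b * (real l * d b v) \<in> \<int>"
            using dS[OF v, of b] dG[OF v, of b] xZ by (cases "b \<in> CS") (auto intro: Ints_mult)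
        qed
        finally show ?thesis .
      qed
      have \<xi>u: "\<xi> (u j) \<in> \<int>" if "j < N" for j
        using sZ that unfolding \<xi>_def \<alpha>_def by (intro Ints_mult) simp_all
      have zero: "\<xi> v = 0" if "v \<in> vecs n" for v
        by (rule K.generates_annihilator[OF gen[unfolded hu] _ \<xi> \<xi>ker \<xi>u that]) (use u in simp)
      show "\<forall>b\<in>CS \<union> CG. x b = 0"
      proof
        fix b assume b: "b \<in> CS \<union> CG"
        then have bB: "b \<in> B" by (auto simp: B_def)
        have "(\<Sum>a\<in>CS \<union> CG. x a * d a b) = (\<Sum>a\<in>CS \<union> CG. if a = b then x b else 0)"
          using coordinatesD(5)[OF cB _ bB] by (intro sum.cong) (auto simp: B_def)
        also have "\<dots> = x b" using b finC by simp
        finally have "real l * x b = 0" using zero[of b] bB Bv by (auto simp: \<xi>_def)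
        then show "x b = 0" using l by simp
      qed
    qed
    \<comment> \<open>\<open>Q\<close> avoids \<open>CS\<close>, so real coordinates remain real.
      Those in \<open>CG - Q\<close> turn from integral to real, and those in \<open>CW\<close> are
      new.\<close>
    define S where "S = B - Q"
    have QB: "Q \<subseteq> B" using Q(1) by (auto simp: B_def)
    have "independent Q" using coordinates_independent[OF cB] QB by (rule independent_mono)
    then have cardQ: "card Q = card BG" using Q(2,3) by (rule card_kernel_span)
    have BSQ: "B - S = Q" using QB by (auto simp: S_def)
    have cardS: "card S = card BS"
      using card_Diff_subset[OF finite_subset[OF QB finB] QB] cardQ cardB card_sum by (simp add: S_def)
    have I: "CS \<union> CG \<subseteq> B" "CS \<inter> CG = {}" "CS \<subseteq> S" "S \<subseteq> B"
      using dis Q(1) by (auto simp: B_def S_def)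
    have NS: "2 * card S + card (B - S) \<le> N" if "S \<noteq> {}"
    proof -
      have "card S > 0" using that finB by (simp add: S_def card_gt_0_iff)
      then have "BS \<noteq> {}" using cardS by auto
      then show ?thesis using N(2) cardS cardQ BSQ by simp
    qed
    obtain \<beta> where \<beta>: "torus_injective S (B - S) N \<beta>" "\<And>b. b \<in> CS \<Longrightarrow> \<beta> b = \<alpha> b"
      "\<And>b j. b \<in> CG \<Longrightarrow> \<beta> b j - \<alpha> b j \<in> \<int>"
      using torus_injective_extend[OF finB I N(1) NS inj] by blast
    \<comment> \<open>The new lifts differ from \<open>u\<close> by integers along
      \<open>CG\<close>, arbitrarily along \<open>CW\<close> and not at all along \<open>CS\<close>,
      hence by elements of \<open>K.ker\<close>.\<close>
    define w where "w j = (\<Sum>b\<in>B. \<beta> b j *\<^sub>R b)" for j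
    have wv: "w j \<in> vecs n" for j
      unfolding w_def using Bv by (intro subspace_sum[OF subspace_vecs] subspace_scale[OF subspace_vecs]) auto
    have wu: "w j - u j \<in> K.ker" if j: "j < N" for j
    proof -
      have "u j = (\<Sum>b\<in>B. \<alpha> b j *\<^sub>R b)" unfolding \<alpha>_def by (rule coordinatesD(6)[OF cB]) (use u j in simp)
      then have "w j - u j = (\<Sum>b\<in>B. (\<beta> b j - \<alpha> b j) *\<^sub>R b)"
        by (simp add: w_def scaleR_diff_left sum_subtractf)
      also have "\<dots> \<in> K.ker"
      proof (rule additive_subgroup_sum[OF K.additive_subgroup_ker])
        fix b assume "b \<in> B"
        then consider "b \<in> CW" | "b \<in> CG" | "b \<in> CS" by (auto simp: B_def)
        then show "(\<beta> b j - \<alpha> b j) *\<^sub>R b \<in> K.ker"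
        proof cases
          case 1
          then show ?thesis by (rule CW)
        next
          case 2
          then show ?thesis using CG by (intro additive_subgroup_int[OF K.additive_subgroup_ker] \<beta>(3)) auto
        next
          case 3
          then show ?thesis using \<beta>(2) additive_subgroup_simps(1)[OF K.additive_subgroup_ker] by simp
        qed
      qed
      finally show ?thesis .
    qed
    have "topologically_generates G Y ((\<lambda>j. F (w j)) ` {..<N})"
    proof (rule annihilator_generates[OF wv])
      fix \<xi> :: "(nat \<Rightarrow> real) \<Rightarrow> real"
      assume \<xi>: "linear \<xi>" and \<xi>ker: "\<And>x. x \<in> ker \<Longrightarrow> \<xi> x \<in> \<int>" and \<xi>w: "\<And>j. j < N \<Longrightarrow> \<xi> (w j) \<in> \<int>"
      have SB: "S \<union> (B - S) = B" using I by blast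
      \<comment> \<open>The values of \<xi> on the basis are the unknowns of
        \<open>torus_injective\<close>; those on \<open>Q\<close> are integral because
        \<open>Q\<close> lies in the kernel.\<close>
      have "\<forall>b\<in>B - S. \<xi> b \<in> \<int>" using \<xi>ker Q(2) unfolding BSQ by blast
      moreover have "\<forall>j<N. (\<Sum>b\<in>S \<union> (B - S). \<xi> b * \<beta> b j) \<in> \<int>"
      proof (intro allI impI)
        fix j assume "j < N"
        have "\<xi> (w j) = (\<Sum>b\<in>B. \<xi> b * \<beta> b j)"
          using \<xi> by (simp add: w_def linear_sum linear_cmul mult.commute)
        then show "(\<Sum>b\<in>S \<union> (B - S). \<xi> b * \<beta> b j) \<in> \<int>" unfolding SB using \<xi>w[OF \<open>j < N\<close>] by simp
      qed
      ultimately have z: "\<xi> b = 0" if "b \<in> B" for b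
        using torus_injectiveD[OF \<beta>(1), of \<xi> b] that unfolding SB by blast
      show "\<forall>x\<in>vecs n. \<xi> x = 0"
      proof
        fix x assume "x \<in> vecs n"
        then have "\<xi> x = \<xi> (\<Sum>b\<in>B. d b x *\<^sub>R b)" using coordinatesD(6)[OF cB] by metis
        also have "\<dots> = (\<Sum>b\<in>B. d b x * \<xi> b)" using \<xi> by (simp add: linear_sum linear_cmul)
        finally show "\<xi> x = 0" using z by simp
      qed
    qed
    moreover have "f (F (w j)) = h j" if "j < N" for j
      using K.eq_iff_ker[OF wv, of "u j" j] wu[OF that] u that by auto
    moreover have "(\<lambda>j. F (w j)) ` {..<N} \<subseteq> carrier G" using closed[OF wv] by blast
    ultimately show "\<exists>g. g ` {..<N} \<subseteq> carrier G \<and> (\<forall>i<N. f (g i) = h i) \<and>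
        topologically_generates G Y (g ` {..<N})" by (intro exI[of _ "\<lambda>j. F (w j)"]) simp
  qed
qed

end

subsection \<open>The lower bound\<close>

text \<open>Openness of \<open>F\<close> makes the induced map continuous, and continuity of
  \<open>F\<close> makes it open.\<close>

lemma (in vector_cover) factor:
  assumes K: "vector_cover n H Z \<Phi>" and ker: "\<And>x. x \<in> ker \<Longrightarrow> \<Phi> x = \<one>\<^bsub>H\<^esub>"
  obtains f where "open_epimorphism G Y H Z f" "\<And>x. x \<in> vecs n \<Longrightarrow> f (F x) = \<Phi> x"
proof -
  interpret K: vector_cover n H Z \<Phi> by (rule K)
  define f where "f a = \<Phi> (SOME x. x \<in> vecs n \<and> F x = a)" for a
  have fF: "f (F x) = \<Phi> x" if x: "x \<in> vecs n" for x
  proof -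
    define y where "y = (SOME y. y \<in> vecs n \<and> F y = F x)"
    have y: "y \<in> vecs n" "F y = F x"
      using someI[of "\<lambda>y. y \<in> vecs n \<and> F y = F x" x] x unfolding y_def by simp_all
    then have "y - x \<in> ker" using eq_iff_ker[OF y(1) x] by simp
    then have "y - x \<in> K.ker" using ker by (simp add: K.ker_def ker_def)
    then show ?thesis using K.eq_iff_ker[OF y(1) x] by (simp add: f_def y_def)
  qed
  have "open_epimorphism G Y H Z f"
    unfolding open_epimorphism_def
  proof (intro conjI)
    have surjD: "\<exists>x. x \<in> vecs n \<and> a = F x" if "a \<in> carrier G" for a using that surjective by blast
    show "f \<in> hom G H"
    proof (rule homI)
      fix a assume "a \<in> carrier G"
      then show "f a \<in> carrier H" using surjD fF K.closed by metis
    next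
      fix a b assume "a \<in> carrier G" "b \<in> carrier G"
      then obtain x y where "x \<in> vecs n" "a = F x" "y \<in> vecs n" "b = F y" using surjD by blast
      then show "f (a \<otimes>\<^bsub>G\<^esub> b) = f a \<otimes>\<^bsub>H\<^esub> f b" using add[of x y] K.add[of x y] fF by (metis vecs_closed(2))
    qed
    have im: "f ` F ` S = \<Phi> ` S" if "S \<subseteq> vecs n" for S
      unfolding image_image using that fF by (intro image_cong) auto
    show "f ` carrier G = carrier H" using im[of "vecs n"] surjective K.surjective by simp
    show "continuous_map Y Z f"
      unfolding continuous_map_def
    proof (intro conjI allI impI)
      show "f \<in> topspace Y \<rightarrow> topspace Z"
        using \<open>f ` carrier G = carrier H\<close> topspace_eq K.topspace_eq by auto
      fix U assume "openin Z U"
      then have "openin Y (F ` {x \<in> vecs n. \<Phi> x \<in> U})"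
        using open_map K.openin_preimage by (simp add: open_map_def)
      moreover have "F ` {x \<in> vecs n. \<Phi> x \<in> U} = {a \<in> topspace Y. f a \<in> U}"
        using surjective topspace_eq fF closed by (auto simp: image_iff) (metis imageE)
      ultimately show "openin Y {a \<in> topspace Y. f a \<in> U}" by simp
    qed
    show "open_map Y Z f"
      unfolding open_map_def
    proof (intro allI impI)
      fix U assume U: "openin Y U"
      have "openin Z (\<Phi> ` {x \<in> vecs n. F x \<in> U})"
        using K.open_map openin_preimage[OF U] by (simp add: open_map_def)
      moreover have "\<Phi> ` {x \<in> vecs n. F x \<in> U} = f ` U"
      proof -
        have "F ` {x \<in> vecs n. F x \<in> U} = U"
          using openin_subset[OF U] surjective topspace_eq by auto
        then show ?thesis using im[of "{x \<in> vecs n. F x \<in> U}"] by auto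
      qed
      ultimately show "openin Z (f ` U)" by simp
    qed
  qed
  then show ?thesis using fF by (rule that)
qed

section \<open>Powers of the circle as quotients of vector groups\<close>

definition circle_power :: "nat \<Rightarrow> (nat \<Rightarrow> complex) monoid" where
  "circle_power m = \<lparr>carrier = {z. (\<forall>i<m. norm (z i) = 1) \<and> (\<forall>i\<ge>m. z i = 1)},
     mult = \<lambda>z w i. z i * w i, one = \<lambda>_. 1\<rparr>"

abbreviation circle_power_topology :: "nat \<Rightarrow> (nat \<Rightarrow> complex) topology" where
  "circle_power_topology m \<equiv> top_of_set (carrier (circle_power m))"

lemma circle_power_simps [simp]:
  "z \<in> carrier (circle_power m) \<longleftrightarrow> (\<forall>i<m. norm (z i) = 1) \<and> (\<forall>i\<ge>m. z i = 1)"
  "z \<otimes>\<^bsub>circle_power m\<^esub> w = (\<lambda>i. z i * w i)" "\<one>\<^bsub>circle_power m\<^esub> = (\<lambda>_. 1)"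
  by (simp_all add: circle_power_def)

lemma circle_power_nonzero:
  assumes "z \<in> carrier (circle_power m)"
  shows "z i \<noteq> 0"
proof -
  have "norm (z i) = 1" using assms by (cases "i < m") simp_all
  then show ?thesis by auto
qed

lemma group_circle_power: "group (circle_power m)"
proof (rule groupI)
  fix z assume z: "z \<in> carrier (circle_power m)"
  then show "\<exists>w\<in>carrier (circle_power m). w \<otimes>\<^bsub>circle_power m\<^esub> z = \<one>\<^bsub>circle_power m\<^esub>"
    using z circle_power_nonzero[OF z]
    by (intro bexI[of _ "\<lambda>i. inverse (z i)"]) (simp_all add: norm_inverse)
qed (simp_all add: norm_mult mult.assoc)

lemma inv_circle_power:
  assumes z: "z \<in> carrier (circle_power m)"
  shows "inv\<^bsub>circle_power m\<^esub> z = (\<lambda>i. inverse (z i))"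
proof (rule group.inv_equality[OF group_circle_power _ z])
  show "(\<lambda>i. inverse (z i)) \<otimes>\<^bsub>circle_power m\<^esub> z = \<one>\<^bsub>circle_power m\<^esub>"
    using circle_power_nonzero[OF z] by simp
  show "(\<lambda>i. inverse (z i)) \<in> carrier (circle_power m)" using z by (simp add: norm_inverse)
qed

lemma topological_group_circle_power: "topological_group (circle_power m) (circle_power_topology m)"
proof -
  let ?C = "carrier (circle_power m)"
  have "continuous_on (?C \<times> ?C) (\<lambda>(z, w). z \<otimes>\<^bsub>circle_power m\<^esub> w)"
    unfolding case_prod_unfold circle_power_simps
    by (intro continuous_on_coordinatewise_then_product continuous_on_mult
        continuous_on_compose2[OF continuous_on_product_coordinates continuous_on_fst[OF continuous_on_id]]
        continuous_on_compose2[OF continuous_on_product_coordinates continuous_on_snd[OF continuous_on_id]]) auto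
  moreover have "(\<lambda>(z, w). z \<otimes>\<^bsub>circle_power m\<^esub> w) \<in> ?C \<times> ?C \<rightarrow> ?C"
    using monoid.m_closed[OF group.is_monoid[OF group_circle_power]] by auto
  moreover have "continuous_on ?C (\<lambda>z. inv\<^bsub>circle_power m\<^esub> z)"
  proof (rule continuous_on_eq)
    show "continuous_on ?C (\<lambda>z i. inverse (z i))"
    proof (intro continuous_on_coordinatewise_then_product continuous_on_inverse continuous_on_product_coordinates)
      fix i
      show "continuous_on ?C (\<lambda>z. z i)"
        by (rule continuous_on_subset[OF continuous_on_product_coordinates]) simp
      show "\<forall>z\<in>?C. z i \<noteq> 0" using circle_power_nonzero by blast
    qed
  qed (simp only: inv_circle_power)
  moreover have "(\<lambda>z. inv\<^bsub>circle_power m\<^esub> z) \<in> ?C \<rightarrow> ?C"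
    using group.inv_closed[OF group_circle_power] by auto
  ultimately show ?thesis
    unfolding topological_group_def prod_topology_subtopology_eu continuous_map_in_subtopology
      continuous_map_iff_continuous
    using group_circle_power by (simp del: circle_power_simps)
qed

lemma Hausdorff_circle_power: "Hausdorff_space (circle_power_topology m)"
  by (intro Hausdorff_space_subtopology) simp

text \<open>A general dual system \<open>d\<close>, \<open>r\<close> takes the place of the standard
  coordinates, so the kernel can be any lattice with basis \<open>r\<close>. Openness rests on
  \<open>Arg\<close>, which inverts the exponential continuously near 1.\<close>

lemma vector_cover_circle_power:
  assumes lin: "\<And>i. i < n \<Longrightarrow> linear (d i :: (nat \<Rightarrow> real) \<Rightarrow> real)" and r: "\<And>i. i < n \<Longrightarrow> r i \<in> vecs n"
    and dual: "\<And>i j. \<lbrakk>i < n; j < n\<rbrakk> \<Longrightarrow> d i (r j) = (if j = i then 1 else 0)"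
  shows "vector_cover n (circle_power n) (circle_power_topology n)
    (\<lambda>v i. if i < n then cis (2 * pi * d i v) else 1)" (is "vector_cover n ?H ?Z _")
proof -
  define P where "P = (\<lambda>v i. if i < n then cis (2 * pi * d i v) else 1)"
  have dsum: "d i (\<Sum>j<n. t j *\<^sub>R r j) = t i" if i: "i < n" for t i
  proof -
    have "d i (\<Sum>j<n. t j *\<^sub>R r j) = (\<Sum>j<n. t j * d i (r j))"
      using lin[OF i] by (simp add: linear_sum linear_cmul)
    also have "\<dots> = (\<Sum>j<n. if j = i then t j else 0)" using dual[OF i] by (intro sum.cong) auto
    finally show ?thesis using i by simp
  qed
  have sumv: "(\<Sum>j<n. t j *\<^sub>R r j) \<in> vecs n" for t
    using r by (intro subspace_sum[OF subspace_vecs] subspace_scale[OF subspace_vecs]) auto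
  have hom: "P (x + y) = P x \<otimes>\<^bsub>?H\<^esub> P y" for x y
    using lin by (auto simp: P_def fun_eq_iff linear_add distrib_left cis_mult)
  have \<Phi>H: "P x \<in> carrier ?H" for x by (simp add: P_def)
  have cisArg: "cis (2 * pi * (Arg w / (2 * pi))) = w" if "norm w = 1" for w
  proof -
    have "w \<noteq> 0" using that by auto
    then show ?thesis using that by (simp add: cis_Arg sgn_eq)
  qed
  have "vector_cover n ?H ?Z P"
  proof
    show "topological_group ?H ?Z" by (rule topological_group_circle_power)
    have "continuous_map (Euclidean_space n) euclidean (\<lambda>v. P v i)" for i
    proof (cases "i < n")
      case True
      have "continuous_map euclideanreal euclidean (\<lambda>t. cis (2 * pi * t))"
        unfolding continuous_map_iff_continuous2 by (intro continuous_intros)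
      from continuous_map_compose[OF continuous_map_linear[OF lin[OF True]] this] True
      show ?thesis by (simp add: o_def P_def)
    qed (simp add: P_def)
    then have "continuous_map (Euclidean_space n) euclidean P"
      unfolding euclidean_product_topology[symmetric] continuous_map_componentwise_UNIV by blast
    then show "continuous_map (Euclidean_space n) ?Z P"
      using \<Phi>H by (simp only: continuous_map_in_subtopology) blast
    show "P ` vecs n = carrier ?H"
    proof (intro equalityI subsetI)
      fix z assume "z \<in> P ` vecs n"
      then show "z \<in> carrier ?H" using \<Phi>H by blast
    next
      fix z assume z: "z \<in> carrier ?H"
      have "P (\<Sum>j<n. (Arg (z j) / (2 * pi)) *\<^sub>R r j) = z"
      proof
        fix i show "P (\<Sum>j<n. (Arg (z j) / (2 * pi)) *\<^sub>R r j) i = z i"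
          using z dsum[of i] cisArg[of "z i"] by (cases "i < n") (simp_all add: P_def)
      qed
      then have "z = P (\<Sum>j<n. (Arg (z j) / (2 * pi)) *\<^sub>R r j)" by (rule sym)
      then show "z \<in> P ` vecs n" using sumv[of "\<lambda>j. Arg (z j) / (2 * pi)"] by (rule image_eqI)
    qed
    show "open_map (Euclidean_space n) ?Z P"
      unfolding open_map_def
    proof (intro allI impI)
      fix V assume V: "openin (Euclidean_space n) V"
      have Vv: "V \<subseteq> vecs n" using openin_subset[OF V] by simp
      show "openin ?Z (P ` V)"
        unfolding openin_subopen[of _ "P ` V"]
      proof
        fix z0 assume "z0 \<in> P ` V"
        then obtain v0 where v0: "v0 \<in> V" "z0 = P v0" by blast
        then have v0v: "v0 \<in> vecs n" using Vv by blast
        obtain e where e: "e > 0" "\<And>v. \<lbrakk>v \<in> vecs n; norm1 n (v - v0) < e\<rbrakk> \<Longrightarrow> v \<in> V"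
          using openin_Euclidean_norm1D[OF V v0(1)] by blast
        \<comment> \<open>A combination of the \<open>r j\<close> with coefficients below
          \<open>e / R\<close> has norm below \<open>e\<close>; the summand 1 makes this
          strict.\<close>
        define R where "R = 1 + (\<Sum>j<n. norm1 n (r j))"
        have Rpos: "R > 0" unfolding R_def by (intro add_pos_nonneg sum_nonneg) simp_all
        have "isCont Arg 1" by (intro continuous_at_Arg) simp
        then obtain \<delta> where \<delta>: "\<delta> > 0" "\<And>w. dist w 1 < \<delta> \<Longrightarrow> \<bar>Arg w\<bar> < e / R"
          unfolding continuous_at_eps_delta using e(1) Rpos
          by (metis Arg_1 diff_zero dist_real_def divide_pos_pos)
        define T where "T = carrier ?H \<inter> {z. \<forall>i\<in>{..<n}. dist (z i) (z0 i) < \<delta>}"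
        have "open {z. \<forall>i\<in>{..<n}. dist (z i) (z0 i) < \<delta>}"
        proof -
          have "open {z :: nat \<Rightarrow> complex. dist (z i) (z0 i) < \<delta>}" for i
            by (intro open_Collect_less continuous_on_dist continuous_on_const continuous_on_product_coordinates)
          then have "open (\<Inter>i\<in>{..<n}. {z :: nat \<Rightarrow> complex. dist (z i) (z0 i) < \<delta>})" by (intro open_INT) simp_all
          moreover have "(\<Inter>i\<in>{..<n}. {z :: nat \<Rightarrow> complex. dist (z i) (z0 i) < \<delta>})
              = {z. \<forall>i\<in>{..<n}. dist (z i) (z0 i) < \<delta>}" by blast
          ultimately show ?thesis by simp
        qed
        then have "openin ?Z T" unfolding T_def by (rule openin_open_Int)
        moreover have "z0 \<in> T" using \<Phi>H[of v0] v0(2) \<delta>(1) by (simp add: T_def)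
        moreover have "T \<subseteq> P ` V"
        proof
          fix z assume z: "z \<in> T"
          \<comment> \<open>The phases of \<open>z\<close> relative to \<open>z0\<close> are the
            coordinates of the displacement from \<open>v0\<close>.\<close>
          define t where "t i = Arg (z i / z0 i) / (2 * pi)" for i
          have n1: "norm (z i) = 1" "norm (z0 i) = 1" "z0 i \<noteq> 0" if "i < n" for i
            using z that by (auto simp: T_def v0(2) P_def)
          have t: "\<bar>t i\<bar> < e / R" if i: "i < n" for i
          proof -
            have "z i / z0 i - 1 = (z i - z0 i) / z0 i" using n1(3)[OF i] by (simp add: diff_divide_distrib)
            then have "dist (z i / z0 i) 1 = dist (z i) (z0 i)"
              using n1(2)[OF i] by (simp add: dist_norm norm_divide)
            then have "\<bar>Arg (z i / z0 i)\<bar> < e / R" using z i by (intro \<delta>(2)) (simp add: T_def)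
            moreover have "\<bar>t i\<bar> \<le> \<bar>Arg (z i / z0 i)\<bar>"
              using pi_gt3 by (simp add: t_def abs_divide divide_le_eq mult_le_cancel_left1)
            ultimately show ?thesis by linarith
          qed
          define y where "y = (\<Sum>j<n. t j *\<^sub>R r j)"
          have "norm1 n y \<le> (\<Sum>j<n. \<bar>t j\<bar> * norm1 n (r j))"
          proof -
            have "norm1 n y = (\<Sum>i<n. \<bar>\<Sum>j<n. t j * r j i\<bar>)" by (simp add: y_def norm1_def)
            also have "\<dots> \<le> (\<Sum>i<n. \<Sum>j<n. \<bar>t j\<bar> * \<bar>r j i\<bar>)"
              by (intro sum_mono order.trans[OF sum_abs]) (simp add: abs_mult)
            also have "\<dots> = (\<Sum>j<n. \<bar>t j\<bar> * norm1 n (r j))"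
              by (subst sum.swap) (simp add: norm1_def sum_distrib_left)
            finally show ?thesis .
          qed
          also have "\<dots> \<le> (\<Sum>j<n. e / R * norm1 n (r j))"
            using t by (intro sum_mono mult_right_mono) (auto simp: less_imp_le)
          also have "\<dots> = e / R * (R - 1)" by (simp add: R_def sum_distrib_left)
          also have "\<dots> < e / R * R" using e(1) Rpos by (intro mult_strict_left_mono) simp_all
          also have "\<dots> = e" using Rpos by simp
          finally have "norm1 n y < e" .
          moreover have y: "y \<in> vecs n" unfolding y_def by (rule sumv)
          ultimately have yV: "v0 + y \<in> V" using v0v by (intro e(2)) simp_all
          have "P (v0 + y) = z"
          proof
            fix i
            show "P (v0 + y) i = z i"
            proof (cases "i < n")
              case True
              have "P y i = cis (2 * pi * (Arg (z i / z0 i) / (2 * pi)))"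
                unfolding y_def using dsum[OF True] True by (simp add: t_def P_def)
              also have "\<dots> = z i / z0 i" by (rule cisArg) (simp add: norm_divide n1[OF True])
              finally have "P y i = z i / z0 i" .
              moreover have "P (v0 + y) i = P v0 i * P y i"
                unfolding hom circle_power_simps by simp
              ultimately show ?thesis using n1(3)[OF True] v0(2) by simp
            next
              case False
              then show ?thesis using z by (simp add: T_def P_def)
            qed
          qed
          then have "z = P (v0 + y)" by (rule sym)
          then show "z \<in> P ` V" using yV by (rule image_eqI)
        qed
        ultimately show "\<exists>T. openin ?Z T \<and> z0 \<in> T \<and> T \<subseteq> P ` V" by blast
      qed
    qed
  qed (rule hom)
  then show ?thesis unfolding P_def .
qed

section \<open>Linear independence of 1 and the square root of 2 over the integers\<close>

lemma square_eq_double_square: "a * a = 2 * (b * b) \<Longrightarrow> b = (0::nat)"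
proof (induction b arbitrary: a rule: less_induct)
  case (less b)
  show ?case
  proof (rule ccontr)
    assume b: "b \<noteq> 0"
    have "even (a * a)" using less.prems by simp
    then obtain c where c: "a = 2 * c" by auto
    then have cb: "b * b = 2 * (c * c)" using less.prems by simp
    then have "even (b * b)" by simp
    then obtain d where d: "b = 2 * d" by auto
    then have "c * c = 2 * (d * d)" using cb by simp
    moreover have "d < b" using d b by simp
    ultimately have "d = 0" using less.IH by blast
    then show False using d b by simp
  qed
qed

lemma sqrt2_linear_independent:
  fixes a b :: int
  assumes "of_int a + sqrt 2 * of_int b = (0::real)"
  shows "a = 0" "b = 0"
proof -
  have "real_of_int a = - (sqrt 2 * of_int b)" using assms by linarith
  then have "real_of_int a * of_int a = (sqrt 2 * sqrt 2) * (of_int b * of_int b)" by simp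
  then have "real_of_int (a * a) = real_of_int (2 * (b * b))" by simp
  then have "a * a = 2 * (b * b)" by (simp only: of_int_eq_iff)
  then have "nat \<bar>a\<bar> * nat \<bar>a\<bar> = 2 * (nat \<bar>b\<bar> * nat \<bar>b\<bar>)"
    by (metis abs_mult abs_numeral nat_abs_mult_distrib nat_numeral)
  then have "nat \<bar>b\<bar> = 0" by (rule square_eq_double_square)
  then show "b = 0" by simp
  then show "a = 0" using assms by simp
qed

lemma cis_eq_1_imp_int:
  assumes "cis (2 * pi * x) = 1"
  shows "x \<in> \<int>"
proof -
  have "cos (2 * pi * x) = 1" using assms by (simp add: complex_eq_iff)
  then obtain m :: int where "2 * pi * x = of_int m * 2 * pi" using cos_one_2pi_int by blast
  then have "x = of_int m" by simp
  then show ?thesis by simp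
qed

context kernel_coordinates
begin

text \<open>The coordinates map \<open>G\<close> onto the torus of dimension \<open>n\<close>, which is generated by the images of
  \<open>sqrt 2\<close> times the basis vectors. For any lifts of these generators, a functional with
  coefficients in the ring generated by \<open>sqrt 2\<close> takes integral values on them as soon as \<open>N\<close>
  integral linear equations in \<open>N + 1\<close> unknowns hold.\<close>

lemma gaschuetz_lower:
  assumes BS: "BS \<noteq> {}" and N: "N + 1 = 2 * card BS + card BG"
  obtains H :: "(nat \<Rightarrow> complex) monoid" and Z f where "topological_group H Z" "Hausdorff_space Z"
    "open_epimorphism G Y H Z f" "\<not> gaschuetz N G Y H Z f"
proof -
  define B where "B = BG \<union> BS"
  note cB = co[folded B_def]
  have finB: "finite B" and cardB: "card B = n" by (fact coordinatesD(1,2)[OF cB])+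
  have "card BS > 0" using BS fin(2) by (simp add: card_gt_0_iff)
  then have nN: "n \<le> N" using N card_sum by linarith
  obtain \<beta> where \<beta>: "bij_betw \<beta> {..<n} B"
    using ex_bij_betw_nat_finite[OF finB] unfolding cardB lessThan_atLeast0 by blast
  have \<beta>B: "\<beta> i \<in> B" if "i < n" for i using bij_betwE[OF \<beta>] that by simp
  have \<beta>inj: "\<beta> i = \<beta> j \<longleftrightarrow> i = j" if "i < n" "j < n" for i j
    using \<beta> that by (auto simp: bij_betw_def inj_on_def)
  \<comment> \<open>The factor \<open>k\<close> makes the coordinates along \<open>BG\<close>
    integral on the kernel, so that the map to the circle power factors through the group.
    Coordinates along \<open>BS\<close> vanish on the kernel.\<close>
  define s where "s i = (if \<beta> i \<in> BG then real k else 1)" for i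
  have spos: "s i > 0" for i using k by (simp add: s_def)
  define r where "r i = (1 / s i) *\<^sub>R \<beta> i" for i
  define d where "d i v = s i * c (\<beta> i) v" for i v
  have lin: "linear (d i)" if "i < n" for i
    using linear_compose[OF coordinatesD(4)[OF cB \<beta>B[OF that]], of "\<lambda>x. s i * x"]
    by (simp add: d_def[abs_def] o_def linear_times)
  have rv: "r i \<in> vecs n" if "i < n" for i
    using coordinatesD(3)[OF cB] \<beta>B[OF that] unfolding r_def by (intro subspace_scale[OF subspace_vecs]) auto
  have dual: "d i (r j) = (if j = i then 1 else 0)" if "i < n" "j < n" for i j
  proof -
    have "c (\<beta> i) (r j) = (1 / s j) * c (\<beta> i) (\<beta> j)"
      unfolding r_def using coordinatesD(4)[OF cB \<beta>B[OF that(1)]] by (simp add: linear_cmul)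
    then show ?thesis
      using coordinatesD(5)[OF cB \<beta>B[OF that(1)] \<beta>B[OF that(2)]] \<beta>inj[OF that] spos[of i]
      by (auto simp: d_def)
  qed
  have expand: "x = (\<Sum>i<n. d i x *\<^sub>R r i)" if "x \<in> vecs n" for x
  proof -
    have "x = (\<Sum>b\<in>B. c b x *\<^sub>R b)" by (rule coordinatesD(6)[OF cB that])
    also have "\<dots> = (\<Sum>i<n. c (\<beta> i) x *\<^sub>R \<beta> i)" by (rule sum.reindex_bij_betw[OF \<beta>, symmetric])
    also have "\<dots> = (\<Sum>i<n. d i x *\<^sub>R r i)"
    proof (rule sum.cong[OF refl])
      fix i show "c (\<beta> i) x *\<^sub>R \<beta> i = d i x *\<^sub>R r i"
        using spos[of i] by (simp add: d_def r_def)
    qed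
    finally show ?thesis .
  qed
  have dker: "d i x \<in> \<int>" "\<beta> i \<in> BS \<Longrightarrow> d i x = 0" if "x \<in> ker" "i < n" for i x
  proof -
    show 0: "d i x = 0" if "\<beta> i \<in> BS" using kerS[OF \<open>x \<in> ker\<close> that] by (simp add: d_def)
    show "d i x \<in> \<int>"
    proof (cases "\<beta> i \<in> BG")
      case True
      then show ?thesis using kerG[OF \<open>x \<in> ker\<close> True] by (simp add: d_def s_def)
    next
      case False
      then show ?thesis using 0 \<beta>B[OF \<open>i < n\<close>] by (simp add: B_def)
    qed
  qed
  define P where "P = (\<lambda>v i. if i < n then cis (2 * pi * d i v) else 1)"
  define H where "H = circle_power n"
  define Z where "Z = circle_power_topology n"
  have cover: "vector_cover n H Z P"
    unfolding H_def Z_def P_def by (rule vector_cover_circle_power[OF lin rv dual])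
  interpret K: vector_cover n H Z P by (rule cover)
  have oneH: "\<one>\<^bsub>H\<^esub> = (\<lambda>_. 1)" by (simp add: H_def)
  have Pker: "P x = \<one>\<^bsub>H\<^esub>" if "\<And>i. i < n \<Longrightarrow> d i x \<in> \<int>" for x
    using that by (auto simp: P_def oneH fun_eq_iff)
  have Kker: "d i x \<in> \<int>" if "x \<in> K.ker" "i < n" for i x
  proof -
    have "P x i = 1" using that(1) by (simp add: K.ker_def oneH)
    then show ?thesis using that(2) by (intro cis_eq_1_imp_int) (simp add: P_def)
  qed
  obtain f where f: "open_epimorphism G Y H Z f" "\<And>x. x \<in> vecs n \<Longrightarrow> f (F x) = P x"
    using factor[OF cover] Pker dker(1) by blast
  \<comment> \<open>The first \<open>n\<close> elements already generate; the tuple is filled up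
    with zeros to length \<open>N\<close>.\<close>
  define v where "v j = (if j < n then sqrt 2 *\<^sub>R r j else 0)" for j
  have vv: "v j \<in> vecs n" for j using rv by (simp add: v_def)
  have dv: "d i (v j) = sqrt 2 * (if i = j then 1 else 0)" if "i < n" for i j
    using lin[OF that] dual[OF that] that by (auto simp: v_def linear_cmul linear_0)
  have gen: "topologically_generates H Z ((\<lambda>j. P (v j)) ` {..<N})"
  proof (rule K.annihilator_generates[OF vv])
    fix \<xi> :: "(nat \<Rightarrow> real) \<Rightarrow> real"
    assume \<xi>: "linear \<xi>" and \<xi>ker: "\<And>x. x \<in> K.ker \<Longrightarrow> \<xi> x \<in> \<int>" and \<xi>v: "\<And>j. j < N \<Longrightarrow> \<xi> (v j) \<in> \<int>"
    have "\<xi> (r i) = 0" if i: "i < n" for i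
    proof -
      have "P (r i) = \<one>\<^bsub>H\<^esub>" by (rule Pker) (simp add: dual i)
      then have "\<xi> (r i) \<in> \<int>" using rv[OF i] by (intro \<xi>ker) (simp add: K.ker_def)
      then obtain a :: int where a: "\<xi> (r i) = of_int a" by (elim Ints_cases)
      have "\<xi> (v i) \<in> \<int>" using i nN by (intro \<xi>v) simp
      then obtain b :: int where b: "\<xi> (v i) = of_int b" by (elim Ints_cases)
      \<comment> \<open>Integral values both at \<open>r i\<close> and at its multiple by
        \<open>sqrt 2\<close> have to be zero.\<close>
      have "of_int (- b) + sqrt 2 * of_int a = (0::real)"
        using i \<xi> by (simp add: v_def linear_cmul flip: a b)
      then show ?thesis using sqrt2_linear_independent(2) a by fastforce
    qed
    then show "\<forall>x\<in>vecs n. \<xi> x = 0"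
    proof (intro ballI)
      fix x assume r0: "\<And>i. i < n \<Longrightarrow> \<xi> (r i) = 0" and x: "x \<in> vecs n"
      have "\<xi> x = \<xi> (\<Sum>i<n. d i x *\<^sub>R r i)" using arg_cong[OF expand[OF x], of \<xi>] .
      also have "\<dots> = (\<Sum>i<n. d i x * \<xi> (r i))" using \<xi> by (simp add: linear_sum linear_cmul)
      finally show "\<xi> x = 0" using r0 by simp
    qed
  qed
  have "\<not> gaschuetz N G Y H Z f"
  proof
    assume gas: "gaschuetz N G Y H Z f"
    have "(\<lambda>j. P (v j)) ` {..<N} \<subseteq> carrier H" using K.closed[OF vv] by blast
    then obtain g where g: "g ` {..<N} \<subseteq> carrier G" "\<forall>j<N. f (g j) = P (v j)"
      "topologically_generates G Y (g ` {..<N})"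
      using gas gen unfolding gaschuetz_def by blast
    have "\<forall>j\<in>{..<N}. \<exists>w. w \<in> vecs n \<and> F w = g j"
    proof
      fix j assume "j \<in> {..<N}"
      then have "g j \<in> F ` vecs n" using g(1) surjective by auto
      then show "\<exists>w. w \<in> vecs n \<and> F w = g j" by auto
    qed
    from bchoice[OF this] obtain w where w: "\<forall>j\<in>{..<N}. w j \<in> vecs n \<and> F (w j) = g j" ..
    have gw: "g ` {..<N} = (\<lambda>j. F (w j)) ` {..<N}" using w by (intro image_cong) simp_all
    \<comment> \<open>The lifts can differ from \<open>v\<close> only by integers in these
      coordinates, so the rounding is exact.\<close>
    define z where "z j i = \<lfloor>d i (w j) - d i (v j)\<rfloor>" for j i
    have dw: "d i (w j) = sqrt 2 * (if i = j then 1 else 0) + of_int (z j i)" if "j < N" "i < n" for i j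
    proof -
      have wj: "w j \<in> vecs n" using w that(1) by simp
      have "P (w j) = P (v j)" using f(2)[OF wj] w g(2) that(1) by auto
      then have "w j - v j \<in> K.ker" using K.eq_iff_ker[OF wj vv] by simp
      then have "d i (w j - v j) \<in> \<int>" using that(2) by (rule Kker)
      then have "d i (w j) - d i (v j) \<in> \<int>" using lin[OF that(2)] by (simp add: linear_diff)
      then have "of_int (z j i) = d i (w j) - d i (v j)" by (simp add: z_def of_int_floor)
      then show ?thesis using dv[OF that(2)] by simp
    qed
    define I where "I = {i. i < n \<and> \<beta> i \<in> BS}"
    have finI: "finite I" by (simp add: I_def)
    have "\<beta> ` I = BS"
      using \<beta> unfolding bij_betw_def I_def B_def by (force simp: image_iff)
    moreover have "inj_on \<beta> I" using \<beta>inj by (auto simp: inj_on_def I_def)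
    ultimately have cardI: "card I = card BS" using card_image by fastforce
    \<comment> \<open>Unknown coefficients: \<open>(i, 0)\<close> is an integer for each coordinate,
      and \<open>(i, 1)\<close> multiplies \<open>sqrt 2\<close>. The latter is allowed only along
      \<open>BS\<close>, where the kernel has no component. The total is
      \<open>n + card BS = N + 1\<close>.\<close>
    define U where "U = {..<n} \<times> {0::nat} \<union> I \<times> {1}"
    define M where "M j u = (if snd u = 0 then (if fst u = j then 1 else 0) else z j (fst u))"
      for j and u :: "nat \<times> nat"
    have disjU: "({..<n} \<times> {0::nat}) \<inter> (I \<times> {1}) = {}" by auto
    have "card U = n + card BS"
      unfolding U_def using finI disjU by (subst card_Un_disjoint) (simp_all add: card_cartesian_product cardI)
    then have lt: "card {..<N} < card U" using N card_sum by simp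
    have finU: "finite U" using finI by (simp add: U_def)
    from homogeneous_solution[OF finite_lessThan finU lt, of M]
    obtain x :: "nat \<times> nat \<Rightarrow> int" where x: "\<exists>u\<in>U. x u \<noteq> 0"
      and sol: "\<forall>j\<in>{..<N}. (\<Sum>u\<in>U. M j u * x u) = 0" by blast
    have sumU: "(\<Sum>u\<in>U. h u) = (\<Sum>i<n. h (i, 0)) + (\<Sum>i\<in>I. h (i, 1))" for h :: "nat \<times> nat \<Rightarrow> int"
    proof -
      have "(\<Sum>u\<in>U. h u) = sum h ({..<n} \<times> {0}) + sum h (I \<times> {1})"
        unfolding U_def using finI disjU by (intro sum.union_disjoint) simp_all
      also have "sum h ({..<n} \<times> {0}) = (\<Sum>i<n. h (i, 0))"
        using sum.cartesian_product[of "\<lambda>i u. h (i, u)" "{0}" "{..<n}"] by (simp add: case_prod_eta)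
      also have "sum h (I \<times> {1}) = (\<Sum>i\<in>I. h (i, 1))"
        using sum.cartesian_product[of "\<lambda>i u. h (i, u)" "{1}" I] by (simp add: case_prod_eta)
      finally show ?thesis .
    qed
    \<comment> \<open>Row \<open>j\<close> makes the coefficient of \<open>sqrt 2\<close> in the
      value of \<xi> at \<open>w j\<close> vanish.\<close>
    have eqn: "(if j < n then x (j, 0) else 0) + (\<Sum>i\<in>I. z j i * x (i, 1)) = 0" if "j < N" for j
    proof -
      have "(\<Sum>u\<in>U. M j u * x u) = 0" using sol that by simp
      then have "(\<Sum>i<n. (if i = j then 1 else 0) * x (i, 0)) + (\<Sum>i\<in>I. z j i * x (i, 1)) = 0"
        by (simp add: sumU M_def)
      moreover have "(\<Sum>i<n. (if i = j then 1 else 0) * x (i, 0)) = (\<Sum>i<n. if i = j then x (i, 0) else 0)"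
        by (intro sum.cong) auto
      ultimately show ?thesis by simp
    qed
    define \<xi> where "\<xi> y = (\<Sum>i<n. of_int (x (i, 0)) * d i y) + (\<Sum>i\<in>I. sqrt 2 * of_int (x (i, 1)) * d i y)" for y
    have In: "i < n" if "i \<in> I" for i using that by (simp add: I_def)
    have \<xi>: "linear \<xi>"
    proof
      show "\<xi> (a + b) = \<xi> a + \<xi> b" for a b
      proof -
        have "(\<Sum>i<n. of_int (x (i, 0)) * d i (a + b)) = (\<Sum>i<n. of_int (x (i, 0)) * d i a + of_int (x (i, 0)) * d i b)"
          using lin by (intro sum.cong) (simp_all add: linear_add distrib_left)
        moreover have "(\<Sum>i\<in>I. sqrt 2 * of_int (x (i, 1)) * d i (a + b))
            = (\<Sum>i\<in>I. sqrt 2 * of_int (x (i, 1)) * d i a + sqrt 2 * of_int (x (i, 1)) * d i b)"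
          using lin In by (intro sum.cong) (simp_all add: linear_add distrib_left)
        ultimately show ?thesis unfolding \<xi>_def by (simp add: sum.distrib)
      qed
      show "\<xi> (t *\<^sub>R a) = t *\<^sub>R \<xi> a" for t a
      proof -
        have "(\<Sum>i<n. of_int (x (i, 0)) * d i (t *\<^sub>R a)) = t * (\<Sum>i<n. of_int (x (i, 0)) * d i a)"
          unfolding sum_distrib_left using lin by (intro sum.cong) (simp_all add: linear_cmul)
        moreover have "(\<Sum>i\<in>I. sqrt 2 * of_int (x (i, 1)) * d i (t *\<^sub>R a))
            = t * (\<Sum>i\<in>I. sqrt 2 * of_int (x (i, 1)) * d i a)"
          unfolding sum_distrib_left using lin In by (intro sum.cong) (simp_all add: linear_cmul)
        ultimately show ?thesis unfolding \<xi>_def by (simp add: distrib_left)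
      qed
    qed
    have \<xi>ker: "\<xi> y \<in> \<int>" if y: "y \<in> ker" for y
    proof -
      have "(\<Sum>i\<in>I. sqrt 2 * of_int (x (i, 1)) * d i y) = 0"
        using dker(2)[OF y] by (intro sum.neutral) (simp add: I_def)
      moreover have "(\<Sum>i<n. of_int (x (i, 0)) * d i y) \<in> \<int>"
        using dker(1)[OF y] by (intro Ints_sum Ints_mult) simp_all
      ultimately show ?thesis by (simp add: \<xi>_def)
    qed
    have \<xi>w: "\<xi> (w j) \<in> \<int>" if j: "j < N" for j
    proof -
      have 1: "(\<Sum>i<n. of_int (x (i, 0)) * d i (w j))
          = sqrt 2 * of_int (if j < n then x (j, 0) else 0) + of_int (\<Sum>i<n. x (i, 0) * z j i)"
      proof -
        have "(\<Sum>i<n. of_int (x (i, 0)) * d i (w j))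
            = (\<Sum>i<n. (if i = j then sqrt 2 * of_int (x (i, 0)) else 0) + of_int (x (i, 0) * z j i))"
          using dw[OF j] by (intro sum.cong) (simp_all add: distrib_left)
        then show ?thesis by (simp add: sum.distrib)
      qed
      \<comment> \<open>The product \<open>sqrt 2 * sqrt 2\<close> contributes to the integral
        part.\<close>
      have 2: "(\<Sum>i\<in>I. sqrt 2 * of_int (x (i, 1)) * d i (w j))
          = of_int (2 * (if j \<in> I then x (j, 1) else 0)) + sqrt 2 * of_int (\<Sum>i\<in>I. z j i * x (i, 1))"
      proof -
        have "(\<Sum>i\<in>I. sqrt 2 * of_int (x (i, 1)) * d i (w j))
            = (\<Sum>i\<in>I. (if i = j then of_int (2 * x (i, 1)) else 0) + sqrt 2 * of_int (z j i * x (i, 1)))"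
          using dw[OF j In] by (intro sum.cong) (simp_all add: distrib_left)
        then show ?thesis using finI by (simp add: sum.distrib sum_distrib_left)
      qed
      have "\<xi> (w j) = sqrt 2 * of_int ((if j < n then x (j, 0) else 0) + (\<Sum>i\<in>I. z j i * x (i, 1)))
          + of_int ((\<Sum>i<n. x (i, 0) * z j i) + 2 * (if j \<in> I then x (j, 1) else 0))"
        unfolding \<xi>_def 1 2 by (simp add: distrib_left)
      then show ?thesis unfolding eqn[OF j] by (simp del: of_int_add of_int_sum of_int_mult)
    qed
    have zero: "\<xi> y = 0" if "y \<in> vecs n" for y
      by (rule generates_annihilator[OF g(3)[unfolded gw] _ \<xi> \<xi>ker \<xi>w that]) (use w in simp)
    have coeff: "x (i, 0) = 0 \<and> (i \<in> I \<longrightarrow> x (i, 1) = 0)" if i: "i < n" for i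
    proof -
      have "(\<Sum>l<n. of_int (x (l, 0)) * d l (r i)) = (\<Sum>l<n. if l = i then of_int (x (l, 0)) else 0 :: real)"
        using dual i by (intro sum.cong) auto
      moreover have "(\<Sum>l\<in>I. sqrt 2 * of_int (x (l, 1)) * d l (r i))
          = (\<Sum>l\<in>I. if l = i then sqrt 2 * of_int (x (l, 1)) else 0)"
        using dual i In by (intro sum.cong) auto
      ultimately have "\<xi> (r i) = of_int (x (i, 0)) + sqrt 2 * of_int (if i \<in> I then x (i, 1) else 0)"
        using i finI by (simp add: \<xi>_def)
      then have "of_int (x (i, 0)) + sqrt 2 * of_int (if i \<in> I then x (i, 1) else 0) = (0::real)"
        using zero[OF rv[OF i]] by simp
      from sqrt2_linear_independent[OF this] show ?thesis by (auto split: if_splits)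
    qed
    have "x u = 0" if "u \<in> U" for u using that coeff In by (auto simp: U_def)
    then show False using x by blast
  qed
  moreover have "topological_group H Z" "Hausdorff_space Z"
    unfolding H_def Z_def by (rule topological_group_circle_power, rule Hausdorff_circle_power)
  ultimately show ?thesis using f(1) by (intro that)
qed

subsection \<open>The rank\<close>

lemma gaschuetz_rank_eq:
  "gaschuetz_rank G Y = (if compact_space Y then 1 else enat (2 * n - card BG))"
proof -
  define R where "R = (if compact_space Y then 1 else 2 * card BS + card BG)"
  have R1: "1 \<le> R"
    using compact_iff fin(2) by (auto simp: R_def card_gt_0_iff Suc_le_eq)
  have gas: "\<forall>N\<ge>R. \<forall>(H :: 'a set monoid) Z f.
      topological_group H Z \<and> Hausdorff_space Z \<and> open_epimorphism G Y H Z f \<longrightarrow> gaschuetz N G Y H Z f"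
  proof (intro allI impI, elim conjE)
    fix N and H :: "'a set monoid" and Z f
    assume "R \<le> N" "topological_group H Z" "Hausdorff_space Z" "open_epimorphism G Y H Z f"
    then show "gaschuetz N G Y H Z f"
      using R1 compact_iff by (intro gaschuetz_upper) (auto simp: R_def)
  qed
  have le: "gaschuetz_rank G Y \<le> enat R"
    unfolding gaschuetz_rank_def using R1 gas by (intro Inf_lower) blast
  have "enat R \<le> gaschuetz_rank G Y"
  proof (cases "compact_space Y")
    \<comment> \<open>In the compact case the lower bound is the convention that ranks start at
      1.\<close>
    case True
    then show ?thesis unfolding gaschuetz_rank_def R_def
      by (intro Inf_greatest) (auto simp: one_enat_def)
  next
    case False
    show ?thesis
    proof (rule ccontr)
      assume "\<not> ?thesis"
      then have lt: "gaschuetz_rank G Y < enat R" by simp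
      then obtain q where q: "gaschuetz_rank G Y = enat q" "q < R" by (cases "gaschuetz_rank G Y") auto
      \<comment> \<open>A smaller rank would apply at \<open>N = R - 1\<close> to the circle power,
        whose elements are functions instead of subsets of the group;
        \<open>gaschuetz_rank_all_types\<close> bridges the difference of types.\<close>
      then have rank: "gaschuetz_rank G Y \<le> enat (R - 1)" by simp
      have BS: "BS \<noteq> {}" using False compact_iff by simp
      have "R - 1 + 1 = 2 * card BS + card BG" using R1 False by (simp add: R_def)
      from gaschuetz_lower[OF BS this]
      obtain H :: "(nat \<Rightarrow> complex) monoid" and Z f where H: "topological_group H Z" "Hausdorff_space Z"
        "open_epimorphism G Y H Z f" "\<not> gaschuetz (R - 1) G Y H Z f" by blast
      then show False using gaschuetz_rank_all_types[OF group rank H(1-3)] by blast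
    qed
  qed
  then have "gaschuetz_rank G Y = enat R" using le by simp
  \<comment> \<open>The truncated subtraction is exact, since \<open>card BG\<close> is at most
    \<open>n\<close>.\<close>
  moreover have "2 * n - card BG = 2 * card BS + card BG" using card_sum by linarith
  ultimately show ?thesis by (simp add: R_def one_enat_def)
qed

end

theorem theorem1p5:
  fixes A :: "('a, 'b) monoid_scheme" and X :: "'a topology" and T :: "'a set"
  assumes "lie_group A X" and "comm_group A" and "connected_space X"
    and "maximal_compact_subgroup A X T"
  shows "gaschuetz_rank A X =
    (if compact_space X then 1
     else enat (2 * lie_dim A X - lie_dim (A\<lparr>carrier := T\<rparr>) (subtopology X T)))"
proof -
  obtain n \<A> where lie: "lie_structure n A X \<A>" using assms(1) by (auto simp: lie_group_def)
  then have X: "Hausdorff_space X" "second_countable X" by (simp_all add: lie_structure_def)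
  obtain F \<sigma> where F: "vector_cover n A X F" "\<sigma> > 0"
    "\<And>x. \<lbrakk>x \<in> vecs n; norm1 n x < \<sigma>; F x = \<one>\<^bsub>A\<^esub>\<rbrakk> \<Longrightarrow> x = 0"
    using lie_structure_vector_cover[OF lie assms(2,3)] by blast
  interpret discrete_cover n A X F \<sigma>
    by (intro discrete_cover.intro discrete_cover_axioms.intro F)
  obtain BG BS c and k :: nat where b: "coordinates n (BG \<union> BS) c" "BG \<inter> BS = {}" "BG \<subseteq> ker" "k > 0"
    "\<And>v b. \<lbrakk>v \<in> ker; b \<in> BS\<rbrakk> \<Longrightarrow> c b v = 0" "\<And>v b. \<lbrakk>v \<in> ker; b \<in> BG\<rbrakk> \<Longrightarrow> real k * c b v \<in> \<int>"
    by (rule kernel_basis[OF X(1)]) (rule that)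
  interpret kernel_coordinates n A X F \<sigma> BG BS c k
    by (intro kernel_coordinates.intro kernel_coordinates_axioms.intro discrete_cover_axioms assms(2) b)
  have "T = torus" using assms(4) by (rule maximal_compact_subgroup_eq)
  then have "lie_dim (A\<lparr>carrier := T\<rparr>) (subtopology X T) = card BG"
    using lie_dim_torus[OF X] by simp
  moreover have "lie_dim A X = n" by (rule lie_dim_eq[OF lie])
  ultimately show ?thesis using gaschuetz_rank_eq by simp
qed

end
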